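(* Let $p$ be a prime and let $G$ be a locally compact abelian $p$-group. The following statements are equivalent: (a) $G$ is topologically modular. (b) For every open compact subgroup $U$ of $G$, exactly one of the following holds: (b.1) $U$ has finite $p$-rank, $\mathrm{tor}(G)$ is discrete, and $G/\mathrm{tor}(G)$ has finite $p$-rank. (b.2) $U$ has infinite $p$-rank, $\mathrm{div}(G)$ is closed, $G/U$ and $\mathrm{div}(G)$ both have finite $p$-rank, and $G/\mathrm{div}(G)$ is compact. (c) $G$ is strongly topologically quasihamiltonian.
   Context: All topological groups are Hausdorff; abelian groups are written additively. A locally compact abelian (LCA) group is periodic if it is totally disconnected and the union of its compact subgroups. For a prime $p$, an element $x$ of an LCA group is a $p$-element if $p^kx\to 0$ as $k\to\infty$; a locally compact abelian $p$-group is a periodic LCA group all of whose elements are $p$-elements. For closed subgroups $A,B$ of an LCA group $G$ put $A\vee B=\overline{A+B}$ and $A\wedge B=A\cap B$. $G$ is topologically modular if $A\vee(B\wedge C)=(A\vee B)\wedge C$ for all closed subgroups $A,B,C$ of $G$ with $A\subseteq C$. $G$ is strongly topologically quasihamiltonian if $X+Y$ is closed in $G$ for all closed subgroups $X,Y$ of $G$. $\mathrm{tor}(G)$ is the set (subgroup) of elements of finite order and $\mathrm{div}(G)$ is the largest divisible subgroup of $G$. A closed subgroup is finitely generated if it is the closure of the subgroup generated by a finite subset. A locally compact abelian $p$-group has finite $p$-rank $n$ if every finitely generated closed subgroup can be topologically generated by at most $n$ elements and $n$ is minimal with this property; if there is no such $n$, its $p$-rank is infinite. *)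

theory Defs
  imports "HOL-Analysis.Analysis" "HOL-Computational_Algebra.Primes" "HOL-Algebra.Generated_Groups"
begin

text \<open>
  Topological groups are pairs of a group in the sense of HOL-Algebra and a topology on its carrier,
  so that subgroups and quotients are again objects of the same kind. HOL-Algebra groups are
  multiplicative: the additive \<open>kx\<close> is \<open>x [^] k\<close>, and \<open>A + B\<close> is \<open>A <#> B\<close>.
\<close>

locale topological_comm_group = comm_group G for G (structure) +
  fixes T :: "'a topology"
  assumes topspace_eq: "topspace T = carrier G"
    and continuous_mult: "continuous_map (prod_topology T T) T (\<lambda>(x, y). x \<otimes> y)"
    and continuous_inv: "continuous_map T T (\<lambda>x. inv x)"
    and Hausdorff: "Hausdorff_space T"

locale lca_group = topological_comm_group +
  assumes locally_compact: "locally_compact_space T"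

definition totally_disconnected :: "'a topology \<Rightarrow> bool" where
  "totally_disconnected T \<longleftrightarrow> (\<forall>x \<in> topspace T. connected_component_of_set T x = {x})"

locale periodic_lca_group = lca_group +
  assumes totally_disconnected: "totally_disconnected T"
    and Union_compact_subgroups: "carrier G = \<Union>{K. subgroup K G \<and> compactin T K}"

definition p_element :: "nat \<Rightarrow> ('a, 'm) monoid_scheme \<Rightarrow> 'a topology \<Rightarrow> 'a \<Rightarrow> bool" where
  "p_element p G T x \<longleftrightarrow> limitin T (\<lambda>k::nat. x [^]\<^bsub>G\<^esub> (p ^ k)) \<one>\<^bsub>G\<^esub> sequentially"

locale lca_p_group = periodic_lca_group +
  fixes p :: nat
  assumes prime: "prime p"
    and all_p_elements: "x \<in> carrier G \<Longrightarrow> p_element p G T x"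

definition closed_subgroup :: "('a, 'm) monoid_scheme \<Rightarrow> 'a topology \<Rightarrow> 'a set \<Rightarrow> bool" where
  "closed_subgroup G T H \<longleftrightarrow> subgroup H G \<and> closedin T H"

definition closed_join :: "('a, 'm) monoid_scheme \<Rightarrow> 'a topology \<Rightarrow> 'a set \<Rightarrow> 'a set \<Rightarrow> 'a set" where
  "closed_join G T A B = T closure_of (A <#>\<^bsub>G\<^esub> B)"

definition topologically_modular :: "('a, 'm) monoid_scheme \<Rightarrow> 'a topology \<Rightarrow> bool" where
  "topologically_modular G T \<longleftrightarrow>
    (\<forall>A B C. closed_subgroup G T A \<longrightarrow> closed_subgroup G T B \<longrightarrow> closed_subgroup G T C \<longrightarrow> A \<subseteq> C \<longrightarrow>
      closed_join G T A (B \<inter> C) = closed_join G T A B \<inter> C)"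

definition strongly_topologically_quasihamiltonian ::
    "('a, 'm) monoid_scheme \<Rightarrow> 'a topology \<Rightarrow> bool" where
  "strongly_topologically_quasihamiltonian G T \<longleftrightarrow>
    (\<forall>X Y. closed_subgroup G T X \<longrightarrow> closed_subgroup G T Y \<longrightarrow> closedin T (X <#>\<^bsub>G\<^esub> Y))"

definition tor :: "('a, 'm) monoid_scheme \<Rightarrow> 'a set" where
  "tor G = {x \<in> carrier G. \<exists>n::nat. n > 0 \<and> x [^]\<^bsub>G\<^esub> n = \<one>\<^bsub>G\<^esub>}"

definition divisible_subgroup :: "('a, 'm) monoid_scheme \<Rightarrow> 'a set \<Rightarrow> bool" where
  "divisible_subgroup G D \<longleftrightarrow>
    subgroup D G \<and> (\<forall>x \<in> D. \<forall>n::nat. n > 0 \<longrightarrow> (\<exists>y \<in> D. y [^]\<^bsub>G\<^esub> n = x))"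

text \<open>The greatest element with respect to inclusion; it exists in every abelian group,
  see \<open>divisible_part_greatest\<close> below.\<close>

definition divisible_part :: "('a, 'm) monoid_scheme \<Rightarrow> 'a set" where
  "divisible_part G = (GREATEST D. divisible_subgroup G D)"

definition topologically_generates ::
    "('a, 'm) monoid_scheme \<Rightarrow> 'a topology \<Rightarrow> 'a set \<Rightarrow> 'a set \<Rightarrow> bool" where
  "topologically_generates G T F H \<longleftrightarrow> F \<subseteq> carrier G \<and> H = T closure_of (generate G F)"

definition p_rank_le :: "('a, 'm) monoid_scheme \<Rightarrow> 'a topology \<Rightarrow> nat \<Rightarrow> bool" where
  "p_rank_le G T n \<longleftrightarrow>
    (\<forall>H. closed_subgroup G T H \<longrightarrow> (\<exists>F. finite F \<and> topologically_generates G T F H) \<longrightarrow>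
      (\<exists>F. finite F \<and> card F \<le> n \<and> topologically_generates G T F H))"

text \<open>As in the source, the definition of the \<open>p\<close>-rank does not mention \<open>p\<close>;
  it is only meaningful for locally compact abelian \<open>p\<close>-groups.\<close>

definition has_p_rank :: "('a, 'm) monoid_scheme \<Rightarrow> 'a topology \<Rightarrow> nat \<Rightarrow> bool" where
  "has_p_rank G T n \<longleftrightarrow> p_rank_le G T n \<and> (\<forall>m < n. \<not> p_rank_le G T m)"

definition finite_p_rank :: "('a, 'm) monoid_scheme \<Rightarrow> 'a topology \<Rightarrow> bool" where
  "finite_p_rank G T \<longleftrightarrow> (\<exists>n. has_p_rank G T n)"

abbreviation infinite_p_rank :: "('a, 'm) monoid_scheme \<Rightarrow> 'a topology \<Rightarrow> bool" where
  "infinite_p_rank G T \<equiv> \<not> finite_p_rank G T"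

abbreviation subgroup_of :: "('a, 'm) monoid_scheme \<Rightarrow> 'a set \<Rightarrow> ('a, 'm) monoid_scheme" where
  "subgroup_of G H \<equiv> G\<lparr>carrier := H\<rparr>"

definition quotient_topology :: "('a, 'm) monoid_scheme \<Rightarrow> 'a topology \<Rightarrow> 'a set \<Rightarrow> 'a set topology" where
  "quotient_topology G T H =
    topology (\<lambda>V. V \<subseteq> carrier (G Mod H) \<and> openin T {x \<in> topspace T. H #>\<^bsub>G\<^esub> x \<in> V})"

lemma openin_quotient_topology:
  "openin (quotient_topology G T H) V \<longleftrightarrow>
    V \<subseteq> carrier (G Mod H) \<and> openin T {x \<in> topspace T. H #>\<^bsub>G\<^esub> x \<in> V}"
proof -
  have "istopology (\<lambda>V. V \<subseteq> carrier (G Mod H) \<and> openin T {x \<in> topspace T. H #>\<^bsub>G\<^esub> x \<in> V})"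
    unfolding istopology_def
  proof (intro conjI allI impI)
    fix S S' :: "'a set set"
    assume S: "S \<subseteq> carrier (G Mod H) \<and> openin T {x \<in> topspace T. H #>\<^bsub>G\<^esub> x \<in> S}"
      and S': "S' \<subseteq> carrier (G Mod H) \<and> openin T {x \<in> topspace T. H #>\<^bsub>G\<^esub> x \<in> S'}"
    show "S \<inter> S' \<subseteq> carrier (G Mod H)"
      using S by blast
    have "{x \<in> topspace T. H #>\<^bsub>G\<^esub> x \<in> S \<inter> S'} =
        {x \<in> topspace T. H #>\<^bsub>G\<^esub> x \<in> S} \<inter> {x \<in> topspace T. H #>\<^bsub>G\<^esub> x \<in> S'}"
      by blast
    then show "openin T {x \<in> topspace T. H #>\<^bsub>G\<^esub> x \<in> S \<inter> S'}"
      using S S' by (simp add: openin_Int)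
  next
    fix \<K> :: "'a set set set"
    assume K: "\<forall>K\<in>\<K>. K \<subseteq> carrier (G Mod H) \<and> openin T {x \<in> topspace T. H #>\<^bsub>G\<^esub> x \<in> K}"
    then show "\<Union>\<K> \<subseteq> carrier (G Mod H)"
      by blast
    have "{x \<in> topspace T. H #>\<^bsub>G\<^esub> x \<in> \<Union>\<K>} = (\<Union>K\<in>\<K>. {x \<in> topspace T. H #>\<^bsub>G\<^esub> x \<in> K})"
      by blast
    then show "openin T {x \<in> topspace T. H #>\<^bsub>G\<^esub> x \<in> \<Union>\<K>}"
      using K by auto
  qed
  then show ?thesis
    unfolding quotient_topology_def by (simp add: topology_inverse')
qed

lemma (in topological_comm_group) quotient_map_quotient_topology:
  "quotient_map T (quotient_topology G T H) (\<lambda>x. H #> x)"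
proof -
  have "carrier (G Mod H) \<subseteq> topspace (quotient_topology G T H)"
  proof (rule openin_subset)
    have "{x \<in> topspace T. H #> x \<in> carrier (G Mod H)} = topspace T"
      by (auto simp: topspace_eq carrier_FactGroup)
    then show "openin (quotient_topology G T H) (carrier (G Mod H))"
      by (simp add: openin_quotient_topology)
  qed
  then have "topspace (quotient_topology G T H) = carrier (G Mod H)"
    by (meson openin_quotient_topology openin_topspace subset_antisym)
  then show ?thesis
    by (simp add: quotient_map_def openin_quotient_topology topspace_eq carrier_FactGroup)
qed

lemma (in comm_group) divisible_subgroup_set_mult:
  assumes "divisible_subgroup G D" "divisible_subgroup G E"
  shows "divisible_subgroup G (D <#> E)"
  unfolding divisible_subgroup_def
proof (intro conjI ballI allI impI)
  have D: "subgroup D G" and E: "subgroup E G"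
    using assms by (auto simp: divisible_subgroup_def)
  then show "subgroup (D <#> E) G"
    by (rule mult_subgroups)
  fix x and n :: nat
  assume "x \<in> D <#> E" "n > 0"
  then obtain d e where "d \<in> D" "e \<in> E" "x = d \<otimes> e"
    by (auto simp: set_mult_def)
  moreover obtain d' e' where "d' \<in> D" "d' [^] n = d" "e' \<in> E" "e' [^] n = e"
    using assms \<open>n > 0\<close> \<open>d \<in> D\<close> \<open>e \<in> E\<close> unfolding divisible_subgroup_def by blast
  moreover have "d' \<in> carrier G" "e' \<in> carrier G"
    using calculation D E by (auto dest: subgroup.mem_carrier)
  ultimately have "d' \<otimes> e' \<in> D <#> E" "(d' \<otimes> e') [^] n = x"
    by (auto simp: set_mult_def pow_mult_distrib m_comm)
  then show "\<exists>y \<in> D <#> E. y [^] n = x"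
    by blast
qed

lemma (in comm_group) divisible_part_greatest:
  shows "divisible_subgroup G (divisible_part G)"
    and "divisible_subgroup G D \<Longrightarrow> D \<subseteq> divisible_part G"
proof -
  define S where "S = \<Union>{D. divisible_subgroup G D}"
  have one: "divisible_subgroup G {\<one>}"
    by (auto simp: divisible_subgroup_def triv_subgroup)
  have "subgroup S G"
  proof
    show "S \<subseteq> carrier G"
      by (auto simp: S_def divisible_subgroup_def dest: subgroup.subset)
    show "\<one> \<in> S"
      using one by (auto simp: S_def)
    show "inv x \<in> S" if "x \<in> S" for x
      using that by (auto simp: S_def divisible_subgroup_def intro: subgroup.m_inv_closed)
    show "x \<otimes> y \<in> S" if x: "x \<in> S" and y: "y \<in> S" for x y
    proof -
      obtain D E where "divisible_subgroup G D" "x \<in> D" "divisible_subgroup G E" "y \<in> E"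
        using x y by (auto simp: S_def)
      moreover have "x \<otimes> y \<in> D <#> E"
        using calculation by (auto simp: set_mult_def)
      ultimately show ?thesis
        using divisible_subgroup_set_mult by (auto simp: S_def)
    qed
  qed
  then have S: "divisible_subgroup G S"
    unfolding divisible_subgroup_def S_def by blast
  have "divisible_part G = S"
    unfolding divisible_part_def
    by (rule Greatest_equality) (use S in \<open>auto simp: S_def\<close>)
  then show "divisible_subgroup G (divisible_part G)"
    and "divisible_subgroup G D \<Longrightarrow> D \<subseteq> divisible_part G"
    using S by (auto simp: S_def)
qed

end

theory Submission
  imports Defs
begin

text \<open>
  Fix a compact open subgroup \<open>U\<close>. It has finite rank iff \<open>U / pU\<close> is finite, and the discrete
  torsion group \<open>G / U\<close> has finite rank iff its socle \<open>{x. px \<in> U} / U\<close> is finite. Each of (a), (b), (c)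
  amounts to: one of these two quotients is finite.

  If \<open>U / pU\<close> is finite, then closed subgroups of \<open>U\<close> are finitely generated, and Nakayama's
  lemma shows that \<open>(X + Y) \<inter> U\<close> is the closed subgroup generated by finitely many of its elements.
  If the socle is finite, then \<open>M / W\<close> is finite modulo \<open>p\<close>, where \<open>M = (X + Y) \<inter> U\<close> and
  \<open>W = (X \<inter> U) + (Y \<inter> U)\<close>; as \<open>M / W\<close> is torsion inside the pro-\<open>p\<close> group \<open>U / W\<close>, it is finite.
  If both quotients are infinite, one chooses a closed \<open>W \<subseteq> U\<close>, elements \<open>g\<^sub>n\<close> independent modulo \<open>U\<close>
  and \<open>u\<^sub>n \<in> U\<close> independent modulo \<open>W\<close> and converging to \<open>W\<close>, with all \<open>pg\<^sub>n, pu\<^sub>n\<close> in \<open>W\<close>;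
  then \<open>\<langle>g\<^sub>n\<rangle> + W\<close> and \<open>\<langle>g\<^sub>n + u\<^sub>n\<rangle> + W\<close> are closed, but their sum misses the limit points
  of \<open>u\<^sub>0 + \<dots> + u\<^sub>n\<close>.

  Modularity forces closed sums: if \<open>z\<close> is in the closure of \<open>X + Y\<close> but not in \<open>X + Y\<close>, the modular
  law fails for \<open>X\<close>, \<open>Y\<close> and \<open>X + \<langle>z\<rangle>\<close>, since
  \<open>Y \<inter> (X + \<langle>z\<rangle>) \<subseteq> X + p\<langle>z\<rangle>\<close> and the latter does not contain \<open>z\<close>.
\<close>

section \<open>Cosets and powers in abelian groups\<close>

text \<open>The two finiteness conditions are dual: over the \<open>p\<close>-adic integers, finite
  \<open>U / pU\<close> makes \<open>U\<close> a noetherian module, and a finite socle makes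
  \<open>G / U\<close> an artinian one. No \<open>p\<close>-adic scalars are introduced. The closed
  subgroup generated by \<open>x\<close> stands for the module spanned by \<open>x\<close>, and
  inverting a number prime to \<open>p\<close> becomes a Bezout identity modulo powers of
  \<open>p\<close>, completed by compactness. A sum of two closed noncompact subgroups has no
  evident reason to be closed; the way in is that a subgroup is closed once its trace on one compact
  open subgroup is. Quotients are counted, not only shown to be finite, because the rank asks for
  one bound valid for all finitely generated closed subgroups. In (b) the two alternatives exclude
  each other through the rank of \<open>U\<close> alone, and their clauses on \<open>tor(G)\<close>
  and \<open>div(G)\<close> follow from the finiteness of \<open>U / pU\<close> and of the socle
  respectively.\<close>

definition pow_image :: "('a, 'm) monoid_scheme \<Rightarrow> 'a set \<Rightarrow> nat \<Rightarrow> 'a set" where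
  "pow_image G H n = (\<lambda>x. x [^]\<^bsub>G\<^esub> n) ` H"

text \<open>The image of \<open>K\<close> in \<open>G / L\<close>. Neither
  \<open>L \<subseteq> K\<close> nor a group structure on \<open>K\<close> is demanded, so that
  passing to subsets of \<open>K\<close> or to another \<open>L\<close> needs no side
  conditions.\<close>

definition cosets :: "('a, 'm) monoid_scheme \<Rightarrow> 'a set \<Rightarrow> 'a set \<Rightarrow> 'a set set" where
  "cosets G L K = (\<lambda>x. L #>\<^bsub>G\<^esub> x) ` K"

lemma set_mult_iff: "x \<in> A <#>\<^bsub>G\<^esub> B \<longleftrightarrow> (\<exists>a\<in>A. \<exists>b\<in>B. x = a \<otimes>\<^bsub>G\<^esub> b)"
  by (auto simp: set_mult_def)

lemma set_multE:
  assumes "x \<in> A <#>\<^bsub>G\<^esub> B"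
  obtains a b where "a \<in> A" "b \<in> B" "x = a \<otimes>\<^bsub>G\<^esub> b"
  using assms by (auto simp: set_mult_def)

lemma set_multI: "a \<in> A \<Longrightarrow> b \<in> B \<Longrightarrow> a \<otimes>\<^bsub>G\<^esub> b \<in> A <#>\<^bsub>G\<^esub> B"
  by (auto simp: set_mult_def)

lemma cosets_mono: "K \<subseteq> K' \<Longrightarrow> cosets G L K \<subseteq> cosets G L K'"
  by (auto simp: cosets_def)

context comm_group
begin

lemma subgroup_nat_pow: "subgroup H G \<Longrightarrow> x \<in> H \<Longrightarrow> x [^] (n::nat) \<in> H"
  by (induct n) (auto simp: subgroup.one_closed subgroup.m_closed)

lemma subgroup_diff: "subgroup H G \<Longrightarrow> x \<in> H \<Longrightarrow> y \<in> H \<Longrightarrow> x \<otimes> inv y \<in> H"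
  by (simp add: subgroup.m_closed subgroup.m_inv_closed)

lemma inv_mult_cancel [simp]:
  assumes "x \<in> carrier G" "y \<in> carrier G"
  shows "x \<otimes> inv y \<otimes> y = x" "x \<otimes> (inv x \<otimes> y) = y" "x \<otimes> y \<otimes> inv y = x"
    "inv x \<otimes> (x \<otimes> y) = y" "x \<otimes> (y \<otimes> inv x) = y"
proof -
  show 1: "x \<otimes> inv y \<otimes> y = x" "x \<otimes> y \<otimes> inv y = x"
    using assms by (metis inv_closed m_assoc l_inv r_inv r_one)+
  show 2: "x \<otimes> (inv x \<otimes> y) = y" "inv x \<otimes> (x \<otimes> y) = y"
    using assms by (metis inv_closed m_assoc l_inv r_inv l_one)+
  show "x \<otimes> (y \<otimes> inv x) = y"
    using assms 2 by (metis inv_closed m_comm)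
qed

lemma subgroup_mult_left: "subgroup H G \<Longrightarrow> x \<in> H \<Longrightarrow> y \<in> carrier G \<Longrightarrow> x \<otimes> y \<in> H \<longleftrightarrow> y \<in> H"
  by (metis inv_mult_cancel(4) subgroup.m_closed subgroup.m_inv_closed subgroup.mem_carrier)

lemma subgroup_mult_right: "subgroup H G \<Longrightarrow> y \<in> H \<Longrightarrow> x \<in> carrier G \<Longrightarrow> x \<otimes> y \<in> H \<longleftrightarrow> x \<in> H"
  by (metis m_comm subgroup.mem_carrier subgroup_mult_left)

lemma set_mult_subset: "subgroup H G \<Longrightarrow> A \<subseteq> H \<Longrightarrow> B \<subseteq> H \<Longrightarrow> A <#> B \<subseteq> H"
  by (auto simp: set_mult_iff intro!: subgroup.m_closed)

lemma subset_set_mult_left: "subgroup B G \<Longrightarrow> A \<subseteq> carrier G \<Longrightarrow> A \<subseteq> A <#> B"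
  unfolding set_mult_iff subset_iff by (metis r_one subgroup.one_closed)

lemma subset_set_mult_right: "subgroup A G \<Longrightarrow> B \<subseteq> carrier G \<Longrightarrow> B \<subseteq> A <#> B"
  unfolding set_mult_iff subset_iff by (metis l_one subgroup.one_closed)

lemma set_mult_comm: "A \<subseteq> carrier G \<Longrightarrow> B \<subseteq> carrier G \<Longrightarrow> A <#> B = B <#> A"
  unfolding set_mult_def by (fastforce simp: m_comm)

lemma subgroup_pow_image:
  assumes "subgroup H G"
  shows "subgroup (pow_image G H n) G"
proof
  show "pow_image G H n \<subseteq> carrier G"
    using assms by (auto simp: pow_image_def subgroup.mem_carrier)
  show "\<one> \<in> pow_image G H n"
    unfolding pow_image_def by (rule image_eqI[of _ _ "\<one>"]) (auto simp: assms subgroup.one_closed)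
  fix x assume "x \<in> pow_image G H n"
  then obtain a where a: "a \<in> H" "x = a [^] n" by (auto simp: pow_image_def)
  then have ac: "a \<in> carrier G" using assms by (simp add: subgroup.mem_carrier)
  show "inv x \<in> pow_image G H n"
    unfolding pow_image_def using a ac assms
    by (intro image_eqI[of _ _ "inv a"]) (auto simp: subgroup.m_inv_closed nat_pow_inv)
  fix y assume "y \<in> pow_image G H n"
  then obtain b where b: "b \<in> H" "y = b [^] n" by (auto simp: pow_image_def)
  then have bc: "b \<in> carrier G" using assms by (simp add: subgroup.mem_carrier)
  show "x \<otimes> y \<in> pow_image G H n"
    unfolding pow_image_def using a ac b bc assms
    by (intro image_eqI[of _ _ "a \<otimes> b"]) (auto simp: subgroup.m_closed nat_pow_distrib)
qed

lemma pow_image_subset: "subgroup H G \<Longrightarrow> pow_image G H n \<subseteq> H"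
  by (auto simp: pow_image_def subgroup_nat_pow)

lemma pow_imageI: "x \<in> H \<Longrightarrow> x [^] n \<in> pow_image G H n"
  by (auto simp: pow_image_def)

lemma pow_image_1: "H \<subseteq> carrier G \<Longrightarrow> pow_image G H (Suc 0) = H"
  by (force simp: pow_image_def)

lemma pow_image_mono: "H \<subseteq> K \<Longrightarrow> pow_image G H n \<subseteq> pow_image G K n"
  by (auto simp: pow_image_def)

lemma pow_image_pow_image: "H \<subseteq> carrier G \<Longrightarrow> pow_image G (pow_image G H n) m = pow_image G H (n * m)"
  by (auto simp: pow_image_def image_image nat_pow_pow intro!: image_cong)

lemma pow_image_dvd:
  assumes "subgroup H G" "n dvd m"
  shows "pow_image G H m \<subseteq> pow_image G H n"
proof -
  obtain k where "m = k * n" using assms(2) by (auto simp: dvd_def mult.commute)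
  then have "pow_image G H m = pow_image G (pow_image G H k) n"
    using assms(1) by (simp add: pow_image_pow_image subgroup.subset)
  then show ?thesis by (simp add: pow_image_mono pow_image_subset assms)
qed

lemma pow_image_set_mult:
  assumes "A \<subseteq> carrier G" "B \<subseteq> carrier G"
  shows "pow_image G (A <#> B) n = pow_image G A n <#> pow_image G B n"
proof -
  have "(a \<otimes> b) [^] n = a [^] n \<otimes> b [^] n" if "a \<in> A" "b \<in> B" for a b
    using that assms by (meson nat_pow_distrib subsetD)
  then have "(\<lambda>x. x [^] n) ` (\<Union>a\<in>A. \<Union>b\<in>B. {a \<otimes> b}) = (\<Union>a\<in>A. \<Union>b\<in>B. {a [^] n \<otimes> b [^] n})"
    by (simp add: image_UN)
  then show ?thesis
    by (simp add: pow_image_def set_mult_def)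
qed

lemma subgroup_pow_preimage:
  assumes "subgroup K G" "subgroup L G"
  shows "subgroup {x \<in> K. x [^] (n::nat) \<in> L} G"
proof
  show "{x \<in> K. x [^] n \<in> L} \<subseteq> carrier G"
    using assms subgroup.mem_carrier by auto
  show "\<one> \<in> {x \<in> K. x [^] n \<in> L}" using assms by (auto simp: subgroup.one_closed)
  fix x assume x: "x \<in> {x \<in> K. x [^] n \<in> L}"
  then have xc: "x \<in> carrier G" using assms(1) by (auto simp: subgroup.mem_carrier)
  show "inv x \<in> {x \<in> K. x [^] n \<in> L}"
    using x xc assms by (auto simp: subgroup.m_inv_closed nat_pow_inv)
  fix y assume y: "y \<in> {x \<in> K. x [^] n \<in> L}"
  then have "y \<in> carrier G" using assms(1) by (auto simp: subgroup.mem_carrier)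
  then show "x \<otimes> y \<in> {x \<in> K. x [^] n \<in> L}"
    using x xc y assms by (auto simp: subgroup.m_closed nat_pow_distrib)
qed

lemma subgroup_Int: "subgroup A G \<Longrightarrow> subgroup B G \<Longrightarrow> subgroup (A \<inter> B) G"
  by (rule subgroups_Inter_pair)

section \<open>Cosets and the comparison of finite quotients\<close>

lemma rcos_eq_iff:
  assumes "subgroup L G" "x \<in> carrier G" "y \<in> carrier G"
  shows "L #> x = L #> y \<longleftrightarrow> x \<otimes> inv y \<in> L"
proof
  assume "L #> x = L #> y"
  then have "x \<in> L #> y" using rcos_self[OF assms(2,1)] by simp
  then obtain l where "l \<in> L" "x = l \<otimes> y" by (auto simp: r_coset_def)
  then show "x \<otimes> inv y \<in> L" using assms by (simp add: subgroup.mem_carrier)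
next
  assume "x \<otimes> inv y \<in> L"
  moreover have "x = (x \<otimes> inv y) \<otimes> y" using assms by simp
  ultimately have "x \<in> L #> y" unfolding r_coset_def by blast
  then show "L #> x = L #> y" using repr_independence assms by metis
qed

lemma cosets_cover:
  assumes "finite (cosets G L K)" "K \<subseteq> carrier G" "subgroup L G"
  obtains C where "finite C" "C \<subseteq> K" "card C \<le> card (cosets G L K)" "K \<subseteq> C <#> L"
proof -
  obtain C where C: "finite C" "C \<subseteq> K" "cosets G L K = (\<lambda>x. L #> x) ` C" "inj_on (\<lambda>x. L #> x) C"
    using assms(1) unfolding cosets_def
    by (metis finite_image_iff order_refl subset_image_inj)
  show thesis
  proof (rule that[OF C(1,2)])
    show "card C \<le> card (cosets G L K)" using C by (simp add: card_image)
    show "K \<subseteq> C <#> L"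
    proof
      fix x assume x: "x \<in> K"
      then obtain c where c: "c \<in> C" "L #> x = L #> c" using C(3) unfolding cosets_def by (metis image_iff)
      then have "x \<otimes> inv c \<in> L" using rcos_eq_iff[OF assms(3)] x assms(2) C(2) by blast
      moreover have "x = c \<otimes> (x \<otimes> inv c)" using x c assms(2) C(2)
        by (metis inv_mult_cancel(5) subsetD)
      ultimately show "x \<in> C <#> L" unfolding set_mult_iff using c by blast
    qed
  qed
qed

lemma cosets_finite_card:
  assumes "finite C" "C \<subseteq> carrier G" "subgroup L G" "K \<subseteq> C <#> L"
  shows "finite (cosets G L K)" "card (cosets G L K) \<le> card C"
proof -
  have "cosets G L K \<subseteq> (\<lambda>x. L #> x) ` C"
  proof (unfold cosets_def, rule image_subsetI)
    fix x assume "x \<in> K"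
    then obtain c l where *: "c \<in> C" "l \<in> L" "x = c \<otimes> l" using assms(4) by (meson set_multE subsetD)
    then have cl: "c \<in> carrier G" "l \<in> carrier G" using assms(2,3) by (auto intro: subgroup.mem_carrier)
    then have "x \<otimes> inv c = l" using * by (simp add: m_comm)
    then have "L #> x = L #> c" using rcos_eq_iff[OF assms(3)] * cl by auto
    then show "L #> x \<in> (\<lambda>x. L #> x) ` C" using * by auto
  qed
  then show "finite (cosets G L K)" "card (cosets G L K) \<le> card C"
    using assms(1) finite_subset surj_card_le by blast+
qed

text \<open>The map \<open>f\<close> need not be a homomorphism or respect cosets of
  \<open>L\<close>. It suffices that the coset \<open>L' #> f x\<close> determines
  \<open>L #> x\<close>: picking any preimage then maps the classes of \<open>K'\<close> onto a set
  containing those of \<open>K\<close>. This covers multiplication by \<open>p\<close>, the identity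
  between different quotients, and arbitrary choices of a summand.\<close>

lemma cosets_inject:
  assumes fin: "finite (cosets G L' K')" and f: "\<And>x. x \<in> K \<Longrightarrow> f x \<in> K'"
    and L': "subgroup L' G" "K' \<subseteq> carrier G" and L: "subgroup L G" "K \<subseteq> carrier G"
    and imp: "\<And>x y. x \<in> K \<Longrightarrow> y \<in> K \<Longrightarrow> f x \<otimes> inv (f y) \<in> L' \<Longrightarrow> x \<otimes> inv y \<in> L"
  shows "finite (cosets G L K)" "card (cosets G L K) \<le> card (cosets G L' K')"
proof -
  define g where "g c = L #> (SOME x. x \<in> K \<and> L' #> f x = c)" for c
  have "cosets G L K \<subseteq> g ` cosets G L' K'"
  proof (unfold cosets_def, rule image_subsetI)
    fix x assume x: "x \<in> K"
    define y where "y = (SOME y. y \<in> K \<and> L' #> f y = L' #> f x)"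
    have y: "y \<in> K \<and> L' #> f y = L' #> f x"
      unfolding y_def by (rule someI[of _ x]) (simp add: x)
    then have "f y \<otimes> inv (f x) \<in> L'" using rcos_eq_iff[OF L'(1)] L'(2) f x by (metis subsetD)
    then have "L #> y = L #> x" using rcos_eq_iff[OF L(1)] L(2) imp x y by blast
    then have "L #> x = g (L' #> f x)" by (simp add: g_def flip: y_def)
    then show "L #> x \<in> g ` (\<lambda>x. L' #> x) ` K'" using f x by blast
  qed
  then show "finite (cosets G L K)" "card (cosets G L K) \<le> card (cosets G L' K')"
    using fin finite_subset surj_card_le by blast+
qed

lemma cosets_trans:
  assumes "finite (cosets G L K)" "finite (cosets G M L)" "K \<subseteq> carrier G" "subgroup L G" "subgroup M G"
  shows "finite (cosets G M K)"
proof -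
  obtain C where C: "finite C" "C \<subseteq> K" "K \<subseteq> C <#> L"
    using cosets_cover[OF assms(1,3,4)] by metis
  obtain D where D: "finite D" "D \<subseteq> L" "L \<subseteq> D <#> M"
    using cosets_cover[OF assms(2) _ assms(5)] assms(4) subgroup.subset by metis
  have Dc: "D \<subseteq> carrier G" "M \<subseteq> carrier G" "C \<subseteq> carrier G" using D C assms subgroup.subset by blast+
  have "K \<subseteq> C <#> (D <#> M)" using C D mono_set_mult by blast
  also have "\<dots> = (C <#> D) <#> M" using set_mult_assoc Dc by simp
  finally show ?thesis
    using C D Dc by (intro cosets_finite_card(1)[of "C <#> D"] assms(5)) (auto simp: set_mult_def)
qed

lemma finite_cosets_cover:
  assumes "finite (cosets G L K)" "K \<subseteq> carrier G" "subgroup L G"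
  obtains C where "finite C" "C \<subseteq> K" "K \<subseteq> C <#> L"
  by (rule cosets_cover[OF assms])

text \<open>The negated conjunction treats an infinite quotient and a finite one with more than
  \<open>N\<close> elements alike; either contradicts a bound by \<open>N\<close> through
  \<open>N + 1\<close> inequivalent elements.\<close>

lemma pick_inequivalent:
  assumes "\<not> (finite (cosets G L K) \<and> card (cosets G L K) \<le> N)"
  obtains B where "finite B" "B \<subseteq> K" "card B = Suc N" "inj_on (\<lambda>x. L #> x) B"
proof -
  obtain Q where Q: "finite Q" "card Q = Suc N" "Q \<subseteq> cosets G L K"
    using assms by (metis infinite_arbitrarily_large not_less_eq_eq obtain_subset_with_card_n)
  then obtain B where "B \<subseteq> K" "Q = (\<lambda>x. L #> x) ` B" "inj_on (\<lambda>x. L #> x) B"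
    unfolding cosets_def by (metis subset_image_inj)
  then show thesis using Q that by (metis card_image finite_image_iff)
qed

lemma generate_insert:
  assumes "a \<in> carrier G" "F \<subseteq> carrier G"
  shows "generate G (insert a F) = generate G {a} <#> generate G F"
proof
  have s: "subgroup (generate G {a} <#> generate G F) G"
    using assms by (intro mult_subgroups generate_is_subgroup) auto
  show "generate G (insert a F) \<subseteq> generate G {a} <#> generate G F"
  proof (rule generate_subgroup_incl[OF _ s])
    have sa: "subgroup (generate G {a}) G" and sF: "subgroup (generate G F) G"
      using assms by (auto intro: generate_is_subgroup)
    have "{a} \<subseteq> generate G {a} <#> generate G F"
      using subset_set_mult_left[OF sF subgroup.subset[OF sa]] generate.incl[of a "{a}" G] by auto
    moreover have "F \<subseteq> generate G {a} <#> generate G F"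
      using subset_set_mult_right[OF sa subgroup.subset[OF sF]] generate.incl[of _ F G] by auto
    ultimately show "insert a F \<subseteq> generate G {a} <#> generate G F" by simp
  qed
  show "generate G {a} <#> generate G F \<subseteq> generate G (insert a F)"
    using assms by (intro set_mult_subset generate_is_subgroup mono_generate) auto
qed

text \<open>Modulo \<open>L\<close> each generator has order dividing \<open>q\<close>, so exponents
  below \<open>q\<close> suffice. The count \<open>q ^ card F\<close> later converts a rank bound
  into a bound on the size of a quotient.\<close>

lemma generate_combinations:
  assumes "finite F" "F \<subseteq> carrier G" "subgroup L G" "q > 0" "\<And>f. f \<in> F \<Longrightarrow> f [^] (q::nat) \<in> L"
  shows "\<exists>C. finite C \<and> card C \<le> q ^ card F \<and> C \<subseteq> generate G F \<and> generate G F \<subseteq> C <#> L"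
  using assms(1,2,5)
proof (induction F)
  case empty
  have "generate G {} \<subseteq> {\<one>} <#> L"
    using generate_empty subset_set_mult_left[OF assms(3), of "{\<one>}"] by auto
  then show ?case by (intro exI[of _ "{\<one>}"]) (auto simp: generate_empty)
next
  case (insert a F)
  then obtain C where C: "finite C" "card C \<le> q ^ card F" "C \<subseteq> generate G F" "generate G F \<subseteq> C <#> L"
    by auto
  have a: "a \<in> carrier G" "F \<subseteq> carrier G" using insert by auto
  let ?C = "(\<lambda>(i, c). a [^] (i::nat) \<otimes> c) ` ({..<q} \<times> C)"
  have sg: "subgroup (generate G (insert a F)) G" using a by (intro generate_is_subgroup) auto
  have ain: "a \<in> generate G (insert a F)" "generate G F \<subseteq> generate G (insert a F)"
    by (auto intro: generate.incl mono_generate[THEN subsetD])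
  have "?C \<subseteq> generate G (insert a F)"
    using ain C(3) sg by (auto intro!: subgroup.m_closed[OF sg] subgroup_nat_pow[OF sg])
  moreover have "card ?C \<le> q ^ card (insert a F)"
  proof -
    have "card ?C \<le> card ({..<q} \<times> C)" using C(1) by (intro card_image_le) auto
    also have "\<dots> \<le> q * q ^ card F" using C(1,2) by (simp add: card_cartesian_product)
    finally show ?thesis using insert by simp
  qed
  moreover have "generate G (insert a F) \<subseteq> ?C <#> L"
  proof
    fix x assume "x \<in> generate G (insert a F)"
    then obtain y g where yg: "y \<in> generate G {a}" "g \<in> generate G F" "x = y \<otimes> g"
      unfolding generate_insert[OF a] set_mult_iff by blast
    then obtain k :: int where k: "y = a [^] k" using generate_pow[OF a(1)] by blast
    obtain c l where cl: "c \<in> C" "l \<in> L" "g = c \<otimes> l" using yg(2) C(4) by (meson set_multE subsetD)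
    have carr: "c \<in> carrier G" "l \<in> carrier G"
      using cl C(3) generate_incl[OF a(2)] by (auto intro: subgroup.mem_carrier[OF assms(3)])
    \<comment> \<open>Division with remainder of the exponent, which may be negative; the multiple
      of \<open>q\<close> goes into \<open>L\<close>.\<close>
    define i where "i = nat (k mod int q)"
    define m where "m = k div int q"
    have "k = int i + int q * m" using assms(4) by (simp add: i_def m_def)
    then have "y = a [^] i \<otimes> (a [^] q) [^] m"
      using a(1) unfolding k int_pow_int[symmetric] by (simp add: int_pow_mult int_pow_pow)
    then have "x = (a [^] i \<otimes> c) \<otimes> ((a [^] q) [^] m \<otimes> l)"
      using yg cl carr a(1) by (simp add: m_ac)
    moreover have "(a [^] q) [^] m \<otimes> l \<in> L"
      using insert.prems(2)[of a] cl(2) assms(3) by (simp add: subgroup_int_pow_closed subgroup.m_closed)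
    moreover have "i < q" using assms(4) by (simp add: i_def nat_less_iff)
    ultimately show "x \<in> ?C <#> L" unfolding set_mult_iff using cl(1) by force
  qed
  ultimately show ?case using C(1) by (intro exI[of _ ?C]) auto
qed

lemma pow_image_generate_set_mult:
  assumes C: "C \<subseteq> carrier G" and W: "subgroup W G" and k: "\<And>c. c \<in> C \<Longrightarrow> c [^] (n::nat) \<in> W"
  shows "pow_image G (generate G C <#> W) n \<subseteq> W"
proof -
  let ?R = "{x \<in> carrier G. x [^] n \<in> W}"
  have s: "subgroup ?R G" using W subgroup_self by (intro subgroup_pow_preimage)
  have "C \<subseteq> ?R" using k C by blast
  note gen = generate_subgroup_incl[OF this s]
  have "W \<subseteq> ?R" using subgroup.subset[OF W] subgroup_nat_pow[OF W] by blast
  from set_mult_subset[OF s gen this]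
  have "x [^] n \<in> W" if "x \<in> generate G C <#> W" for x using that by blast
  then show ?thesis unfolding pow_image_def by blast
qed

lemma finite_generate_set_mult:
  assumes "finite C" "C \<subseteq> carrier G" "subgroup W G" "n > 0" "\<And>c. c \<in> C \<Longrightarrow> c [^] (n::nat) \<in> W"
  obtains D where "finite D" "D \<subseteq> generate G C" "generate G C <#> W \<subseteq> D <#> W"
proof -
  obtain D where D: "finite D" "D \<subseteq> generate G C" "generate G C \<subseteq> D <#> W"
    using generate_combinations[OF assms] by blast
  have c: "D \<subseteq> carrier G" "W \<subseteq> carrier G" using D generate_incl[OF assms(2)] subgroup.subset[OF assms(3)] by auto
  have "generate G C <#> W \<subseteq> (D <#> W) <#> W" using D(3) by (intro mono_set_mult) auto
  also have "\<dots> \<subseteq> D <#> W" unfolding set_mult_assoc[OF c c(2)]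
    by (rule mono_set_mult[OF order_refl set_mult_subset[OF assms(3)]]) auto
  finally show thesis using that D by blast
qed

text \<open>The algebraic half of Nakayama's lemma: substituting the inclusion into itself gives
  \<open>B + p(B + p^j M)\<close>, and \<open>pB\<close> is absorbed by \<open>B\<close>. Topology
  enters only when \<open>j\<close> is allowed to grow.\<close>

lemma subset_set_mult_pow_image_iterate:
  assumes "subgroup B G" "subgroup M G" "M \<subseteq> B <#> pow_image G M p"
  shows "M \<subseteq> B <#> pow_image G M (p ^ j)"
proof (induction j)
  case 0
  then show ?case using subset_set_mult_right[OF assms(1) subgroup.subset[OF assms(2)]]
    by (simp add: pow_image_1 subgroup.subset[OF assms(2)])
next
  case (Suc j)
  have c: "B \<subseteq> carrier G" "M \<subseteq> carrier G" using assms by (auto simp: subgroup.subset)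
  have cp: "pow_image G A n \<subseteq> carrier G" if "A \<subseteq> carrier G" for A and n :: nat
    using that by (auto simp: pow_image_def)
  have "M \<subseteq> B <#> pow_image G M p" by fact
  also have "\<dots> \<subseteq> B <#> pow_image G (B <#> pow_image G M (p ^ j)) p"
    using Suc by (intro mono_set_mult pow_image_mono order_refl)
  also have "\<dots> = B <#> (pow_image G B p <#> pow_image G M (p ^ Suc j))"
    using c by (simp add: pow_image_set_mult cp pow_image_pow_image mult.commute)
  also have "\<dots> = (B <#> pow_image G B p) <#> pow_image G M (p ^ Suc j)"
    using c by (simp add: set_mult_assoc cp)
  also have "\<dots> \<subseteq> B <#> pow_image G M (p ^ Suc j)"
    using assms(1) by (intro mono_set_mult set_mult_subset pow_image_subset order_refl)
  finally show ?case .
qed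

text \<open>The index of the kernel of multiplication by \<open>n\<close> is the order of its image,
  so Lagrange's theorem applied to both subgroups compares \<open>G / nG\<close> with the
  \<open>n\<close>-torsion.\<close>

lemma card_rcosets_pow_image:
  assumes "finite (carrier G)"
  shows "card (rcosets (pow_image G (carrier G) n)) \<le> card {x \<in> carrier G. x [^] n = \<one>}"
proof -
  interpret h: group_hom G G "\<lambda>x. x [^] n"
    by unfold_locales (auto simp: hom_def nat_pow_distrib)
  let ?P = "pow_image G (carrier G) n" and ?K = "kernel G G (\<lambda>x. x [^] n)"
  have P: "subgroup ?P G" by (simp add: subgroup_pow_image subgroup_self)
  have K: "subgroup ?K G" by (rule h.subgroup_kernel)
  have rc: "rcosets L = cosets G L (carrier G)" for L
    by (auto simp: RCOSETS_def cosets_def)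
  have finP: "finite ?P" using assms by (simp add: pow_image_def)
  have "card (rcosets ?K) \<le> card (cosets G {\<one>} ?P)"
    unfolding rc
  proof (rule cosets_inject(2)[where f = "\<lambda>x. x [^] n"])
    fix x y assume *: "x \<in> carrier G" "y \<in> carrier G" "x [^] n \<otimes> inv (y [^] n) \<in> {\<one>}"
    then show "x \<otimes> inv y \<in> ?K" by (simp add: kernel_def nat_pow_distrib nat_pow_inv)
  qed (use P K finP in \<open>auto simp: triv_subgroup subgroup.subset cosets_def pow_imageI\<close>)
  also have "\<dots> \<le> card ?P" using finP unfolding cosets_def by (rule card_image_le)
  finally have le: "card (rcosets ?K) \<le> card ?P" .
  have "card (rcosets ?P) * card ?P = card (rcosets ?K) * card ?K"
    using lagrange_finite[OF assms P] lagrange_finite[OF assms K] by simp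
  also have "\<dots> \<le> card ?K * card ?P"
    using le by (simp add: mult.commute)
  finally have "card (rcosets ?P) \<le> card ?K"
    using finP subgroup.one_closed[OF P] by (auto simp: card_gt_0_iff)
  then show ?thesis by (simp add: kernel_def)
qed

end

lemma nat_pow_subgroup_of [simp]: "x [^]\<^bsub>subgroup_of G H\<^esub> (n::nat) = x [^]\<^bsub>G\<^esub> n"
  by (simp add: nat_pow_def)

lemma pow_image_subgroup_of [simp]: "pow_image (subgroup_of G H) A n = pow_image G A n"
  by (simp add: pow_image_def)

lemma r_coset_subgroup_of [simp]: "L #>\<^bsub>subgroup_of G H\<^esub> x = L #>\<^bsub>G\<^esub> x"
  by (simp add: r_coset_def)

lemma cosets_subgroup_of [simp]: "cosets (subgroup_of G H) L K = cosets G L K"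
  by (simp add: cosets_def)

section \<open>Torsion groups with finite socle\<close>

context comm_group
begin

lemma comm_group_subgroup_of:
  assumes "subgroup H G"
  shows "comm_group (subgroup_of G H)"
proof -
  interpret H: group "subgroup_of G H" using assms by (rule subgroup_imp_group)
  show ?thesis
    using assms by (intro H.group_comm_groupI) (auto simp: m_comm subgroup.mem_carrier)
qed

lemma uniform_p_power:
  assumes "finite B" "subgroup L G" "B \<subseteq> carrier G" "\<And>b. b \<in> B \<Longrightarrow> \<exists>k. b [^] ((p::nat) ^ k) \<in> L"
  obtains k where "\<And>b. b \<in> B \<Longrightarrow> b [^] (p ^ k) \<in> L"
proof -
  have "\<exists>k. \<forall>b\<in>B. b [^] (p ^ k) \<in> L"
    using assms(1,3,4)
  proof (induction B)
    case empty then show ?case by simp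
  next
    case (insert a B)
    then obtain k where k: "\<forall>b\<in>B. b [^] (p ^ k) \<in> L" by auto
    obtain j where j: "a [^] (p ^ j) \<in> L" using insert.prems by auto
    have up: "b [^] (p ^ (i + i')) \<in> L" if "b [^] (p ^ i) \<in> L" "b \<in> carrier G" for b i i'
      using subgroup_nat_pow[OF assms(2) that(1), of "p ^ i'"] that(2)
      by (simp add: nat_pow_pow power_add)
    show ?case
      using k j up[of a j k] up[of _ k j] insert.prems
      by (intro exI[of _ "j + k"]) (auto simp: add.commute)
  qed
  then show thesis using that by blast
qed

lemma finite_generate:
  assumes "finite B" "B \<subseteq> carrier G" "p > 0" "\<And>b. b \<in> B \<Longrightarrow> \<exists>k. b [^] ((p::nat) ^ k) = \<one>"
  shows "finite (generate G B)"
proof -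
  obtain k where k: "\<And>b. b \<in> B \<Longrightarrow> b [^] (p ^ k) \<in> {\<one>}"
    using uniform_p_power[OF assms(1) triv_subgroup assms(2), of p] assms(4) by blast
  obtain C where "finite C" "generate G B \<subseteq> C <#> {\<one>}"
    using generate_combinations[OF assms(1,2) triv_subgroup _ k] assms(3) by auto
  moreover from this have "finite (C <#> {\<one>})" by (simp add: set_mult_def)
  ultimately show ?thesis by (meson finite_subset)
qed

text \<open>An abelian torsion group is locally finite, so too many inequivalent elements would
  already sit in a finite subgroup \<open>H\<close>. They stay inequivalent modulo
  \<open>pH\<close>, which is contained in \<open>pG\<close>, and this contradicts the count for
  finite groups.\<close>

lemma card_cosets_pow_image_le:
  assumes "p > 0" and tors: "\<And>x. x \<in> carrier G \<Longrightarrow> \<exists>k. x [^] ((p::nat) ^ k) = \<one>"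
    and fin: "finite {x \<in> carrier G. x [^] p = \<one>}"
  shows "finite (cosets G (pow_image G (carrier G) p) (carrier G)) \<and>
    card (cosets G (pow_image G (carrier G) p) (carrier G)) \<le> card {x \<in> carrier G. x [^] p = \<one>}"
proof (rule ccontr)
  assume "\<not> ?thesis"
  then obtain B where B: "finite B" "B \<subseteq> carrier G" "card B = Suc (card {x \<in> carrier G. x [^] p = \<one>})"
    "inj_on (\<lambda>x. pow_image G (carrier G) p #> x) B"
    using pick_inequivalent[of "pow_image G (carrier G) p" "carrier G" "card {x \<in> carrier G. x [^] p = \<one>}"] by blast
  define H where "H = generate G B"
  have H: "subgroup H G" "finite H" "B \<subseteq> H"
    unfolding H_def using B assms by (auto intro!: generate_is_subgroup finite_generate generate.incl)
  interpret H: comm_group "subgroup_of G H" using H by (intro comm_group_subgroup_of)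
  have "inj_on (\<lambda>x. pow_image G H p #> x) B"
  proof (rule inj_onI)
    fix x y assume xy: "x \<in> B" "y \<in> B" "pow_image G H p #> x = pow_image G H p #> y"
    then have "x \<otimes> inv y \<in> pow_image G H p"
      using rcos_eq_iff[OF subgroup_pow_image[OF H(1)]] B(2) by blast
    then have "x \<otimes> inv y \<in> pow_image G (carrier G) p"
      using pow_image_mono[OF subgroup.subset[OF H(1)]] by blast
    then have "pow_image G (carrier G) p #> x = pow_image G (carrier G) p #> y"
      using rcos_eq_iff[OF subgroup_pow_image[OF subgroup_self]] B(2) xy by blast
    then show "x = y" using B(4) xy by (auto dest: inj_onD)
  qed
  then have "card B = card ((\<lambda>x. pow_image G H p #> x) ` B)" by (simp add: card_image)
  also have "\<dots> \<le> card (cosets G (pow_image G H p) H)"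
    unfolding cosets_def using H by (intro card_mono) auto
  also have "\<dots> = card (rcosets\<^bsub>subgroup_of G H\<^esub> (pow_image G H p))"
    by (rule arg_cong[of _ _ card]) (auto simp: cosets_def RCOSETS_def)
  also have "\<dots> \<le> card {x \<in> H. x [^] p = \<one>}"
    using H.card_rcosets_pow_image[of p] H by simp
  also have "\<dots> \<le> card {x \<in> carrier G. x [^] p = \<one>}"
    using fin subgroup.subset[OF H(1)] by (intro card_mono) auto
  finally show False using B by simp
qed

lemma FactGroup_rcos:
  assumes "subgroup L G" "x \<in> carrier G"
  shows "(L #> x) [^]\<^bsub>G Mod L\<^esub> (n::nat) = L #> (x [^] n)"
  using assms normal.FactGroup_pow[of L G x n] normal_iff_subgroup by simp

lemma rcos_eq_self_iff: "subgroup L G \<Longrightarrow> x \<in> carrier G \<Longrightarrow> L #> x = L \<longleftrightarrow> x \<in> L"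
  by (metis coset_join1 coset_join2 subgroup.subset)

text \<open>This is \<open>card_cosets_pow_image_le\<close> for the torsion group
  \<open>K / L\<close>, pulled back to representatives so that later arguments stay inside
  \<open>G\<close>: a finite socle bounds the quotient modulo \<open>p\<close>.\<close>

lemma card_cosets_quotient_le:
  assumes K: "subgroup K G" and L: "subgroup L G" "L \<subseteq> K" and "p > 0"
    and tors: "\<And>x. x \<in> K \<Longrightarrow> \<exists>k. x [^] ((p::nat) ^ k) \<in> L"
    and fin: "finite (cosets G L {x \<in> K. x [^] p \<in> L})"
  shows "finite (cosets G (pow_image G K p <#> L) K)"
    "card (cosets G (pow_image G K p <#> L) K) \<le> card (cosets G L {x \<in> K. x [^] p \<in> L})"
proof -
  interpret K: comm_group "subgroup_of G K" by (rule comm_group_subgroup_of[OF K])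
  have LK: "subgroup L (subgroup_of G K)" using L K by (simp add: subgroup_incl)
  let ?A = "subgroup_of G K Mod L"
  interpret A: comm_group ?A by (rule K.abelian_FactGroup[OF LK])
  have carr: "carrier ?A = (\<lambda>x. L #> x) ` K" by (simp add: carrier_FactGroup)
  have pow: "(L #> x) [^]\<^bsub>?A\<^esub> (n::nat) = L #> (x [^] n)" if "x \<in> K" for x n
    using K.FactGroup_rcos[OF LK, of x n] that by simp
  have Kc: "K \<subseteq> carrier G" using K by (rule subgroup.subset)
  have eq1: "L #> x = L \<longleftrightarrow> x \<in> L" if "x \<in> K" for x
    using rcos_eq_self_iff[OF L(1)] that Kc by blast
  have soc: "{a \<in> carrier ?A. a [^]\<^bsub>?A\<^esub> p = \<one>\<^bsub>?A\<^esub>} = cosets G L {x \<in> K. x [^] p \<in> L}"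
  proof -
    have "(L #> x) [^]\<^bsub>?A\<^esub> p = \<one>\<^bsub>?A\<^esub> \<longleftrightarrow> x [^] p \<in> L" if "x \<in> K" for x
      unfolding pow[OF that] one_FactGroup using eq1 subgroup_nat_pow[OF K that] by blast
    then show ?thesis unfolding carr cosets_def by blast
  qed
  have *: "finite (cosets ?A (pow_image ?A (carrier ?A) p) (carrier ?A)) \<and>
    card (cosets ?A (pow_image ?A (carrier ?A) p) (carrier ?A)) \<le> card (cosets G L {x \<in> K. x [^] p \<in> L})"
    unfolding soc[symmetric]
  proof (rule A.card_cosets_pow_image_le)
    fix a assume "a \<in> carrier ?A"
    then obtain x where x: "x \<in> K" "a = L #> x" unfolding carr by auto
    then obtain k where "x [^] (p ^ k) \<in> L" using tors by blast
    then show "\<exists>k. a [^]\<^bsub>?A\<^esub> (p ^ k) = \<one>\<^bsub>?A\<^esub>"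
      using x pow eq1 subgroup_nat_pow[OF K] by auto
  qed (use \<open>p > 0\<close> fin soc in auto)
  let ?P = "pow_image G K p <#> L"
  have sP: "subgroup ?P G" by (rule mult_subgroups[OF subgroup_pow_image[OF K] L(1)])
  obtain C' where C': "finite C'" "C' \<subseteq> carrier ?A"
    "card C' \<le> card (cosets ?A (pow_image ?A (carrier ?A) p) (carrier ?A))"
    "carrier ?A \<subseteq> C' <#>\<^bsub>?A\<^esub> pow_image ?A (carrier ?A) p"
    using A.cosets_cover[OF conjunct1[OF *] order_refl A.subgroup_pow_image[OF A.subgroup_self]] .
  obtain C where C: "C \<subseteq> K" "C' = (\<lambda>x. L #> x) ` C" "inj_on (\<lambda>x. L #> x) C"
    using C'(2) unfolding carr by (metis subset_image_inj)
  have finC: "finite C" "card C = card C'"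
    using C'(1) C(2,3) by (simp_all add: finite_image_iff card_image)
  have Cc: "C \<subseteq> carrier G" using C(1) Kc by blast
  have "K \<subseteq> C <#> ?P"
  proof
    fix x assume x: "x \<in> K"
    then have "L #> x \<in> C' <#>\<^bsub>?A\<^esub> pow_image ?A (carrier ?A) p" using C'(4) carr by blast
    then obtain a b where ab: "a \<in> C'" "b \<in> pow_image ?A (carrier ?A) p" "L #> x = a \<otimes>\<^bsub>?A\<^esub> b"
      by (rule set_multE)
    obtain c where c: "c \<in> C" "a = L #> c" using ab(1) C(2) by blast
    obtain y where y: "y \<in> K" "b = L #> y [^] p" using ab(2) pow unfolding pow_image_def carr by auto
    have cc: "x \<in> carrier G" "c \<in> carrier G" "y [^] p \<in> carrier G" using x y c Kc Cc by auto
    have "L #> x = L #> (c \<otimes> y [^] p)"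
      using ab(3) c y cc normal.rcos_sum[of L G c "y [^] p"] normal_iff_subgroup L(1) by simp
    then have "x \<otimes> inv (c \<otimes> y [^] p) \<in> L" using rcos_eq_iff[OF L(1)] cc by simp
    moreover have "x = c \<otimes> (y [^] p \<otimes> (x \<otimes> inv (c \<otimes> y [^] p)))"
      using inv_mult_cancel(5)[of "c \<otimes> y [^] p" x] cc by (metis m_assoc m_closed inv_closed)
    ultimately show "x \<in> C <#> ?P" using c(1) y(1) by (metis pow_imageI set_multI)
  qed
  from cosets_finite_card[OF finC(1) Cc sP this]
  show "finite (cosets G ?P K)" "card (cosets G ?P K) \<le> card (cosets G L {x \<in> K. x [^] p \<in> L})"
    using * C'(3) finC(2) by auto
qed

end

section \<open>Closed subgroups of topological abelian groups\<close>

context topological_comm_group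
begin

lemma continuous_map_translate: "a \<in> carrier G \<Longrightarrow> continuous_map T T (\<lambda>x. a \<otimes> x)"
  using continuous_map_compose[OF _ continuous_mult, of T "\<lambda>x. (a, x)"]
  by (simp add: o_def continuous_map_pairedI topspace_eq)

lemma continuous_map_diff: "continuous_map (prod_topology T T) T (\<lambda>(x, y). x \<otimes> inv y)"
proof -
  have "continuous_map (prod_topology T T) (prod_topology T T) (\<lambda>z. (fst z, inv (snd z)))"
    by (intro continuous_map_pairedI continuous_map_fst
        continuous_map_compose[OF continuous_map_snd continuous_inv, unfolded o_def])
  from continuous_map_compose[OF this continuous_mult] show ?thesis
    by (simp add: o_def case_prod_unfold)
qed

lemma continuous_map_pow: "continuous_map T T (\<lambda>x. x [^] (n::nat))"
proof (induction n)
  case 0 then show ?case by (simp add: topspace_eq)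
next
  case (Suc n)
  have "continuous_map T (prod_topology T T) (\<lambda>x. (x [^] n, x))"
    using Suc by (intro continuous_map_pairedI) auto
  from continuous_map_compose[OF this continuous_mult] show ?case by (simp add: o_def)
qed

lemma translate_eq_preimage:
  assumes "a \<in> carrier G" "C \<subseteq> carrier G"
  shows "(\<lambda>x. a \<otimes> x) ` C = {x \<in> topspace T. inv a \<otimes> x \<in> C}"
proof (intro Set.set_eqI iffI)
  fix x assume "x \<in> {x \<in> topspace T. inv a \<otimes> x \<in> C}"
  then have "x = a \<otimes> (inv a \<otimes> x)" "inv a \<otimes> x \<in> C" using assms by (auto simp: topspace_eq)
  then show "x \<in> (\<lambda>x. a \<otimes> x) ` C" by blast
next
  fix x assume "x \<in> (\<lambda>x. a \<otimes> x) ` C"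
  then show "x \<in> {x \<in> topspace T. inv a \<otimes> x \<in> C}"
    using assms by (auto simp: topspace_eq subset_iff)
qed

lemma closedin_carrier: "closedin T C \<Longrightarrow> C \<subseteq> carrier G"
  using closedin_subset topspace_eq by blast

lemma openin_carrier: "openin T C \<Longrightarrow> C \<subseteq> carrier G"
  using openin_subset topspace_eq by blast

lemma compactin_carrier: "compactin T C \<Longrightarrow> C \<subseteq> carrier G"
  using compactin_subset_topspace topspace_eq by blast

lemma openin_translate: "a \<in> carrier G \<Longrightarrow> openin T U \<Longrightarrow> openin T ((\<lambda>x. a \<otimes> x) ` U)"
  by (subst translate_eq_preimage)
    (auto intro!: openin_continuous_map_preimage[OF continuous_map_translate] dest: openin_carrier)

lemma closedin_translate: "a \<in> carrier G \<Longrightarrow> closedin T U \<Longrightarrow> closedin T ((\<lambda>x. a \<otimes> x) ` U)"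
  by (subst translate_eq_preimage)
    (auto intro!: closedin_continuous_map_preimage[OF continuous_map_translate] dest: closedin_carrier)

lemma set_mult_eq_Union: "A <#> B = (\<Union>a\<in>A. (\<lambda>x. a \<otimes> x) ` B)"
  by (auto simp: set_mult_def)

lemma openin_set_mult: "A \<subseteq> carrier G \<Longrightarrow> openin T U \<Longrightarrow> openin T (A <#> U)"
  unfolding set_mult_eq_Union using openin_translate by blast

lemma closedin_finite_set_mult: "finite A \<Longrightarrow> A \<subseteq> carrier G \<Longrightarrow> closedin T U \<Longrightarrow> closedin T (A <#> U)"
  unfolding set_mult_eq_Union using closedin_translate by (intro closedin_Union) auto

lemma compactin_set_mult:
  assumes "compactin T A" "compactin T B"
  shows "compactin T (A <#> B)"
proof -
  have "A <#> B = (\<lambda>(x, y). x \<otimes> y) ` (A \<times> B)" by (auto simp: set_mult_def)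
  moreover have "compactin (prod_topology T T) (A \<times> B)" using assms by (simp add: compactin_Times)
  ultimately show ?thesis using image_compactin[OF _ continuous_mult] by metis
qed

lemma compactin_finite: "finite A \<Longrightarrow> A \<subseteq> carrier G \<Longrightarrow> compactin T A"
  by (simp add: finite_imp_compactin topspace_eq)

lemma compactin_pow_image: "compactin T K \<Longrightarrow> compactin T (pow_image G K n)"
  unfolding pow_image_def by (rule image_compactin[OF _ continuous_map_pow])

lemma compactin_closedin: "compactin T K \<Longrightarrow> closedin T K"
  using Hausdorff by (rule compactin_imp_closedin)

lemma compactin_closed_subset: "compactin T K \<Longrightarrow> closedin T C \<Longrightarrow> C \<subseteq> K \<Longrightarrow> compactin T C"
  using closed_compactin by blast

text \<open>Projection along a compact factor is a closed map, and \<open>A + K\<close> is the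
  projection of the closed set of pairs \<open>(x, k)\<close> with
  \<open>x - k \<in> A\<close>.\<close>

lemma closedin_set_mult_compactin:
  assumes A: "closedin T A" and K: "compactin T K"
  shows "closedin T (A <#> K)"
proof -
  let ?P = "prod_topology T (subtopology T K)"
  have Kc: "K \<subseteq> carrier G" and Ac: "A \<subseteq> carrier G" using K A by (auto dest: compactin_carrier closedin_carrier)
  then have tP: "topspace ?P = carrier G \<times> K" by (auto simp: topspace_eq)
  let ?S = "{z \<in> topspace ?P. (\<lambda>(x, y). x \<otimes> inv y) z \<in> A}"
  have "continuous_map ?P T (\<lambda>(x, y). x \<otimes> inv y)"
    using continuous_map_from_subtopology[OF continuous_map_diff, of "UNIV \<times> K"]
      prod_topology_subtopology(2)[of T T K] topspace_eq
    by (metis continuous_map_diff continuous_map_from_subtopology)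
  then have "closedin ?P ?S" using A by (rule closedin_continuous_map_preimage)
  moreover have "closed_map ?P T fst"
    using K by (intro closed_map_fst) (simp add: compact_space_subtopology)
  ultimately have "closedin T (fst ` ?S)" by (simp add: closed_map_def)
  moreover have "fst ` ?S = A <#> K"
  proof (intro Set.set_eqI iffI)
    fix x assume "x \<in> fst ` ?S"
    then obtain k where k: "x \<in> carrier G" "k \<in> K" "x \<otimes> inv k \<in> A" unfolding tP by auto
    then have "x = (x \<otimes> inv k) \<otimes> k" using Kc by auto
    then show "x \<in> A <#> K" using k unfolding set_mult_iff by blast
  next
    fix x assume "x \<in> A <#> K"
    then obtain a k where ak: "a \<in> A" "k \<in> K" "x = a \<otimes> k" by (rule set_multE)
    moreover have "a \<in> carrier G" "k \<in> carrier G" using ak Ac Kc by auto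
    ultimately have "(x, k) \<in> ?S" unfolding tP by auto
    then show "x \<in> fst ` ?S" by force
  qed
  ultimately show ?thesis by simp
qed

lemma openin_subgroup_closedin:
  assumes "subgroup V G" "openin T V"
  shows "closedin T V"
proof -
  have Vc: "V \<subseteq> carrier G" using assms(1) subgroup.subset by blast
  have "carrier G - V = (carrier G - V) <#> V"
  proof (intro Set.set_eqI iffI)
    fix x assume "x \<in> carrier G - V"
    then show "x \<in> (carrier G - V) <#> V" using subset_set_mult_left[OF assms(1), of "carrier G - V"] by blast
  next
    fix x assume "x \<in> (carrier G - V) <#> V"
    then obtain a v where av: "a \<in> carrier G - V" "v \<in> V" "x = a \<otimes> v" by (rule set_multE)
    then show "x \<in> carrier G - V" using subgroup_mult_right[OF assms(1), of v a] Vc by auto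
  qed
  then have "openin T (topspace T - V)" using openin_set_mult[OF _ assms(2), of "carrier G - V"] topspace_eq by auto
  then show ?thesis using Vc topspace_eq by (simp add: closedin_def)
qed

text \<open>A coset \<open>x + V\<close> either misses \<open>S\<close> or contains some
  \<open>s \<in> S\<close>, and then it meets \<open>S\<close> in the closed translate
  \<open>s + (S \<inter> V)\<close>. This reduces the closedness of sums to a statement inside a
  compact open subgroup.\<close>

lemma closedin_subgroup_if_locally:
  assumes S: "subgroup S G" and V: "subgroup V G" "openin T V" and SV: "closedin T (S \<inter> V)"
  shows "closedin T S"
proof -
  have Sc: "S \<subseteq> carrier G" and Vc: "V \<subseteq> carrier G" using S V(1) subgroup.subset by blast+
  have "\<exists>W. openin T W \<and> x \<in> W \<and> W \<subseteq> topspace T - S" if x: "x \<in> topspace T - S" for x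
  proof (cases "\<exists>v\<in>V. x \<otimes> v \<in> S")
    case False
    then show ?thesis using openin_translate[OF _ V(2), of x] x V(1) topspace_eq Vc
      by (intro exI[of _ "(\<lambda>v. x \<otimes> v) ` V"]) (auto simp: subgroup.one_closed image_iff intro!: bexI[of _ \<one>])
  next
    case True
    then obtain v where v: "v \<in> V" "x \<otimes> v \<in> S" by blast
    have vc: "v \<in> carrier G" "x \<in> carrier G" using v Vc x topspace_eq by auto
    let ?W = "(\<lambda>u. x \<otimes> u) ` V - (\<lambda>u. (x \<otimes> v) \<otimes> u) ` (S \<inter> V)"
    have "openin T ?W" using openin_translate[OF _ V(2)] closedin_translate[OF _ SV] vc by (intro openin_diff) auto
    moreover have "x \<in> ?W"
    proof -
      have "x \<noteq> (x \<otimes> v) \<otimes> u" if "u \<in> S" for u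
        using subgroup.m_closed[OF S v(2) that] x by auto
      moreover have "x = x \<otimes> \<one>" "\<one> \<in> V" using vc V(1) by (auto simp: subgroup.one_closed)
      ultimately show ?thesis by blast
    qed
    moreover have "?W \<subseteq> topspace T - S"
    proof
      fix w assume "w \<in> ?W"
      then obtain u where u: "u \<in> V" "w = x \<otimes> u" and n: "w \<notin> (\<lambda>u. (x \<otimes> v) \<otimes> u) ` (S \<inter> V)" by blast
      have uc: "u \<in> carrier G" using u Vc by blast
      have False if "w \<in> S"
      proof -
        have e: "inv v \<otimes> u = inv (x \<otimes> v) \<otimes> w"
          using u(2) uc vc by (simp add: inv_mult m_ac)
        have "inv v \<otimes> u \<in> S \<inter> V"
          using subgroup.m_closed[OF S subgroup.m_inv_closed[OF S v(2)] that]
            subgroup.m_closed[OF V(1) subgroup.m_inv_closed[OF V(1) v(1)] u(1)] e by simp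
        moreover have "w = (x \<otimes> v) \<otimes> (inv v \<otimes> u)" using u(2) uc vc by (simp add: m_assoc)
        ultimately show False using n by blast
      qed
      then show "w \<in> topspace T - S" using u uc vc topspace_eq by auto
    qed
    ultimately show ?thesis by blast
  qed
  then have "openin T (topspace T - S)" using openin_subopen by blast
  then show ?thesis using Sc topspace_eq by (simp add: closedin_def)
qed

lemma subgroup_closure_of:
  assumes H: "subgroup H G"
  shows "subgroup (T closure_of H) G"
proof
  show "T closure_of H \<subseteq> carrier G" using closure_of_subset_topspace topspace_eq by metis
  show "\<one> \<in> T closure_of H"
    using closure_of_subset[of H T] topspace_eq H by (auto simp: subgroup.one_closed subgroup.subset)
  fix x assume x: "x \<in> T closure_of H"
  have "(\<lambda>x. inv x) ` (T closure_of H) \<subseteq> T closure_of ((\<lambda>x. inv x) ` H)"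
    using continuous_inv by (rule continuous_map_image_closure_subset)
  also have "\<dots> \<subseteq> T closure_of H" using H by (intro closure_of_mono) (auto simp: subgroup.m_inv_closed)
  finally show "inv x \<in> T closure_of H" using x by blast
  fix y assume y: "y \<in> T closure_of H"
  have "(\<lambda>(x, y). x \<otimes> y) ` (prod_topology T T closure_of (H \<times> H)) \<subseteq> T closure_of ((\<lambda>(x, y). x \<otimes> y) ` (H \<times> H))"
    using continuous_mult by (rule continuous_map_image_closure_subset)
  also have "\<dots> \<subseteq> T closure_of H" using H by (intro closure_of_mono) (auto simp: subgroup.m_closed)
  finally show "x \<otimes> y \<in> T closure_of H" using x y by (auto simp: closure_of_Times)
qed

lemma closed_subgroup_closure_of: "subgroup H G \<Longrightarrow> closed_subgroup G T (T closure_of H)"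
  by (simp add: closed_subgroup_def subgroup_closure_of)

lemma closed_subgroup_Int: "closed_subgroup G T A \<Longrightarrow> closed_subgroup G T B \<Longrightarrow> closed_subgroup G T (A \<inter> B)"
  by (simp add: closed_subgroup_def subgroup_Int closedin_Int)

lemma closed_subgroup_pow_preimage:
  assumes "closed_subgroup G T K" "closed_subgroup G T L"
  shows "closed_subgroup G T {x \<in> K. x [^] (n::nat) \<in> L}"
proof -
  have "{x \<in> K. x [^] n \<in> L} = K \<inter> {x \<in> topspace T. x [^] n \<in> L}"
    using assms(1) closedin_subset by (auto simp: closed_subgroup_def)
  then have "closedin T {x \<in> K. x [^] n \<in> L}"
    using assms closedin_continuous_map_preimage[OF continuous_map_pow]
    by (simp add: closed_subgroup_def closedin_Int)
  then show ?thesis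
    using assms by (simp add: closed_subgroup_def subgroup_pow_preimage)
qed

lemma openin_rcos_image:
  assumes sN: "subgroup N G" and U: "openin T U"
  shows "openin (quotient_topology G T N) ((\<lambda>x. N #> x) ` U)"
proof -
  let ?q = "\<lambda>x. N #> x"
  have Nc: "N \<subseteq> carrier G" using sN by (rule subgroup.subset)
  have Uc: "U \<subseteq> carrier G" using U by (rule openin_carrier)
  have "{x \<in> topspace T. ?q x \<in> ?q ` U} = N <#> U"
  proof (intro subset_antisym subsetI)
    fix x assume "x \<in> {x \<in> topspace T. ?q x \<in> ?q ` U}"
    then obtain u where u: "x \<in> carrier G" "u \<in> U" "?q x = ?q u" using topspace_eq by auto
    then have "x \<otimes> inv u \<in> N" using rcos_eq_iff[OF sN] Uc by blast
    moreover have "x = (x \<otimes> inv u) \<otimes> u" using u Uc by auto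
    ultimately show "x \<in> N <#> U" using u(2) set_multI by metis
  next
    fix x assume "x \<in> N <#> U"
    then obtain n u where nu: "n \<in> N" "u \<in> U" "x = n \<otimes> u" by (rule set_multE)
    then have c: "n \<in> carrier G" "u \<in> carrier G" using Nc Uc by auto
    then have "x \<otimes> inv u \<in> N" using nu by simp
    then have "?q x = ?q u" using rcos_eq_iff[OF sN, of x u] c nu by simp
    then show "x \<in> {x \<in> topspace T. ?q x \<in> ?q ` U}" using nu c topspace_eq by auto
  qed
  moreover have "openin T (N <#> U)" using openin_set_mult[OF Nc U] .
  ultimately show ?thesis using Uc unfolding openin_quotient_topology carrier_FactGroup by auto
qed

definition tgen :: "'a set \<Rightarrow> 'a set" where
  "tgen F = T closure_of (generate G F)"

lemma closed_subgroup_tgen: "F \<subseteq> carrier G \<Longrightarrow> closed_subgroup G T (tgen F)"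
  unfolding tgen_def by (intro closed_subgroup_closure_of generate_is_subgroup)

lemma generate_subset_tgen: "F \<subseteq> carrier G \<Longrightarrow> generate G F \<subseteq> tgen F"
  unfolding tgen_def by (metis closure_of_subset generate_incl topspace_eq)

lemma subset_tgen: "F \<subseteq> carrier G \<Longrightarrow> F \<subseteq> tgen F"
  using generate_subset_tgen[of F] generate.incl[of _ F G] by blast

lemma tgen_subset: "closed_subgroup G T H \<Longrightarrow> F \<subseteq> H \<Longrightarrow> tgen F \<subseteq> H"
  unfolding tgen_def closed_subgroup_def by (meson closure_of_minimal generate_subgroup_incl)

lemma tgen_mono: "F \<subseteq> F' \<Longrightarrow> F' \<subseteq> carrier G \<Longrightarrow> tgen F \<subseteq> tgen F'"
  by (meson closed_subgroup_tgen subset_tgen tgen_subset subset_trans)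

lemma tgen_empty: "tgen {} = {\<one>}"
  unfolding tgen_def generate_empty
  by (simp add: Hausdorff Hausdorff_imp_t1_space closure_of_eq closedin_Hausdorff_singleton topspace_eq)

lemma closed_subgroup_trivial: "closed_subgroup G T {\<one>}"
  using closed_subgroup_tgen[of "{}"] by (simp add: tgen_empty)

lemma topologically_generates_iff: "topologically_generates G T F H \<longleftrightarrow> F \<subseteq> carrier G \<and> H = tgen F"
  by (simp add: topologically_generates_def tgen_def)

text \<open>The abstract group generated by \<open>F\<close> is covered by finitely many translates
  of \<open>L\<close>. Since \<open>L\<close> is closed, so is their union, and the same finite
  cover works for the closure.\<close>

lemma tgen_cover:
  assumes F: "finite F" "F \<subseteq> carrier G" and L: "closed_subgroup G T L" and q: "q > 0" "\<And>f. f \<in> F \<Longrightarrow> f [^] (q::nat) \<in> L"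
  obtains C where "finite C" "card C \<le> q ^ card F" "C \<subseteq> generate G F" "tgen F \<subseteq> C <#> L"
proof -
  obtain C where C: "finite C" "card C \<le> q ^ card F" "C \<subseteq> generate G F" "generate G F \<subseteq> C <#> L"
    using generate_combinations[OF F _ q] L unfolding closed_subgroup_def by blast
  have "closedin T (C <#> L)"
    using C L generate_incl[OF F(2)] by (intro closedin_finite_set_mult) (auto simp: closed_subgroup_def)
  then have "tgen F \<subseteq> C <#> L" unfolding tgen_def using C(4) by (rule closure_of_minimal[rotated])
  then show thesis using that C by blast
qed

end

section \<open>Groups with small compact open subgroups\<close>

text \<open>Unlike \<^locale>\<open>lca_p_group\<close>, the following conditions pass to closed subgroups and to quotients by
  closed subgroups at once; every group in (b) is of this form.\<close>

locale linear_p_group = topological_comm_group +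
  fixes p :: nat
  assumes prime: "prime p"
    and base: "openin T N \<Longrightarrow> \<one> \<in> N \<Longrightarrow>
      \<exists>V. subgroup V G \<and> openin T V \<and> compactin T V \<and> V \<subseteq> N"
    and eventually_in: "subgroup V G \<Longrightarrow> openin T V \<Longrightarrow> x \<in> carrier G \<Longrightarrow> \<exists>k. x [^] (p ^ k) \<in> V"
begin

lemma p_pos: "p > 0"
  using prime prime_gt_0_nat by blast

lemma closed_subgroup_carrier: "closed_subgroup G T (carrier G)"
  unfolding closed_subgroup_def by (metis closedin_topspace subgroup_self topspace_eq)

lemma closed_subgroup_compact: "subgroup K G \<Longrightarrow> compactin T K \<Longrightarrow> closed_subgroup G T K"
  by (simp add: closed_subgroup_def compactin_closedin)

lemma compact_open_subgroup:
  obtains V where "subgroup V G" "openin T V" "compactin T V"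
  using base[OF openin_topspace] topspace_eq one_closed by metis

lemma compact_cover:
  assumes K: "compactin T K" and V: "subgroup V G" "openin T V"
  obtains C where "finite C" "C \<subseteq> K" "K \<subseteq> C <#> V"
proof -
  have Kc: "K \<subseteq> carrier G" using K by (rule compactin_carrier)
  let ?U = "(\<lambda>x. (\<lambda>v. x \<otimes> v) ` V) ` K"
  have "\<forall>U\<in>?U. openin T U" using openin_translate[OF _ V(2)] Kc by auto
  moreover have "K \<subseteq> \<Union>?U"
    using subset_set_mult_left[OF V(1) Kc] by (auto simp: set_mult_eq_Union)
  ultimately obtain F where "finite F" "F \<subseteq> ?U" "K \<subseteq> \<Union>F"
    using K unfolding compactin_def by meson
  then obtain C where "finite C" "C \<subseteq> K" "F = (\<lambda>x. (\<lambda>v. x \<otimes> v) ` V) ` C"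
    by (meson finite_subset_image)
  then show thesis using that \<open>K \<subseteq> \<Union>F\<close> by (simp add: set_mult_eq_Union)
qed

lemma finite_cosets_compact:
  assumes K: "compactin T K" and V: "subgroup V G" "openin T V"
  shows "finite (cosets G V K)"
proof -
  obtain C where "finite C" "C \<subseteq> K" "K \<subseteq> C <#> V" using compact_cover[OF assms] .
  then show ?thesis using cosets_finite_card(1)[of C V K] V(1) compactin_carrier[OF K] by blast
qed

text \<open>Only finitely many coset representatives have to be moved into \<open>V\<close>, because
  \<open>V\<close> is stable under powers. Hence the sets \<open>p^k K\<close> tend to zero
  uniformly, although \<open>eventually_in\<close> speaks about single elements.\<close>

lemma compact_uniform_power:
  assumes K: "compactin T K" and V: "subgroup V G" "openin T V"
  obtains k where "pow_image G K (p ^ k) \<subseteq> V"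
proof -
  obtain C where C: "finite C" "C \<subseteq> K" "K \<subseteq> C <#> V" using compact_cover[OF assms] .
  have Cc: "C \<subseteq> carrier G" "V \<subseteq> carrier G" using C compactin_carrier[OF K] subgroup.subset[OF V(1)] by auto
  obtain k where k: "\<And>c. c \<in> C \<Longrightarrow> c [^] (p ^ k) \<in> V"
    using uniform_p_power[OF C(1) V(1) Cc(1), of p] eventually_in[OF V] Cc by blast
  have "pow_image G K (p ^ k) \<subseteq> pow_image G C (p ^ k) <#> pow_image G V (p ^ k)"
    using pow_image_mono[OF C(3)] pow_image_set_mult[OF Cc] by simp
  also have "\<dots> \<subseteq> V"
    using k V(1) pow_image_subset[OF V(1)] by (intro set_mult_subset) (auto simp: pow_image_def)
  finally show thesis using that by blast
qed

lemma closed_separation: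
  assumes W: "closedin T W" and z: "z \<in> carrier G" "z \<notin> W"
  obtains V where "subgroup V G" "openin T V" "z \<notin> W <#> V"
proof -
  let ?N = "{x \<in> topspace T. z \<otimes> inv x \<in> topspace T - W}"
  have "openin T ?N"
    using continuous_map_compose[OF continuous_inv continuous_map_translate[OF z(1)]] W
    by (intro openin_continuous_map_preimage[of T T "\<lambda>x. z \<otimes> inv x"]) (auto simp: o_def closedin_def)
  moreover have "\<one> \<in> ?N" using z by (simp add: topspace_eq)
  ultimately obtain V where V: "subgroup V G" "openin T V" "V \<subseteq> ?N" using base by meson
  have "z \<notin> W <#> V"
  proof
    assume "z \<in> W <#> V"
    then obtain w v where wv: "w \<in> W" "v \<in> V" "z = w \<otimes> v" by (rule set_multE)
    then have "w \<in> carrier G" "v \<in> carrier G" using closedin_carrier[OF W] V(3) topspace_eq by auto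
    then have "z \<otimes> inv v = w" using wv by simp
    then show False using wv V(3) by blast
  qed
  then show thesis using that V by blast
qed

text \<open>A closed set is the intersection of its thickenings by open subgroups, and some
  \<open>p^j U\<close> lies in each of these. This supplies the limit over \<open>j\<close> for
  inclusions that hold up to an error in every \<open>p^j U\<close>.\<close>

lemma in_closed_if_in_all_powers:
  assumes W: "closedin T W" and U: "compactin T U" and z: "\<And>j. z \<in> W <#> pow_image G U (p ^ j)"
  shows "z \<in> W"
proof (rule ccontr)
  assume "z \<notin> W"
  have "z \<in> carrier G"
    using z[of 0] closedin_carrier[OF W] compactin_carrier[OF U] by (auto simp: pow_image_def elim!: set_multE)
  then obtain V where V: "subgroup V G" "openin T V" "z \<notin> W <#> V"
    using closed_separation[OF W _ \<open>z \<notin> W\<close>] by metis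
  obtain k where k: "pow_image G U (p ^ k) \<subseteq> V" using compact_uniform_power[OF U V(1,2)] .
  show False using subsetD[OF mono_set_mult[OF order_refl k] z[of k]] V(3) by blast
qed

text \<open>Iterating the inclusion puts \<open>U\<close> into \<open>W + p^j U\<close> for all
  \<open>j\<close>, and compactness of \<open>U\<close> makes the last term vanish in the
  limit.\<close>

lemma nakayama:
  assumes W: "closed_subgroup G T W" and U: "subgroup U G" "compactin T U"
    and "U \<subseteq> W <#> pow_image G U p"
  shows "U \<subseteq> W"
proof
  fix z assume "z \<in> U"
  then show "z \<in> W"
    using subset_set_mult_pow_image_iterate[OF _ U(1) assms(4)] W U
    by (intro in_closed_if_in_all_powers[of W U]) (auto simp: closed_subgroup_def)
qed

text \<open>A common power of the generators lies in a compact open \<open>V\<close>, so the closure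
  is covered by finitely many translates of \<open>V\<close>. Finitely generated closed subgroups
  are thus compact, which makes their sums with closed sets closed.\<close>

lemma compactin_tgen:
  assumes "finite F" "F \<subseteq> carrier G"
  shows "compactin T (tgen F)"
proof -
  obtain V where V: "subgroup V G" "openin T V" "compactin T V" by (rule compact_open_subgroup)
  obtain k where k: "pow_image G F (p ^ k) \<subseteq> V"
    using compact_uniform_power[OF compactin_finite[OF assms] V(1,2)] .
  have "p ^ k > 0" "\<And>f. f \<in> F \<Longrightarrow> f [^] (p ^ k) \<in> V" using p_pos k unfolding pow_image_def by (simp, blast)
  from tgen_cover[OF assms closed_subgroup_compact[OF V(1,3)] this]
  obtain C where C: "finite C" "C \<subseteq> generate G F" "tgen F \<subseteq> C <#> V" by metis
  have "compactin T (C <#> V)"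
    using C V generate_incl[OF assms(2)] by (intro compactin_set_mult[OF compactin_finite]) auto
  then show ?thesis
    using C(3) closed_subgroup_tgen[OF assms(2)] compactin_closed_subset by (auto simp: closed_subgroup_def)
qed

section \<open>Procyclic subgroups and closed subgroups of finitely generated groups\<close>

lemma subgroup_tgen: "F \<subseteq> carrier G \<Longrightarrow> subgroup (tgen F) G"
  using closed_subgroup_tgen by (simp add: closed_subgroup_def)

lemma tgen_singleton:
  assumes "a \<in> carrier G"
  shows "closed_subgroup G T (tgen {a})" "subgroup (tgen {a}) G" "compactin T (tgen {a})" "a \<in> tgen {a}"
  using assms closed_subgroup_tgen subgroup_tgen compactin_tgen subset_tgen[of "{a}"] by auto

lemma closed_subgroup_set_mult:
  assumes "closed_subgroup G T A" "subgroup K G" "compactin T K"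
  shows "closed_subgroup G T (A <#> K)"
  using assms by (auto simp: closed_subgroup_def mult_subgroups closedin_set_mult_compactin)

lemma closed_subgroup_pow_image:
  assumes "subgroup K G" "compactin T K"
  shows "closed_subgroup G T (pow_image G K n)"
  using assms by (intro closed_subgroup_compact subgroup_pow_image compactin_pow_image)

lemma pow_in_tgen:
  assumes "z \<in> carrier G" "w \<in> tgen {z}"
  shows "w [^] (m::nat) \<in> tgen {z [^] m}"
proof -
  have "tgen {z} \<subseteq> {x \<in> carrier G. x [^] m \<in> tgen {z [^] m}}"
    using assms subset_tgen[of "{z [^] m}"]
    by (intro tgen_subset closed_subgroup_pow_preimage closed_subgroup_carrier closed_subgroup_tgen) auto
  then show ?thesis using assms by blast
qed

text \<open>The quotient of \<open>tgen {a}\<close> by its \<open>p\<close>-multiples is generated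
  by the class of \<open>a\<close>. Integer exponents replace \<open>p\<close>-adic ones at the cost
  of the error \<open>w\<close>.\<close>

lemma tgen_singleton_decompose:
  assumes a: "a \<in> carrier G" and z: "z \<in> tgen {a}"
  obtains i :: int and w where "w \<in> pow_image G (tgen {a}) p" "z = a [^] i \<otimes> w"
proof -
  let ?Z = "tgen {a}"
  have Z: "subgroup ?Z G" "compactin T ?Z" "a \<in> ?Z"
    by (rule tgen_singleton[OF a])+
  have "finite {a}" "{a} \<subseteq> carrier G" "\<And>f. f \<in> {a} \<Longrightarrow> f [^] p \<in> pow_image G ?Z p"
    using a pow_imageI[OF Z(3)] by auto
  from tgen_cover[OF this(1,2) closed_subgroup_pow_image[OF Z(1,2)] p_pos this(3)]
  obtain C where "C \<subseteq> generate G {a}" "?Z \<subseteq> C <#> pow_image G ?Z p" by metis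
  moreover from this obtain c w where cw: "c \<in> C" "w \<in> pow_image G ?Z p" "z = c \<otimes> w"
    using z by (meson set_multE subsetD)
  ultimately obtain i :: int where "c = a [^] i" using generate_pow[OF a] by blast
  then show thesis using that cw by blast
qed

text \<open>A \<open>p\<close>-adic integer that is not a multiple of \<open>p\<close> is a unit.
  Here \<open>z\<close> is \<open>i\<close> times \<open>a\<close> modulo \<open>pZ\<close> with
  \<open>i\<close> prime to \<open>p\<close>; Bezout inverts \<open>i\<close> modulo
  \<open>p\<close>, and Nakayama removes the error term.\<close>

lemma tgen_eq_if_not_p_multiple:
  assumes a: "a \<in> carrier G" and z: "z \<in> tgen {a}" "z \<notin> pow_image G (tgen {a}) p"
  shows "tgen {z} = tgen {a}"
proof
  let ?Z = "tgen {a}"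
  have Z: "closed_subgroup G T ?Z" "subgroup ?Z G" "compactin T ?Z" "a \<in> ?Z"
    by (rule tgen_singleton[OF a])+
  let ?P = "pow_image G ?Z p"
  have P: "subgroup ?P G" using Z subgroup_pow_image by blast
  have zc: "z \<in> carrier G" using z Z by (auto simp: subgroup.mem_carrier)
  have tz: "closed_subgroup G T (tgen {z})" "subgroup (tgen {z}) G" "z \<in> tgen {z}"
    by (rule tgen_singleton[OF zc])+
  show "tgen {z} \<subseteq> ?Z" using Z z by (intro tgen_subset) auto
  obtain i :: int and w where w: "w \<in> ?P" "z = a [^] i \<otimes> w"
    using tgen_singleton_decompose[OF a z(1)] .
  have wc: "w \<in> carrier G" using w P by (auto simp: subgroup.mem_carrier)
  have ap: "a [^] p \<in> ?P" using Z pow_imageI by blast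
  have api: "a [^] (int p * t) \<in> ?P" for t
    using subgroup_int_pow_closed[OF P ap, of t] a int_pow_pow[OF a, of "int p" t] by (simp add: int_pow_int)
  have "\<not> int p dvd i"
  proof
    assume "int p dvd i"
    then obtain t where "i = int p * t" by blast
    then have "z \<in> ?P" using w api[of t] P by (auto intro: subgroup.m_closed)
    then show False using z by blast
  qed
  then have "coprime i (int p)"
    using prime_imp_coprime[of "int p" i] prime by (simp add: coprime_commute)
  then obtain s t where st: "i * s + int p * t = 1"
    using bezout_int[of i "int p"] by (metis coprime_imp_gcd_eq_1 mult.commute)
  have "a \<in> tgen {z} <#> ?P"
  proof -
    have "a [^] i = z \<otimes> inv w" using w wc a by simp
    then have "a = (z \<otimes> inv w) [^] s \<otimes> a [^] (int p * t)"
      using a st by (metis int_pow_mult int_pow_pow int_pow_1)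
    also have "\<dots> = z [^] s \<otimes> (inv w [^] s \<otimes> a [^] (int p * t))"
      using a zc wc by (simp add: int_pow_mult_distrib m_ac)
    finally have e: "a = z [^] s \<otimes> (inv w [^] s \<otimes> a [^] (int p * t))" .
    have "z [^] s \<in> tgen {z}" using tz by (intro subgroup_int_pow_closed)
    moreover have "inv w [^] s \<otimes> a [^] (int p * t) \<in> ?P"
      by (rule subgroup.m_closed[OF P subgroup_int_pow_closed[OF P subgroup.m_inv_closed[OF P w(1)]] api])
    ultimately show ?thesis using e set_multI by metis
  qed
  moreover have "closed_subgroup G T (tgen {z} <#> ?P)"
    using tz P Z by (intro closed_subgroup_set_mult compactin_pow_image)
  ultimately have "?Z \<subseteq> tgen {z} <#> ?P" by (intro tgen_subset) auto
  then show "?Z \<subseteq> tgen {z}" by (rule nakayama[OF tz(1) Z(2,3)])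
qed

text \<open>The number \<open>m\<close> is invertible modulo every \<open>p ^ j\<close>, so
  \<open>x\<close> is a multiple of \<open>m x\<close> up to \<open>p ^ j\<close> times an element
  of \<open>tgen {x}\<close>; compactness removes this error.\<close>

lemma in_tgen_coprime_power:
  assumes x: "x \<in> carrier G" and m: "\<not> p dvd m"
  shows "x \<in> tgen {x [^] m}"
proof (rule in_closed_if_in_all_powers[of _ "tgen {x}"])
  show "closedin T (tgen {x [^] m})"
    using x closed_subgroup_tgen[of "{x [^] m}"] by (simp add: closed_subgroup_def)
  show "compactin T (tgen {x})" using x by (intro compactin_tgen) auto
  fix j
  have "coprime (int m) (int p ^ j)"
    using prime_imp_coprime[OF prime m] by (simp add: coprime_commute)
  then obtain s t where st: "int m * s + int (p ^ j) * t = 1"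
    using bezout_int[of "int m" "int p ^ j"] by (metis coprime_imp_gcd_eq_1 mult.commute of_nat_power)
  have "x = (x [^] m) [^] s \<otimes> (x [^] t) [^] (p ^ j)"
  proof -
    have "x = x [^] (int m * s + int (p ^ j) * t)" using st x by simp
    also have "\<dots> = (x [^] int m) [^] s \<otimes> (x [^] t) [^] int (p ^ j)"
      using x by (simp only: int_pow_mult int_pow_pow mult.commute[of "int (p ^ j)" t])
    finally show ?thesis unfolding int_pow_int .
  qed
  moreover have "(x [^] m) [^] s \<in> tgen {x [^] m}"
    using x subset_tgen[of "{x [^] m}"] by (intro subgroup_int_pow_closed subgroup_tgen) auto
  moreover have "(x [^] t) [^] (p ^ j) \<in> pow_image G (tgen {x}) (p ^ j)"
    using x subset_tgen[of "{x}"] by (intro pow_imageI subgroup_int_pow_closed subgroup_tgen) auto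
  ultimately show "x \<in> tgen {x [^] m} <#> pow_image G (tgen {x}) (p ^ j)" using set_multI by metis
qed

text \<open>The analogue of the theorem that submodules of an \<open>n\<close>-generated module over
  a principal ideal domain are \<open>n\<close>-generated. By induction \<open>H \<inter> U\<close>
  needs at most \<open>card F\<close> generators, and a single \<open>h \<in> H\<close> whose
  component in \<open>Z\<close> is least divisible by \<open>p\<close> generates the rest.\<close>

lemma closed_subgroup_of_tgen:
  assumes "finite F" "F \<subseteq> carrier G" "closed_subgroup G T H" "H \<subseteq> tgen F"
  shows "\<exists>F'. finite F' \<and> card F' \<le> card F \<and> F' \<subseteq> H \<and> H = tgen F'"
  using assms
proof (induction F arbitrary: H)
  case empty
  then have "H = {\<one>}" by (auto simp: tgen_empty closed_subgroup_def dest: subgroup.one_closed)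
  then show ?case by (intro exI[of _ "{}"]) (simp add: tgen_empty)
next
  case (insert a F)
  have a: "a \<in> carrier G" "F \<subseteq> carrier G" using insert.prems by auto
  let ?Z = "tgen {a}" and ?U = "tgen F"
  have Z: "closed_subgroup G T ?Z" "subgroup ?Z G" "compactin T ?Z" "a \<in> ?Z"
    by (rule tgen_singleton[OF a(1)])+
  have U: "closed_subgroup G T ?U" "subgroup ?U G"
    using a closed_subgroup_tgen subgroup_tgen by auto
  have H: "subgroup H G" using insert.prems by (simp add: closed_subgroup_def)
  have Hc: "H \<subseteq> carrier G" using H by (rule subgroup.subset)
  have "tgen (insert a F) \<subseteq> ?U <#> ?Z"
  proof (rule tgen_subset)
    show "closed_subgroup G T (?U <#> ?Z)" using U Z by (intro closed_subgroup_set_mult)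
    show "insert a F \<subseteq> ?U <#> ?Z"
      using subset_set_mult_left[OF Z(2) subgroup.subset[OF U(2)]] subset_set_mult_right[OF U(2) subgroup.subset[OF Z(2)]]
        subset_tgen[OF a(2)] Z(4) by blast
  qed
  then have HUZ: "H \<subseteq> ?U <#> ?Z" using insert.prems by blast
  obtain F' where F': "finite F'" "card F' \<le> card F" "F' \<subseteq> H \<inter> ?U" "H \<inter> ?U = tgen F'"
    using insert.IH[of "H \<inter> ?U"] a U insert.prems closed_subgroup_Int by (metis inf_le2)
  show ?case
  proof (cases "\<forall>k. H \<subseteq> ?U <#> pow_image G ?Z (p ^ k)")
    case True
    then have "H \<subseteq> ?U"
      using in_closed_if_in_all_powers[of ?U ?Z] U Z by (meson closed_subgroup_def subsetD subsetI)
    then have "H \<inter> ?U = H" by blast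
    then show ?thesis using F' insert.hyps by (intro exI[of _ F']) auto
  next
    case False
    \<comment> \<open>The predecessor \<open>j\<close> of \<open>k\<close> is the largest exponent
      with \<open>H \<subseteq> U + p^j Z\<close>, that is, the valuation of the image of
      \<open>H\<close> in \<open>(U + Z) / U\<close>.\<close>
    define k where "k = (LEAST k. \<not> H \<subseteq> ?U <#> pow_image G ?Z (p ^ k))"
    have k: "\<not> H \<subseteq> ?U <#> pow_image G ?Z (p ^ k)"
      unfolding k_def using False by (metis (mono_tags, lifting) LeastI)
    have "k \<noteq> 0" using k HUZ Z by (auto simp: pow_image_1 subgroup.subset)
    then obtain j where j: "k = Suc j" using not0_implies_Suc by blast
    then have Hj: "H \<subseteq> ?U <#> pow_image G ?Z (p ^ j)"
      using not_less_Least[of j "\<lambda>k. \<not> H \<subseteq> ?U <#> pow_image G ?Z (p ^ k)"] by (simp flip: k_def)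
    obtain h where h: "h \<in> H" "h \<notin> ?U <#> pow_image G ?Z (p ^ k)" using k by blast
    obtain u z where u: "u \<in> ?U" "z \<in> pow_image G ?Z (p ^ j)" "h = u \<otimes> z" using h(1) Hj by (meson set_multE subsetD)
    obtain z0 where z0: "z0 \<in> ?Z" "z = z0 [^] (p ^ j)" using u(2) by (auto simp: pow_image_def)
    have z0c: "z0 \<in> carrier G" "u \<in> carrier G" "h \<in> carrier G"
      using z0 u h Z U Hc by (auto simp: subgroup.mem_carrier)
    \<comment> \<open>If \<open>z0\<close> were in \<open>pZ\<close>, then \<open>h\<close> would
      lie in \<open>U + p^k Z\<close>. So \<open>z0\<close> generates \<open>Z\<close>, and
      \<open>p^j Z\<close> is the procyclic group of \<open>z\<close>.\<close>
    have "z0 \<notin> pow_image G ?Z p"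
    proof
      assume "z0 \<in> pow_image G ?Z p"
      then have "z \<in> pow_image G (pow_image G ?Z p) (p ^ j)" using z0 pow_imageI by blast
      then have "z \<in> pow_image G ?Z (p ^ k)" using Z by (simp add: pow_image_pow_image subgroup.subset j)
      then show False using h u set_multI by metis
    qed
    then have tz0: "tgen {z0} = ?Z" using tgen_eq_if_not_p_multiple[OF a(1) z0(1)] by simp
    let ?h = "tgen {h}"
    have th: "closed_subgroup G T ?h" "subgroup ?h G" "compactin T ?h" "h \<in> ?h"
      by (rule tgen_singleton[OF z0c(3)])+
    have thH: "?h \<subseteq> H" using h insert.prems by (intro tgen_subset) auto
    have sUh: "closed_subgroup G T (?U <#> ?h)" using U th by (intro closed_subgroup_set_mult)
    then have sUh': "subgroup (?U <#> ?h) G" by (simp add: closed_subgroup_def)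
    have inUh: "?U \<subseteq> ?U <#> ?h" "?h \<subseteq> ?U <#> ?h"
      using subset_set_mult_left[OF th(2) subgroup.subset[OF U(2)]] subset_set_mult_right[OF U(2) subgroup.subset[OF th(2)]] by auto
    \<comment> \<open>Modulo \<open>U\<close> the elements \<open>z\<close> and \<open>h\<close>
      agree, so the sum of \<open>U\<close> and \<open>tgen {h}\<close> contains all of
      \<open>p^j Z\<close> and hence \<open>H\<close>.\<close>
    have "z \<in> ?U <#> ?h"
    proof -
      have "z = inv u \<otimes> h" using u z0 z0c by simp
      then show ?thesis using u(1) U th set_multI by (metis subgroup.m_inv_closed)
    qed
    then have zUh: "tgen {z} \<subseteq> ?U <#> ?h" using sUh by (intro tgen_subset) auto
    have "H \<subseteq> tgen (insert h F')"
    proof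
      fix y assume y: "y \<in> H"
      then obtain v w where v: "v \<in> ?U" "w \<in> pow_image G ?Z (p ^ j)" "y = v \<otimes> w" using Hj by (meson set_multE subsetD)
      then obtain w0 where "w0 \<in> ?Z" "w = w0 [^] (p ^ j)" by (auto simp: pow_image_def)
      then have "w \<in> tgen {z}" using pow_in_tgen[OF z0c(1)] tz0 z0 by simp
      then have "y \<in> ?U <#> ?h" using v zUh inUh sUh' by (auto intro: subgroup.m_closed)
      then obtain u' r where r: "u' \<in> ?U" "r \<in> ?h" "y = u' \<otimes> r" by (rule set_multE)
      have c: "u' \<in> carrier G" "r \<in> carrier G" using r U th by (auto simp: subgroup.mem_carrier)
      have "u' = y \<otimes> inv r" using r c by simp
      moreover have "r \<in> H" using r thH by blast
      ultimately have "u' \<in> H \<inter> ?U" using r(1) subgroup_diff[OF H y] by simp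
      then have u': "u' \<in> tgen F'" using F' by simp
      have F'c: "insert h F' \<subseteq> carrier G" using F' Hc z0c by auto
      have "u' \<in> tgen (insert h F')" "r \<in> tgen (insert h F')"
        using u' r tgen_mono[of F' "insert h F'"] tgen_mono[of "{h}" "insert h F'"] F'c by auto
      then show "y \<in> tgen (insert h F')" using r subgroup_tgen[OF F'c] by (auto intro: subgroup.m_closed)
    qed
    moreover have "tgen (insert h F') \<subseteq> H" using h F' insert.prems by (intro tgen_subset) auto
    ultimately have "H = tgen (insert h F')" by blast
    moreover have "card (insert h F') \<le> card (insert a F)"
      using F' insert.hyps card_insert_le_m1[of "Suc (card F)" F' h] by simp
    ultimately show ?thesis using F' h by (intro exI[of _ "insert h F'"]) auto
  qed
qed

end

section \<open>Finite rank and closed sums\<close>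

lemma finite_p_rank_iff: "finite_p_rank G T \<longleftrightarrow> (\<exists>n. p_rank_le G T n)"
proof
  assume "\<exists>n. p_rank_le G T n"
  then have "has_p_rank G T (LEAST n. p_rank_le G T n)"
    unfolding has_p_rank_def using LeastI_ex not_less_Least by metis
  then show "finite_p_rank G T" by (auto simp: finite_p_rank_def)
qed (auto simp: finite_p_rank_def has_p_rank_def)

context linear_p_group
begin

text \<open>A group with \<open>n\<close> topological generators has at most \<open>p ^ n\<close>
  classes modulo \<open>p\<close>. Both finiteness consequences of a rank bound come from choosing
  one element more than that.\<close>

lemma p_rank_le_cover:
  assumes "p_rank_le G T n" "finite F" "F \<subseteq> carrier G"
  obtains C where "finite C" "card C \<le> p ^ n" "C \<subseteq> tgen F" "tgen F \<subseteq> C <#> pow_image G (tgen F) p"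
proof -
  have "\<exists>F. finite F \<and> topologically_generates G T F (tgen F)"
    if "finite F" "F \<subseteq> carrier G" for F
    using that by (auto simp: topologically_generates_iff)
  then obtain F' where F': "finite F'" "card F' \<le> n" "F' \<subseteq> carrier G" "tgen F = tgen F'"
    using assms closed_subgroup_tgen[OF assms(3)] unfolding p_rank_le_def topologically_generates_iff by metis
  have P: "closed_subgroup G T (pow_image G (tgen F') p)"
    using F' by (intro closed_subgroup_pow_image subgroup_tgen compactin_tgen)
  have "\<And>f. f \<in> F' \<Longrightarrow> f [^] p \<in> pow_image G (tgen F') p"
    using subset_tgen[OF F'(3)] pow_imageI[of _ "tgen F'"] by blast
  from tgen_cover[OF F'(1,3) P p_pos this]
  obtain C where C: "finite C" "card C \<le> p ^ card F'" "C \<subseteq> generate G F'" "tgen F' \<subseteq> C <#> pow_image G (tgen F') p"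
    by metis
  moreover have "p ^ card F' \<le> p ^ n" using F' p_pos by (intro power_increasing) auto
  ultimately show thesis using that[of C] F' generate_subset_tgen[OF F'(3)] by (metis order_trans)
qed

text \<open>In a subgroup killed by \<open>p\<close> the classes modulo \<open>p\<close> are the
  elements themselves, so a finitely generated one has at most \<open>p ^ n\<close>
  elements.\<close>

lemma finite_socle_if_p_rank_le:
  assumes "p_rank_le G T n"
  shows "finite {x \<in> carrier G. x [^] p = \<one>}"
proof (rule ccontr)
  let ?S = "{x \<in> carrier G. x [^] p = \<one>}"
  assume "infinite ?S"
  from infinite_arbitrarily_large[OF this, of "Suc (p ^ n)"]
  obtain B where B: "finite B" "B \<subseteq> ?S" "card B = Suc (p ^ n)" by blast
  have Bc: "B \<subseteq> carrier G" using B by blast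
  have "closed_subgroup G T {\<one>}" by (rule closed_subgroup_trivial)
  from closed_subgroup_pow_preimage[OF closed_subgroup_carrier this, of p]
  have S: "closed_subgroup G T ?S" by simp
  have H: "tgen B \<subseteq> ?S" using S B by (intro tgen_subset)
  obtain C where C: "finite C" "card C \<le> p ^ n" "C \<subseteq> tgen B" "tgen B \<subseteq> C <#> pow_image G (tgen B) p"
    using p_rank_le_cover[OF assms B(1) Bc] .
  have "pow_image G (tgen B) p \<subseteq> {\<one>}" using H by (auto simp: pow_image_def)
  then have "C <#> pow_image G (tgen B) p \<subseteq> C"
    using C H by (auto elim!: set_multE simp: subset_iff)
  then have "B \<subseteq> C" using C subset_tgen[OF Bc] by blast
  then have "card B \<le> card C" by (rule card_mono[OF C(1)])
  then show False using B(3) C(2) by linarith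
qed

text \<open>Elements inequivalent modulo \<open>pG\<close> remain so modulo \<open>p\<close> times
  the closed subgroup that they generate, where at most \<open>p ^ n\<close> classes are
  available.\<close>

lemma finite_Frattini_quotient_if_p_rank_le:
  assumes "p_rank_le G T n"
  shows "finite (cosets G (pow_image G (carrier G) p) (carrier G))"
proof (rule ccontr)
  let ?P = "pow_image G (carrier G) p"
  assume "infinite (cosets G ?P (carrier G))"
  then obtain B where B: "finite B" "B \<subseteq> carrier G" "card B = Suc (p ^ n)" "inj_on (\<lambda>x. ?P #> x) B"
    using pick_inequivalent[of ?P "carrier G" "p ^ n"] by blast
  have P: "subgroup ?P G" by (intro subgroup_pow_image subgroup_self)
  obtain C where C: "finite C" "card C \<le> p ^ n" "C \<subseteq> tgen B" "tgen B \<subseteq> C <#> pow_image G (tgen B) p"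
    using p_rank_le_cover[OF assms B(1,2)] .
  have tc: "tgen B \<subseteq> carrier G" using subgroup_tgen[OF B(2)] subgroup.subset by blast
  have "B \<subseteq> C <#> ?P"
    using subset_trans[OF subset_tgen[OF B(2)] subset_trans[OF C(4) mono_set_mult[OF order_refl pow_image_mono[OF tc]]]] .
  then have "card (cosets G ?P B) \<le> card C"
    using cosets_finite_card(2)[OF C(1) _ P] C(3) tc by blast
  then show False using B(3,4) C(2) by (simp add: cosets_def card_image)
qed

text \<open>Burnside's basis theorem for abelian pro-\<open>p\<close> groups: representatives of
  \<open>U / pU\<close> generate topologically, by Nakayama.\<close>

lemma tgen_if_finite_Frattini_quotient:
  assumes U: "subgroup U G" "compactin T U" and fin: "finite (cosets G (pow_image G U p) U)"
  obtains F where "finite F" "F \<subseteq> U" "U = tgen F"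
proof -
  have Uc: "U \<subseteq> carrier G" using U subgroup.subset by blast
  obtain F where F: "finite F" "F \<subseteq> U" "U \<subseteq> F <#> pow_image G U p"
    using cosets_cover[OF fin Uc subgroup_pow_image[OF U(1)]] .
  have Fc: "F \<subseteq> carrier G" using F Uc by blast
  have "U \<subseteq> tgen F <#> pow_image G U p"
    using subset_trans[OF F(3) mono_set_mult[OF subset_tgen[OF Fc] order_refl]] .
  then have "U \<subseteq> tgen F" by (rule nakayama[OF closed_subgroup_tgen[OF Fc] U])
  moreover have "tgen F \<subseteq> U" using F U closed_subgroup_compact by (intro tgen_subset)
  ultimately show thesis using that F by blast
qed

text \<open>A finitely generated closed \<open>H\<close> is compact, so by Nakayama it is generated
  by generators of \<open>H \<inter> U\<close> together with representatives modulo
  \<open>pH + (H \<inter> U)\<close>. The former number at most \<open>card F\<close>; for the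
  latter, the socle of \<open>H / (H \<inter> U)\<close> embeds into that of \<open>G / U\<close>.
  Taking the size of the socle instead of its dimension gives a crude bound, which is enough for
  finiteness.\<close>

lemma finite_p_rank_if_open:
  assumes U: "subgroup U G" "openin T U" "compactin T U"
    and fU: "finite (cosets G (pow_image G U p) U)"
    and fQ: "finite (cosets G U {x \<in> carrier G. x [^] p \<in> U})"
  shows "finite_p_rank G T"
proof -
  obtain F where F: "finite F" "F \<subseteq> U" "U = tgen F"
    using tgen_if_finite_Frattini_quotient[OF U(1,3) fU] .
  have Uc: "U \<subseteq> carrier G" using U subgroup.subset by blast
  have Fc: "F \<subseteq> carrier G" using F Uc by blast
  let ?N = "card (cosets G U {x \<in> carrier G. x [^] p \<in> U})"
  have "p_rank_le G T (card F + ?N)"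
    unfolding p_rank_le_def topologically_generates_iff
  proof (intro allI impI)
    fix H assume H: "closed_subgroup G T H" and "\<exists>F. finite F \<and> F \<subseteq> carrier G \<and> H = tgen F"
    then have cH: "compactin T H" using compactin_tgen by blast
    have sH: "subgroup H G" and Hc: "H \<subseteq> carrier G" using H by (auto simp: closed_subgroup_def subgroup.subset)
    have sHU: "subgroup (H \<inter> U) G" using sH U by (intro subgroup_Int)
    have "closed_subgroup G T (H \<inter> U)" by (intro closed_subgroup_Int H closed_subgroup_compact U)
    then obtain F1 where F1: "finite F1" "card F1 \<le> card F" "F1 \<subseteq> H \<inter> U" "H \<inter> U = tgen F1"
      using closed_subgroup_of_tgen[OF F(1) Fc, of "H \<inter> U"] F(3) by blast
    have fin: "finite (cosets G (H \<inter> U) {x \<in> H. x [^] p \<in> H \<inter> U})"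
      and le: "card (cosets G (H \<inter> U) {x \<in> H. x [^] p \<in> H \<inter> U}) \<le> ?N"
    proof -
      have *: "x \<in> {x \<in> H. x [^] p \<in> H \<inter> U} \<Longrightarrow> x \<in> {x \<in> carrier G. x [^] p \<in> U}"
        "x \<in> {x \<in> H. x [^] p \<in> H \<inter> U} \<Longrightarrow> y \<in> {x \<in> H. x [^] p \<in> H \<inter> U} \<Longrightarrow> x \<otimes> inv y \<in> U \<Longrightarrow> x \<otimes> inv y \<in> H \<inter> U"
        for x y
        using Hc subgroup_diff[OF sH] by auto
      have c: "{x \<in> carrier G. x [^] p \<in> U} \<subseteq> carrier G" "{x \<in> H. x [^] p \<in> H \<inter> U} \<subseteq> carrier G" using Hc by auto
      note inj = cosets_inject[OF fQ *(1) U(1) c(1) sHU c(2) *(2)]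
      show "finite (cosets G (H \<inter> U) {x \<in> H. x [^] p \<in> H \<inter> U})" by (rule inj(1))
      show "card (cosets G (H \<inter> U) {x \<in> H. x [^] p \<in> H \<inter> U}) \<le> ?N" by (rule inj(2))
    qed
    have tors: "\<exists>k. x [^] (p ^ k) \<in> H \<inter> U" if "x \<in> H" for x
      using eventually_in[OF U(1,2)] subgroup_nat_pow[OF sH that] that Hc by blast
    note q = card_cosets_quotient_le[OF sH sHU Int_lower1 p_pos tors fin]
    have sPH: "subgroup (pow_image G H p <#> (H \<inter> U)) G" using sH sHU by (intro mult_subgroups subgroup_pow_image)
    obtain F2 where F2: "finite F2" "F2 \<subseteq> H"
      "card F2 \<le> card (cosets G (pow_image G H p <#> (H \<inter> U)) H)" "H \<subseteq> F2 <#> (pow_image G H p <#> (H \<inter> U))"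
      using cosets_cover[OF q(1) Hc sPH] .
    have "card F2 \<le> ?N" using F2(3) q(2) le by linarith
    let ?F = "F1 \<union> F2"
    have Fs: "finite ?F" "?F \<subseteq> H" "?F \<subseteq> carrier G" using F1 F2 Hc by auto
    have sF: "subgroup (tgen ?F) G" using Fs by (intro subgroup_tgen)
    have sub: "F2 \<subseteq> tgen ?F" "H \<inter> U \<subseteq> tgen ?F"
      using subset_tgen[OF Fs(3)] tgen_mono[of F1 ?F] Fs F1 by auto
    have "H \<subseteq> tgen ?F <#> pow_image G H p"
    proof
      fix x assume "x \<in> H"
      then obtain a b where 1: "a \<in> F2" "b \<in> pow_image G H p <#> (H \<inter> U)" "x = a \<otimes> b" using F2 by (meson set_multE subsetD)
      then obtain c d where 2: "c \<in> pow_image G H p" "d \<in> H \<inter> U" "b = c \<otimes> d" by (meson set_multE)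
      have cc: "a \<in> carrier G" "c \<in> carrier G" "d \<in> carrier G"
        using 1 2 F2 Hc pow_image_subset[OF sH, of p] by auto
      then have "x = (a \<otimes> d) \<otimes> c" using 1 2 by (simp add: m_ac)
      moreover have "a \<otimes> d \<in> tgen ?F" using 1 2 sub sF by (auto intro: subgroup.m_closed)
      ultimately show "x \<in> tgen ?F <#> pow_image G H p" using 2 set_multI by metis
    qed
    then have "H \<subseteq> tgen ?F" using nakayama[OF closed_subgroup_tgen[OF Fs(3)] sH cH] by blast
    moreover have "tgen ?F \<subseteq> H" using H Fs by (intro tgen_subset)
    moreover have "card ?F \<le> card F + ?N" using card_Un_le[of F1 F2] F1(2) \<open>card F2 \<le> ?N\<close> by linarith
    ultimately show "\<exists>F'. finite F' \<and> card F' \<le> card F + ?N \<and> F' \<subseteq> carrier G \<and> H = tgen F'"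
      using Fs by blast
  qed
  then show ?thesis unfolding finite_p_rank_iff by blast
qed

section \<open>Closed sums from either finiteness condition\<close>

lemma tgen_subset_set_mult:
  assumes X: "closed_subgroup G T X" and Y: "closed_subgroup G T Y" and F: "finite F" "F \<subseteq> X <#> Y"
  shows "tgen F \<subseteq> X <#> Y"
proof -
  have s: "subgroup X G" "subgroup Y G" using X Y by (auto simp: closed_subgroup_def)
  have "X <#> Y = (\<lambda>(x, y). x \<otimes> y) ` (X \<times> Y)" by (auto simp: set_mult_def)
  then obtain D where D: "finite D" "D \<subseteq> X \<times> Y" "F = (\<lambda>(x, y). x \<otimes> y) ` D"
    using finite_subset_image[OF F(1)] F(2) by metis
  let ?A = "fst ` D" and ?B = "snd ` D"
  have AB: "?A \<subseteq> X" "?B \<subseteq> Y" "finite ?A" "finite ?B" using D by auto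
  then have AB': "?A \<subseteq> carrier G" "?B \<subseteq> carrier G" using s subgroup.subset by blast+
  \<comment> \<open>As \<open>X <#> Y\<close> may fail to be closed, the closure of the group
    generated by \<open>F\<close> is caught in the sum of two finitely generated closed subgroups,
    which is compact.\<close>
  have "tgen F \<subseteq> tgen ?A <#> tgen ?B"
  proof (rule tgen_subset)
    show "closed_subgroup G T (tgen ?A <#> tgen ?B)"
      using AB AB' by (intro closed_subgroup_set_mult closed_subgroup_tgen subgroup_tgen compactin_tgen)
    show "F \<subseteq> tgen ?A <#> tgen ?B"
      using D(3) subset_tgen[OF AB'(1)] subset_tgen[OF AB'(2)] by (force intro: set_multI)
  qed
  also have "\<dots> \<subseteq> X <#> Y" using X Y AB by (intro mono_set_mult tgen_subset)
  finally show ?thesis .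
qed

text \<open>The closure \<open>N\<close> of the trace \<open>M\<close> on \<open>U\<close> is
  finitely generated. It remains to find generators that already lie in \<open>X + Y\<close>, and
  there the density of \<open>M\<close> in \<open>N\<close> enters.\<close>

lemma closedin_set_mult_if_noetherian:
  assumes U: "subgroup U G" "openin T U" "compactin T U"
    and fU: "finite (cosets G (pow_image G U p) U)"
    and X: "closed_subgroup G T X" and Y: "closed_subgroup G T Y"
  shows "closedin T (X <#> Y)"
proof -
  let ?S = "X <#> Y"
  have S: "subgroup ?S G" using X Y by (auto simp: closed_subgroup_def mult_subgroups)
  obtain F where F: "finite F" "F \<subseteq> U" "U = tgen F"
    using tgen_if_finite_Frattini_quotient[OF U(1,3) fU] .
  have Uc: "U \<subseteq> carrier G" using U subgroup.subset by blast
  have Fc: "F \<subseteq> carrier G" using F Uc by blast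
  let ?M = "?S \<inter> U"
  let ?N = "T closure_of ?M"
  have M: "subgroup ?M G" using S U by (intro subgroup_Int)
  have N: "closed_subgroup G T ?N" using M by (rule closed_subgroup_closure_of)
  have NU: "?N \<subseteq> U" using U compactin_closedin by (intro closure_of_minimal) auto
  have MN: "?M \<subseteq> ?N" using Uc topspace_eq by (intro closure_of_subset) auto
  obtain F' where F': "finite F'" "F' \<subseteq> ?N" "?N = tgen F'"
    using closed_subgroup_of_tgen[OF F(1) Fc N] F(3) NU by blast
  have cN: "compactin T ?N" and sN: "subgroup ?N G" and Nc: "?N \<subseteq> carrier G"
    using N U NU compactin_closed_subset by (auto simp: closed_subgroup_def subgroup.subset)
  let ?P = "pow_image G ?N p"
  have P: "closed_subgroup G T ?P" using sN cN by (rule closed_subgroup_pow_image)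
  then have sP: "subgroup ?P G" by (simp add: closed_subgroup_def)
  have F'c: "F' \<subseteq> carrier G" using F' Nc by blast
  have "\<And>f. f \<in> F' \<Longrightarrow> f [^] p \<in> ?P" using F'(2) pow_imageI[of _ ?N] by blast
  from tgen_cover[OF F'(1) F'c P p_pos this]
  obtain C where C: "finite C" "C \<subseteq> generate G F'" "?N \<subseteq> C <#> ?P" unfolding F'(3)[symmetric] by metis
  then have "finite (cosets G ?P ?N)"
    using cosets_finite_card(1)[OF C(1) _ sP C(3)] generate_incl[OF F'c] by blast
  then have "finite (cosets G ?P ?M)" using cosets_mono[OF MN] finite_subset by blast
  \<comment> \<open>Classes modulo \<open>pN\<close> are represented inside \<open>M\<close>: the
    set \<open>D + pN\<close> is closed and contains \<open>M\<close>, hence contains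
    \<open>N\<close>. Nakayama then generates \<open>N\<close> by elements of
    \<open>X + Y\<close>.\<close>
  then obtain D where D: "finite D" "D \<subseteq> ?M" "?M \<subseteq> D <#> ?P"
    using cosets_cover[OF _ subgroup.subset[OF M] sP] by metis
  have Dc: "D \<subseteq> carrier G" using D Uc by blast
  have "?N \<subseteq> D <#> ?P"
    using D Dc P by (intro closure_of_minimal closedin_finite_set_mult) (auto simp: closed_subgroup_def)
  also have "\<dots> \<subseteq> tgen D <#> ?P" using Dc by (intro mono_set_mult subset_tgen order_refl)
  finally have "?N \<subseteq> tgen D" using nakayama[OF closed_subgroup_tgen[OF Dc] sN cN] by blast
  also have "\<dots> \<subseteq> ?S" using D by (intro tgen_subset_set_mult X Y) auto
  finally have "?N = ?M" using NU MN by blast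
  then have "closedin T ?M" by (metis closedin_closure_of)
  then show ?thesis using closedin_subgroup_if_locally[OF S U(1,2)] by blast
qed

text \<open>The \<open>X\<close>-components of elements of \<open>M\<close> lie in \<open>K\<close>,
  and \<open>K / (X \<inter> U)\<close> is torsion with finite socle, hence finite modulo
  \<open>p\<close>. This makes \<open>M / W\<close> finite modulo \<open>p\<close>. A common bound
  on exponents then upgrades this to finiteness of \<open>M / W\<close>, so \<open>M\<close> is a
  finite union of translates of the compact group \<open>W\<close>.\<close>

lemma closedin_set_mult_if_artinian:
  assumes U: "subgroup U G" "openin T U" "compactin T U"
    and fQ: "finite (cosets G U {x \<in> carrier G. x [^] p \<in> U})"
    and X: "closed_subgroup G T X" and Y: "closed_subgroup G T Y"
  shows "closedin T (X <#> Y)"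
proof -
  let ?S = "X <#> Y"
  have sX: "subgroup X G" and sY: "subgroup Y G" using X Y by (auto simp: closed_subgroup_def)
  have S: "subgroup ?S G" using sX sY by (rule mult_subgroups)
  have Uc: "U \<subseteq> carrier G" and Xc: "X \<subseteq> carrier G" and Yc: "Y \<subseteq> carrier G" using U sX sY subgroup.subset by blast+
  let ?M = "?S \<inter> U" and ?XU = "X \<inter> U" and ?YU = "Y \<inter> U" and ?K = "X \<inter> (Y <#> U)"
  let ?W = "?XU <#> ?YU"
  have M: "subgroup ?M G" using S U by (intro subgroup_Int)
  have sXU: "subgroup ?XU G" and sYU: "subgroup ?YU G" using sX sY U by (auto intro: subgroup_Int)
  have W: "subgroup ?W G" using sXU sYU by (rule mult_subgroups)
  have "closedin T ?XU" "closedin T ?YU"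
    using X Y compactin_closedin[OF U(3)] by (auto simp: closed_subgroup_def)
  then have cW: "compactin T ?W"
    by (intro compactin_set_mult compactin_closed_subset[OF U(3)]) auto
  have K: "subgroup ?K G" using sX sY U by (intro subgroup_Int mult_subgroups)
  have Mc: "?M \<subseteq> carrier G" and Kc: "?K \<subseteq> carrier G" using Uc Xc by auto
  have XUK: "?XU \<subseteq> ?K" using subset_set_mult_right[OF sY Uc] by blast
  have WM: "?W \<subseteq> ?M"
    using mono_set_mult[OF Int_lower1 Int_lower1, of G X U Y U] set_mult_subset[OF U(1) Int_lower2 Int_lower2, of X Y] by blast
  have fin: "finite (cosets G ?XU {x \<in> ?K. x [^] p \<in> ?XU})"
  proof (rule cosets_inject(1)[OF fQ, where f = "\<lambda>x. x"])
    show "x \<otimes> inv y \<in> ?XU" if "x \<in> {x \<in> ?K. x [^] p \<in> ?XU}" "y \<in> {x \<in> ?K. x [^] p \<in> ?XU}" "x \<otimes> inv y \<in> U" for x y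
      using that subgroup_diff[OF sX] by auto
  qed (use U sXU Xc in auto)
  have tors: "\<exists>k. x [^] (p ^ k) \<in> ?XU" if "x \<in> ?K" for x
    using eventually_in[OF U(1,2), of x] that Xc subgroup_nat_pow[OF sX, of x] by blast
  have finK: "finite (cosets G (pow_image G ?K p <#> ?XU) ?K)"
    using card_cosets_quotient_le(1)[OF K sXU XUK p_pos tors fin] .
  have spKXU: "subgroup (pow_image G ?K p <#> ?XU) G" by (rule mult_subgroups[OF subgroup_pow_image[OF K] sXU])
  have spMW: "subgroup (pow_image G ?M p <#> ?W) G" by (rule mult_subgroups[OF subgroup_pow_image[OF M] W])
  \<comment> \<open>The \<open>X\<close>-component of \<open>m\<close> is determined only up to
    \<open>X \<inter> Y\<close>, so it is chosen; \<open>cosets_inject\<close> does not ask for a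
    homomorphism.\<close>
  define f where "f m = (SOME x. x \<in> X \<and> (\<exists>y\<in>Y. m = x \<otimes> y))" for m
  have f: "f m \<in> X \<and> (\<exists>y\<in>Y. m = f m \<otimes> y)" if "m \<in> ?M" for m
  proof -
    have "m \<in> X <#> Y" using that by blast
    then have "\<exists>x. x \<in> X \<and> (\<exists>y\<in>Y. m = x \<otimes> y)" by (meson set_multE)
    then show ?thesis unfolding f_def by (rule someI_ex)
  qed
  have fK: "f m \<in> ?K" if m: "m \<in> ?M" for m
  proof -
    obtain y where y: "y \<in> Y" "m = f m \<otimes> y" using f[OF m] by blast
    have c: "y \<in> carrier G" "f m \<in> carrier G" "m \<in> carrier G" using y f[OF m] Xc Yc m Uc by auto
    then have "m \<otimes> inv y = f m" by (subst y(2)) simp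
    then have "f m = inv y \<otimes> m" using c by (simp add: m_comm)
    then show ?thesis using f[OF m] m y(1) sY set_multI[of "inv y" Y m U G] by (auto simp: subgroup.m_inv_closed)
  qed
  have "finite (cosets G (pow_image G ?M p <#> ?W) ?M)"
  proof (rule cosets_inject(1)[OF finK fK spKXU Kc spMW Mc])
    fix m m' assume m: "m \<in> ?M" "m' \<in> ?M" and fm: "f m \<otimes> inv f m' \<in> pow_image G ?K p <#> ?XU"
    define x where "x = f m"
    define x' where "x' = f m'"
    obtain k0 u where ku: "k0 \<in> pow_image G ?K p" "u \<in> ?XU" "x \<otimes> inv x' = k0 \<otimes> u"
      using fm unfolding x_def x'_def by (meson set_multE)
    then obtain k where k: "k \<in> ?K" "k0 = k [^] p" by (auto simp: pow_image_def)
    then obtain y0 u0 where yu: "y0 \<in> Y" "u0 \<in> U" "k = y0 \<otimes> u0" by (auto elim: set_multE)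
    obtain y where y: "y \<in> Y" "m = x \<otimes> y" using f[OF m(1)] unfolding x_def by blast
    obtain y' where y': "y' \<in> Y" "m' = x' \<otimes> y'" using f[OF m(2)] unfolding x'_def by blast
    have "x \<in> X" "x' \<in> X" using f m unfolding x_def x'_def by auto
    then have c: "y \<in> carrier G" "y' \<in> carrier G" "y0 \<in> carrier G" "u0 \<in> carrier G" "u \<in> carrier G" "k \<in> carrier G"
      "x \<in> carrier G" "x' \<in> carrier G" "m \<in> carrier G" "m' \<in> carrier G"
      using y(1) y'(1) yu(1,2) ku(2) k(1) Xc Yc Uc m by auto
    \<comment> \<open>By the definition of \<open>K\<close>, \<open>k\<close> splits as
      \<open>y0 + u0\<close>. Then \<open>u0 = k - y0\<close> lies in \<open>M\<close>, and
      \<open>p y0\<close> is absorbed into the \<open>Y\<close>-part \<open>v\<close>; the formula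
      for \<open>m - m'\<close> finally forces \<open>v\<close> into \<open>U\<close>.\<close>
    have "k = u0 \<otimes> y0" using yu(3) c by (simp add: m_comm)
    then have u0: "u0 = k \<otimes> inv y0" using c by simp
    have "u0 \<in> ?S" unfolding u0 using k yu sY by (intro set_multI) (auto simp: subgroup.m_inv_closed)
    then have u0M: "u0 \<in> ?M" using yu by blast
    define v where "v = y \<otimes> inv y' \<otimes> y0 [^] p"
    have vY: "v \<in> Y" unfolding v_def using y y' yu subgroup_diff[OF sY] subgroup_nat_pow[OF sY] by (auto intro: subgroup.m_closed[OF sY])
    have vc: "v \<in> carrier G" using vY Yc by blast
    have e: "m \<otimes> inv m' = u0 [^] p \<otimes> (u \<otimes> v)"
    proof -
      have "m \<otimes> inv m' = (x \<otimes> inv x') \<otimes> (y \<otimes> inv y')"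
        using c(1,2,7,8) unfolding y(2) y'(2) by (simp add: m_ac inv_mult)
      also have "\<dots> = (k [^] p \<otimes> u) \<otimes> (y \<otimes> inv y')" using ku k by simp
      also have "k [^] p = u0 [^] p \<otimes> y0 [^] p" using yu c by (simp add: nat_pow_distrib m_comm)
      finally show ?thesis unfolding v_def using c by (simp add: m_ac)
    qed
    have "v = m \<otimes> inv m' \<otimes> inv (u0 [^] p \<otimes> u)" unfolding e using c vc by (simp add: m_ac inv_mult)
    moreover have "m \<otimes> inv m' \<otimes> inv (u0 [^] p \<otimes> u) \<in> U"
      using m ku yu subgroup_nat_pow[OF U(1)] by (intro subgroup_diff[OF U(1)] subgroup.m_closed[OF U(1)]) auto
    ultimately have "v \<in> ?YU" using vY by simp
    then show "m \<otimes> inv m' \<in> pow_image G ?M p <#> ?W"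
      unfolding e using ku u0M by (intro set_multI pow_imageI) auto
  qed
  then obtain C where C: "finite C" "C \<subseteq> ?M" "?M \<subseteq> C <#> (pow_image G ?M p <#> ?W)"
    using cosets_cover[OF _ Mc spMW] by metis
  have Cc: "C \<subseteq> carrier G" using C Mc by blast
  have torsM: "\<exists>k. m [^] (p ^ k) \<in> ?W" if m: "m \<in> ?M" for m
  proof -
    obtain y where y: "y \<in> Y" "m = f m \<otimes> y" using f[OF m] by blast
    have c: "y \<in> carrier G" "f m \<in> carrier G" "m \<in> carrier G" using y f[OF m] Xc Yc m Uc by auto
    obtain k where k: "f m [^] (p ^ k) \<in> ?XU" using tors fK[OF m] by blast
    have e: "m [^] (p ^ k) = f m [^] (p ^ k) \<otimes> y [^] (p ^ k)" using y(2) c nat_pow_distrib by metis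
    have "m \<in> U" using m by blast
    from subgroup_nat_pow[OF U(1) this, of "p ^ k"]
    have "f m [^] (p ^ k) \<otimes> y [^] (p ^ k) \<in> U" unfolding e .
    then have "y [^] (p ^ k) \<in> U"
      using subgroup_mult_left[OF U(1), of "f m [^] (p ^ k)" "y [^] (p ^ k)"] k c(1) by blast
    then have "y [^] (p ^ k) \<in> ?YU" using subgroup_nat_pow[OF sY y(1)] by blast
    then show ?thesis using e k set_multI by metis
  qed
  obtain k where k: "\<And>c. c \<in> C \<Longrightarrow> c [^] (p ^ k) \<in> ?W"
    using uniform_p_power[OF C(1) W Cc, of p] torsM C(2) by blast
  let ?B = "generate G C <#> ?W"
  have sgC: "subgroup (generate G C) G" using Cc by (rule generate_is_subgroup)
  have B: "subgroup ?B G" using sgC W by (rule mult_subgroups)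
  have Bc: "?B \<subseteq> carrier G" using B by (rule subgroup.subset)
  have Wc: "?W \<subseteq> carrier G" using W by (rule subgroup.subset)
  have BW: "pow_image G ?B (p ^ k) \<subseteq> ?W" using pow_image_generate_set_mult[OF Cc W k] .
  have MB: "?M \<subseteq> ?B <#> pow_image G ?M p"
  proof -
    have pMc: "pow_image G ?M p \<subseteq> carrier G" using pow_image_subset[OF M] Mc by blast
    have "?M \<subseteq> C <#> (pow_image G ?M p <#> ?W)" by fact
    also have "\<dots> = (C <#> ?W) <#> pow_image G ?M p"
      using set_mult_comm[OF pMc Wc] set_mult_assoc[OF Cc Wc pMc] by simp
    also have "\<dots> \<subseteq> ?B <#> pow_image G ?M p"
      by (intro mono_set_mult order_refl) (auto intro: generate.incl)
    finally show ?thesis .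
  qed
  have MBj: "?M \<subseteq> ?B <#> pow_image G ?M (p ^ j)" for j
    by (rule subset_set_mult_pow_image_iterate[OF B M MB])
  \<comment> \<open>From \<open>M \<subseteq> B + p^j M\<close> and
    \<open>p^k B \<subseteq> W\<close> follows \<open>p^k M \<subseteq> W + p^j M\<close> for every
    \<open>j\<close>. Letting \<open>j\<close> grow leaves \<open>W\<close>, because
    \<open>W\<close> is closed and \<open>M\<close> lies in the compact group
    \<open>U\<close>.\<close>
  have pkM: "pow_image G ?M (p ^ k) \<subseteq> ?W"
  proof
    fix z assume z: "z \<in> pow_image G ?M (p ^ k)"
    show "z \<in> ?W"
    proof (rule in_closed_if_in_all_powers[OF compactin_closedin[OF cW] U(3)])
      fix j
      have pMc: "pow_image G ?M (p ^ j) \<subseteq> carrier G" using pow_image_subset[OF M] Mc by blast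
      have "z \<in> pow_image G (?B <#> pow_image G ?M (p ^ j)) (p ^ k)"
        using z pow_image_mono[OF MBj] by blast
      also have "\<dots> = pow_image G ?B (p ^ k) <#> pow_image G (pow_image G ?M (p ^ j)) (p ^ k)"
        by (rule pow_image_set_mult[OF Bc pMc])
      also have "\<dots> \<subseteq> ?W <#> pow_image G ?M (p ^ j)"
        using M by (intro mono_set_mult BW pow_image_subset subgroup_pow_image)
      also have "\<dots> \<subseteq> ?W <#> pow_image G U (p ^ j)"
        by (intro mono_set_mult pow_image_mono) auto
      finally show "z \<in> ?W <#> pow_image G U (p ^ j)" .
    qed
  qed
  have "p ^ k > 0" using p_pos by simp
  then obtain D where D: "finite D" "D \<subseteq> generate G C" "?B \<subseteq> D <#> ?W"
    using finite_generate_set_mult[OF C(1) Cc W _ k] by blast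
  have Dc: "D \<subseteq> carrier G" using D generate_incl[OF Cc] by blast
  \<comment> \<open>Taking \<open>j = k\<close> makes the error term fall into \<open>W\<close>, so
    \<open>M\<close> is covered by \<open>B\<close>, which is finite modulo
    \<open>W\<close>.\<close>
  have "?M \<subseteq> ?B <#> ?W" using subset_trans[OF MBj[of k] mono_set_mult[OF order_refl pkM]] .
  also have "\<dots> \<subseteq> generate G C <#> ?W"
    unfolding set_mult_assoc[OF generate_incl[OF Cc] Wc Wc]
    using W by (intro mono_set_mult set_mult_subset) auto
  also note D(3)
  finally have "?M \<subseteq> D <#> ?W" .
  moreover have "D <#> ?W \<subseteq> ?M"
    by (rule set_mult_subset[OF M subset_trans[OF D(2) generate_subgroup_incl[OF C(2) M]] WM])
  ultimately have "?M = D <#> ?W" by blast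
  moreover have "closedin T (D <#> ?W)" using D Dc cW by (intro closedin_finite_set_mult compactin_closedin)
  ultimately have "closedin T ?M" by simp
  then show ?thesis using closedin_subgroup_if_locally[OF S U(1,2)] by blast
qed

section \<open>Modularity and closed sums\<close>

lemma topologically_modular_if_quasihamiltonian:
  assumes "strongly_topologically_quasihamiltonian G T"
  shows "topologically_modular G T"
  unfolding topologically_modular_def
proof (intro allI impI)
  fix A B C assume A: "closed_subgroup G T A" and B: "closed_subgroup G T B" and C: "closed_subgroup G T C" and AC: "A \<subseteq> C"
  have cl: "closed_join G T X Y = X <#> Y" if "closed_subgroup G T X" "closed_subgroup G T Y" for X Y
    using assms that unfolding closed_join_def strongly_topologically_quasihamiltonian_def
    by (simp add: closure_of_closedin)
  have s: "subgroup A G" "subgroup B G" "subgroup C G" using A B C by (auto simp: closed_subgroup_def)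
  \<comment> \<open>With all joins equal to sums, only Dedekind's modular law for abelian groups
    remains.\<close>
  have "A <#> (B \<inter> C) = (A <#> B) \<inter> C"
  proof (intro subset_antisym subsetI)
    fix x assume "x \<in> A <#> (B \<inter> C)"
    then show "x \<in> (A <#> B) \<inter> C" using AC s by (auto elim!: set_multE intro: set_multI subgroup.m_closed)
  next
    fix x assume x: "x \<in> (A <#> B) \<inter> C"
    then obtain a b where ab: "a \<in> A" "b \<in> B" "x = a \<otimes> b" by (auto elim: set_multE)
    then have "b \<in> C" using subgroup_mult_left[OF s(3), of a b] x AC s(2) by (auto simp: subgroup.mem_carrier)
    then show "x \<in> A <#> (B \<inter> C)" using ab by (auto intro: set_multI)
  qed
  then show "closed_join G T A (B \<inter> C) = closed_join G T A B \<inter> C"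
    using A B C by (simp add: cl closed_subgroup_Int)
qed

lemma quasihamiltonian_if_topologically_modular:
  assumes mod: "topologically_modular G T"
  shows "strongly_topologically_quasihamiltonian G T"
  unfolding strongly_topologically_quasihamiltonian_def
proof (intro allI impI)
  fix X Y assume X: "closed_subgroup G T X" and Y: "closed_subgroup G T Y"
  have s: "subgroup X G" "subgroup Y G" using X Y by (auto simp: closed_subgroup_def)
  have S: "subgroup (X <#> Y) G" using s by (rule mult_subgroups)
  have Xc: "X \<subseteq> carrier G" and Yc: "Y \<subseteq> carrier G" and Sc: "X <#> Y \<subseteq> carrier G" using s S subgroup.subset by blast+
  have XS: "X \<subseteq> X <#> Y" using subset_set_mult_left[OF s(2) Xc] .
  have "T closure_of (X <#> Y) \<subseteq> X <#> Y"
  proof (rule ccontr)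
    assume "\<not> ?thesis"
    then obtain z where z: "z \<in> T closure_of (X <#> Y)" "z \<notin> X <#> Y" by blast
    then have zc: "z \<in> carrier G" using subgroup.mem_carrier[OF subgroup_closure_of[OF S]] by blast
    let ?Z = "tgen {z}"
    have Z: "closed_subgroup G T ?Z" "subgroup ?Z G" "compactin T ?Z" "z \<in> ?Z"
      by (rule tgen_singleton[OF zc])+
    have Zc: "?Z \<subseteq> carrier G" using Z subgroup.subset by blast
    let ?P = "pow_image G ?Z p"
    have P: "subgroup ?P G" "?P \<subseteq> ?Z" using Z subgroup_pow_image pow_image_subset by auto
    let ?C = "X <#> ?Z"
    have C: "closed_subgroup G T ?C" using X Z by (intro closed_subgroup_set_mult)
    have XC: "X \<subseteq> ?C" and ZC: "?Z \<subseteq> ?C" using subset_set_mult_left[OF Z(2) Xc] subset_set_mult_right[OF s(1) Zc] .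
    have XP: "closed_subgroup G T (X <#> ?P)" using X Z P by (intro closed_subgroup_set_mult compactin_pow_image)
    have "Y \<inter> ?C \<subseteq> X <#> ?P"
    proof
      fix y assume y: "y \<in> Y \<inter> ?C"
      then obtain x w where xw: "x \<in> X" "w \<in> ?Z" "y = x \<otimes> w" by (auto elim: set_multE)
      have c: "x \<in> carrier G" "w \<in> carrier G" using xw Xc Zc by auto
      \<comment> \<open>Otherwise \<open>w\<close> generates \<open>Z\<close>. But
        \<open>w = y - x\<close> lies in \<open>X + Y\<close>, which contains the procyclic group of
        each of its elements, so \<open>z\<close> would lie there too.\<close>
      have "w \<in> ?P"
      proof (rule ccontr)
        assume "w \<notin> ?P"
        then have "tgen {w} = ?Z" using tgen_eq_if_not_p_multiple[OF zc xw(2)] by blast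
        moreover have "w = inv x \<otimes> y" using xw c by simp
        then have "w \<in> X <#> Y" using xw(1) y s by (auto intro!: set_multI simp: subgroup.m_inv_closed)
        then have "tgen {w} \<subseteq> X <#> Y" using X Y by (intro tgen_subset_set_mult) auto
        ultimately show False using Z z by blast
      qed
      then show "y \<in> X <#> ?P" using xw by (auto intro: set_multI)
    qed
    then have "X <#> (Y \<inter> ?C) \<subseteq> X <#> ?P"
      using XP subset_set_mult_left[OF P(1) Xc] by (intro set_mult_subset) (auto simp: closed_subgroup_def)
    then have "closed_join G T X (Y \<inter> ?C) \<subseteq> X <#> ?P"
      unfolding closed_join_def using XP by (intro closure_of_minimal) (auto simp: closed_subgroup_def)
    moreover have "z \<in> closed_join G T X Y \<inter> ?C" using z Z ZC by (auto simp: closed_join_def)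
    moreover have "closed_join G T X (Y \<inter> ?C) = closed_join G T X Y \<inter> ?C"
      using mod X Y C XC unfolding topologically_modular_def by blast
    ultimately have "z \<in> X <#> ?P" by blast
    then obtain x w where xw: "x \<in> X" "w \<in> ?P" "z = x \<otimes> w" by (rule set_multE)
    have c: "x \<in> carrier G" "w \<in> carrier G" using xw Xc P Zc by auto
    have x: "x = z \<otimes> inv w" using xw c by simp
    have xZ: "x \<in> ?Z" unfolding x using Z P xw by (intro subgroup_diff) auto
    \<comment> \<open>If \<open>x\<close> were in \<open>pZ\<close>, then so would be
      \<open>z\<close>, whence \<open>Z = pZ\<close> would vanish by Nakayama, contrary to
      \<open>z \<notin> X + Y\<close>. So \<open>x\<close> generates \<open>Z\<close>, which puts
      \<open>z\<close> into \<open>X\<close>.\<close>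
    have "x \<notin> ?P"
    proof
      assume "x \<in> ?P"
      then have "z \<in> ?P" using xw P by (auto intro: subgroup.m_closed)
      then obtain t where t: "t \<in> ?Z" "z = t [^] p" by (auto simp: pow_image_def)
      have "?Z \<subseteq> {\<one>} <#> ?P"
      proof -
        have "closed_subgroup G T ?P" using Z by (intro closed_subgroup_pow_image)
        then have "?Z \<subseteq> ?P" using \<open>z \<in> ?P\<close> by (intro tgen_subset) auto
        then show ?thesis using subset_set_mult_right[OF triv_subgroup subgroup.subset[OF P(1)]] by blast
      qed
      then have "?Z \<subseteq> {\<one>}"
        by (rule nakayama[OF closed_subgroup_trivial Z(2,3)])
      then have "z = \<one>" using Z by blast
      then show False using z S by (auto simp: subgroup.one_closed)
    qed
    then have "tgen {x} = ?Z" using tgen_eq_if_not_p_multiple[OF zc xZ] by blast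
    moreover have "tgen {x} \<subseteq> X" using X xw by (intro tgen_subset) auto
    ultimately show False using z Z XS by blast
  qed
  then have "T closure_of (X <#> Y) = X <#> Y" using Sc topspace_eq closure_of_subset by (metis subset_antisym)
  then show "closedin T (X <#> Y)" by (metis closedin_closure_of)
qed

end

section \<open>Sums that are not closed\<close>

context comm_group
begin

lemma generate_finite_subset:
  assumes "x \<in> generate G H"
  shows "\<exists>F. finite F \<and> F \<subseteq> H \<and> x \<in> generate G F"
  using assms
proof (induction rule: generate.induct)
  case one then show ?case by (intro exI[of _ "{}"]) (simp add: generate.one)
next
  case (incl h) then show ?case by (intro exI[of _ "{h}"]) (simp add: generate.incl)
next
  case (inv h) then show ?case by (intro exI[of _ "{h}"]) (simp add: generate.inv)
next
  case (eng h1 h2)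
  then obtain F1 F2 where "finite F1" "F1 \<subseteq> H" "h1 \<in> generate G F1" "finite F2" "F2 \<subseteq> H" "h2 \<in> generate G F2"
    by blast
  then show ?case
    using mono_generate[of F1 "F1 \<union> F2"] mono_generate[of F2 "F1 \<union> F2"]
    by (intro exI[of _ "F1 \<union> F2"]) (auto intro: generate.eng)
qed

lemma generate_range_sequence:
  assumes "x \<in> generate G (range (h :: nat \<Rightarrow> 'a))"
  obtains n where "x \<in> generate G (h ` {..<n})"
proof -
  obtain F where F: "finite F" "F \<subseteq> range h" "x \<in> generate G F" using generate_finite_subset[OF assms] by blast
  then obtain I where I: "finite I" "F = h ` I" by (meson finite_subset_image)
  then obtain n where "I \<subseteq> {..<n}" by (meson finite_nat_iff_bounded)
  then have "generate G F \<subseteq> generate G (h ` {..<n})" unfolding I(2) by (intro mono_generate image_mono)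
  then show thesis using that F(3) by blast
qed

lemma int_pow_in_subgroup_prime:
  assumes "prime (p::nat)" "subgroup A G" "a \<in> carrier G" "a [^] p \<in> A" "a [^] (i::int) \<in> A" "a \<notin> A"
  shows "int p dvd i"
proof (rule ccontr)
  assume "\<not> int p dvd i"
  then have "coprime i (int p)"
    using prime_imp_coprime[of "int p" i] assms(1) by (simp add: coprime_commute)
  then obtain s t where "i * s + int p * t = 1"
    using bezout_int[of i "int p"] by (metis coprime_imp_gcd_eq_1 mult.commute)
  then have "a = (a [^] i) [^] s \<otimes> (a [^] int p) [^] t"
    using assms(3) by (metis int_pow_mult int_pow_pow int_pow_1)
  moreover have "(a [^] i) [^] s \<in> A" "(a [^] int p) [^] t \<in> A"
    using assms subgroup_int_pow_closed[OF assms(2)] by (auto simp: int_pow_int)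
  ultimately show False using assms(2,6) by (metis subgroup.m_closed)
qed

lemma int_pow_multiple_in_subgroup:
  assumes "subgroup A G" "a \<in> carrier G" "a [^] (p::nat) \<in> A" "int p dvd i"
  shows "a [^] i \<in> A"
proof -
  obtain t where "i = int p * t" using assms(4) by blast
  then have "a [^] i = (a [^] p) [^] t"
    using int_pow_pow[OF assms(2), of "int p" t] by (simp add: int_pow_int)
  then show ?thesis using assms subgroup_int_pow_closed by simp
qed

lemma generate_insert_sequence:
  assumes "range (h :: nat \<Rightarrow> 'a) \<subseteq> carrier G" "x \<in> generate G (h ` {..<Suc n})"
  obtains i :: int and y where "y \<in> generate G (h ` {..<n})" "x = h n [^] i \<otimes> y"
proof -
  have c: "h n \<in> carrier G" "h ` {..<n} \<subseteq> carrier G" using assms(1) by auto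
  have "x \<in> generate G {h n} <#> generate G (h ` {..<n})"
    using assms(2) generate_insert[OF c] by (simp add: lessThan_Suc)
  then obtain z y where "z \<in> generate G {h n}" "y \<in> generate G (h ` {..<n})" "x = z \<otimes> y" by (rule set_multE)
  then show thesis using that generate_pow[OF c(1)] by auto
qed

text \<open>The \<open>h n\<close> are independent modulo \<open>A 0\<close>: a combination in
  \<open>A 0\<close> loses its last coefficient modulo \<open>p\<close> first, since
  \<open>h n\<close> is not in \<open>A n\<close> while the earlier terms are. What remains are
  \<open>p\<close>-multiples, which lie in \<open>W\<close>.\<close>

lemma generate_Int_increasing:
  assumes p: "prime (p::nat)" and A: "\<And>n. subgroup (A n) G" "\<And>n. A n \<subseteq> A (Suc n)"
    and W: "subgroup W G" "W \<subseteq> A 0"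
    and h: "\<And>n. h n \<in> A (Suc n)" "\<And>n. h n \<notin> A n" "\<And>n. h n [^] p \<in> W"
  shows "generate G (range h) \<inter> A 0 \<subseteq> W"
proof -
  have hc: "range h \<subseteq> carrier G" using subgroup.mem_carrier[OF A(1) h(1)] by blast
  have mono: "A m \<subseteq> A n" if "m \<le> n" for m n by (rule lift_Suc_mono_le[of A, OF A(2) that])
  have WA: "W \<subseteq> A n" for n using W(2) mono[of 0 n] by blast
  have gA: "generate G (h ` {..<n}) \<subseteq> A n" for n
  proof (rule generate_subgroup_incl[OF _ A(1)])
    have "h i \<in> A n" if "i < n" for i using h(1)[of i] mono[of "Suc i" n] that by auto
    then show "h ` {..<n} \<subseteq> A n" by blast
  qed
  have "x \<in> generate G (h ` {..<n}) \<Longrightarrow> x \<in> A 0 \<Longrightarrow> x \<in> W" for n x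
  proof (induction n arbitrary: x)
    case 0 then show ?case using W by (simp add: generate_empty subgroup.one_closed)
  next
    case (Suc n)
    obtain i :: int and y where y: "y \<in> generate G (h ` {..<n})" "x = h n [^] i \<otimes> y"
      using generate_insert_sequence[OF hc Suc.prems(1)] .
    have c: "h n \<in> carrier G" using hc by auto
    have yA: "y \<in> A n" using y gA by blast
    have "x \<in> A n" using Suc.prems(2) mono[of 0 n] by blast
    then have "h n [^] i \<in> A n" using subgroup_mult_right[OF A(1) yA, of "h n [^] i"] c y(2) by simp
    then have "int p dvd i" using int_pow_in_subgroup_prime[OF p A(1) c _ _ h(2)] h(3) WA by blast
    then have hW: "h n [^] i \<in> W" using int_pow_multiple_in_subgroup[OF W(1) c h(3)] by blast
    then have "y \<in> A 0" using subgroup_mult_left[OF A(1), of "h n [^] i" 0 y] WA Suc.prems(2) y(2)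
        subgroup.mem_carrier[OF A(1) yA] by blast
    then have "y \<in> W" using Suc.IH y by blast
    then show ?case using hW W(1) y(2) by (simp add: subgroup.m_closed)
  qed
  then show ?thesis using generate_range_sequence by (metis IntE subsetI)
qed

text \<open>The dual elimination. Dropping the last term relaxes membership in
  \<open>V (Suc n)\<close> to membership in \<open>V n\<close>, which is what the induction
  hypothesis for the first \<open>n\<close> generators asks for. It puts the earlier terms into
  \<open>W\<close>, and only then is the last coefficient seen to be divisible by
  \<open>p\<close>.\<close>

lemma generate_Int_decreasing:
  assumes p: "prime (p::nat)" and V: "\<And>n. subgroup (V n) G" "\<And>n. V (Suc n) \<subseteq> V n"
    and W: "subgroup W G" "\<And>n. W \<subseteq> V n"
    and u: "\<And>n. u n \<in> V n" "\<And>n. u n \<notin> V (Suc n)" "\<And>n. u n [^] p \<in> W"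
  shows "generate G (u ` {..<n}) \<inter> V n \<subseteq> W"
proof -
  have uc: "range u \<subseteq> carrier G" using subgroup.mem_carrier[OF V(1) u(1)] by blast
  have "x \<in> generate G (u ` {..<n}) \<Longrightarrow> x \<in> V n \<Longrightarrow> x \<in> W" for x
  proof (induction n arbitrary: x)
    case 0 then show ?case using W by (simp add: generate_empty subgroup.one_closed)
  next
    case (Suc n)
    obtain i :: int and y where y: "y \<in> generate G (u ` {..<n})" "x = u n [^] i \<otimes> y"
      using generate_insert_sequence[OF uc Suc.prems(1)] .
    have c: "u n \<in> carrier G" using uc by auto
    have yc: "y \<in> carrier G" using y generate_incl[of "u ` {..<n}"] uc by blast
    have "u n [^] i \<in> V n" using u(1) by (rule subgroup_int_pow_closed[OF V(1)])
    then have "y \<in> V n" using subgroup_mult_left[OF V(1), of "u n [^] i" n y] yc Suc.prems(2) V(2) y(2) by blast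
    then have yW: "y \<in> W" using Suc.IH y by blast
    then have "u n [^] i \<in> V (Suc n)"
      using subgroup_mult_right[OF V(1), of y "Suc n" "u n [^] i"] W(2) Suc.prems(2) y(2) c by auto
    then have "int p dvd i" using int_pow_in_subgroup_prime[OF p V(1) c _ _ u(2)] u(3) W(2) by blast
    then have "u n [^] i \<in> W" using int_pow_multiple_in_subgroup[OF W(1) c u(3)] by blast
    then show ?case using yW W(1) y(2) by (simp add: subgroup.m_closed)
  qed
  then show ?thesis by blast
qed

end

context linear_p_group
begin

text \<open>This takes the place of convergent subsequences, as the topology need not be first
  countable; compactness is asked only of the traces on \<open>K\<close>.\<close>

lemma compact_nest:
  assumes K: "compactin T K" and C: "\<And>n::nat. closedin T (C n)" "\<And>n. C (Suc n) \<subseteq> C n" "\<And>n. K \<inter> C n \<noteq> {}"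
  obtains x where "x \<in> K" "\<And>n. x \<in> C n"
proof -
  have "(\<Inter>n. K \<inter> C n) \<noteq> {}"
  proof (rule compact_space_imp_nest)
    show "compact_space (subtopology T K)" using K by (rule compact_space_subtopology)
    show "closedin (subtopology T K) (K \<inter> C n)" for n using C(1) by (simp add: closedin_subtopology_Int_closed)
    show "decseq (\<lambda>n. K \<inter> C n)" using C(2) by (intro decseq_SucI) blast
  qed (rule C(3))
  then show thesis using that by blast
qed

text \<open>Dependent choice is applied to pairs \<open>(A, V)\<close>: \<open>A\<close> is generated by \<open>U\<close> and the \<open>g\<^sub>i\<close> chosen so far,
  and \<open>V\<close> is an open subgroup of \<open>U\<close> containing \<open>pA\<close>, shrinking to \<open>W\<close>.\<close>

lemma infinite_construction_step:
  assumes U: "subgroup U G" "openin T U" "compactin T U"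
    and iU: "infinite (cosets G (pow_image G U p) U)"
    and iQ: "infinite (cosets G U {x \<in> carrier G. x [^] p \<in> U})"
    and V: "subgroup V G" "openin T V" "V \<subseteq> U"
    and A: "subgroup A G" "U \<subseteq> A" "finite (cosets G U A)" "pow_image G A p \<subseteq> V"
  obtains g u V' where "g \<in> carrier G" "g \<notin> A" "u \<in> V" "u \<notin> V'"
    "subgroup V' G" "openin T V'" "V' \<subseteq> V"
    "subgroup (generate G {g} <#> A) G" "A \<subseteq> generate G {g} <#> A" "g \<in> generate G {g} <#> A"
    "finite (cosets G U (generate G {g} <#> A))" "pow_image G (generate G {g} <#> A) p \<subseteq> V'"
proof -
  have Uc: "U \<subseteq> carrier G" and Vc: "V \<subseteq> carrier G" and Ac: "A \<subseteq> carrier G"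
    using U V A subgroup.subset by blast+
  let ?R = "{x \<in> carrier G. x [^] p \<in> V}" and ?S = "{x \<in> carrier G. x [^] p \<in> U}"
  have R: "subgroup ?R G" using subgroup_self V by (intro subgroup_pow_preimage)
  have fVU: "finite (cosets G V U)" using finite_cosets_compact[OF U(3) V(1,2)] .
  \<comment> \<open>Multiplication by \<open>p\<close> embeds \<open>S / R\<close> into the finite
    group \<open>U / V\<close>, so \<open>R\<close> is still infinite modulo \<open>U\<close> and
    cannot lie in \<open>A\<close>. Thus \<open>g\<close> can be chosen with
    \<open>p g \<in> V\<close>.\<close>
  have "\<not> ?R \<subseteq> A"
  proof
    assume "?R \<subseteq> A"
    then have "finite (cosets G U ?R)" using A(3) cosets_mono finite_subset by metis
    moreover have "finite (cosets G ?R ?S)"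
    proof (rule cosets_inject(1)[OF fVU, where f = "\<lambda>x. x [^] p"])
      show "x \<otimes> inv y \<in> ?R" if "x \<in> ?S" "y \<in> ?S" "x [^] p \<otimes> inv (y [^] p) \<in> V" for x y
        using that by (simp add: nat_pow_distrib nat_pow_inv)
    qed (use V Uc R in auto)
    ultimately have "finite (cosets G U ?S)" using cosets_trans[of ?R ?S U] R U(1) by blast
    then show False using iQ by blast
  qed
  then obtain g where g: "g \<in> carrier G" "g [^] p \<in> V" "g \<notin> A" by blast
  let ?B = "generate G {g} <#> A"
  have sg: "subgroup (generate G {g}) G" using g by (intro generate_is_subgroup) auto
  have sB: "subgroup ?B G" using sg A by (intro mult_subgroups)
  have AB: "A \<subseteq> ?B" using subset_set_mult_right[OF sg Ac] .
  have gB: "g \<in> ?B" using subset_set_mult_left[OF A(1) subgroup.subset[OF sg]] generate.incl[of g "{g}" G] by blast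
  have "\<And>f. f \<in> {g} \<Longrightarrow> f [^] p \<in> A" using g V A by blast
  then obtain C0 where C0: "finite C0" "C0 \<subseteq> generate G {g}" "generate G {g} \<subseteq> C0 <#> A"
    using generate_combinations[of "{g}" A p] g A p_pos by auto
  have C0c: "C0 \<subseteq> carrier G" using C0 subgroup.subset[OF sg] by blast
  have "?B \<subseteq> (C0 <#> A) <#> A" using C0 by (intro mono_set_mult) auto
  also have "\<dots> \<subseteq> C0 <#> A" unfolding set_mult_assoc[OF C0c Ac Ac] using A by (intro mono_set_mult set_mult_subset) auto
  finally have "finite (cosets G A ?B)" using cosets_finite_card(1)[OF C0(1) C0c A(1)] by blast
  then have fB: "finite (cosets G U ?B)" using cosets_trans[OF _ A(3) subgroup.subset[OF sB] A(1) U(1)] by blast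
  then obtain C where C: "finite C" "C \<subseteq> ?B" "?B \<subseteq> C <#> U"
    using cosets_cover[OF _ subgroup.subset[OF sB] U(1)] by metis
  have Cc: "C \<subseteq> carrier G" using C subgroup.subset[OF sB] by blast
  have Beq: "?B = C <#> U" using C(3) set_mult_subset[OF sB C(2) subset_trans[OF A(2) AB]] by blast
  let ?P = "pow_image G ?B p"
  have sP: "subgroup ?P G" using sB by (rule subgroup_pow_image)
  have cP: "closedin T ?P"
    unfolding Beq by (intro compactin_closedin compactin_pow_image compactin_set_mult compactin_finite C Cc U)
  have PV: "?P \<subseteq> V"
  proof -
    have "generate G {g} \<subseteq> ?R" using g R by (intro generate_subgroup_incl) auto
    moreover have "A \<subseteq> ?R" using A(4) Ac by (auto simp: pow_image_def)
    ultimately have "?B \<subseteq> ?R" using R by (intro set_mult_subset)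
    then show ?thesis by (auto simp: pow_image_def)
  qed
  \<comment> \<open>Both \<open>U / V\<close> and \<open>pB / pU\<close> are finite, the latter
    because \<open>B / U\<close> is. If \<open>V\<close> were contained in \<open>pB\<close>, then
    \<open>U / pU\<close> would be finite.\<close>
  have "\<not> V \<subseteq> ?P"
  proof
    assume VP: "V \<subseteq> ?P"
    have spU: "subgroup (pow_image G U p) G" using U by (intro subgroup_pow_image)
    obtain D where D: "finite D" "D \<subseteq> U" "U \<subseteq> D <#> V" using compact_cover[OF U(3) V(1,2)] .
    have "U \<subseteq> D <#> ?P" using subset_trans[OF D(3) mono_set_mult[OF order_refl VP]] .
    then have "finite (cosets G ?P U)" using cosets_finite_card(1)[OF D(1) _ sP] D(2) Uc by blast
    moreover have "finite (cosets G (pow_image G U p) ?P)"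
      unfolding Beq pow_image_set_mult[OF Cc Uc] using C(1) Cc spU
      by (intro cosets_finite_card(1)[of "pow_image G C p"]) (auto simp: pow_image_def)
    ultimately have "finite (cosets G (pow_image G U p) U)" using cosets_trans[OF _ _ Uc sP spU] by blast
    then show False using iU by blast
  qed
  then obtain u where u: "u \<in> V" "u \<notin> ?P" by blast
  have uc: "u \<in> carrier G" using u Vc by blast
  \<comment> \<open>Thickening the compact group \<open>pB\<close> by an open subgroup small enough
    to avoid \<open>u\<close>, and cutting with \<open>V\<close>, gives the next \<open>V\<close>;
    it contains \<open>pB\<close>, as the invariant demands.\<close>
  obtain W where W: "subgroup W G" "openin T W" "u \<notin> ?P <#> W"
    using closed_separation[OF cP uc u(2)] .
  show thesis
  proof (rule that[of g u "(?P <#> W) \<inter> V"])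
    show "subgroup ((?P <#> W) \<inter> V) G" by (rule subgroup_Int[OF mult_subgroups[OF sP W(1)] V(1)])
    show "openin T ((?P <#> W) \<inter> V)" using openin_set_mult[OF subgroup.subset[OF sP] W(2)] V(2) by blast
    show "?P \<subseteq> (?P <#> W) \<inter> V" using PV subset_set_mult_left[OF W(1) subgroup.subset[OF sP]] by blast
  qed (use g u W sB AB gB fB in auto)
qed

lemma infinite_construction:
  assumes U: "subgroup U G" "openin T U" "compactin T U"
    and iU: "infinite (cosets G (pow_image G U p) U)"
    and iQ: "infinite (cosets G U {x \<in> carrier G. x [^] p \<in> U})"
  obtains A V :: "nat \<Rightarrow> 'a set" and W :: "'a set" and g u :: "nat \<Rightarrow> 'a" where
    "\<And>n. subgroup (A n) G" "\<And>n. A n \<subseteq> A (Suc n)" "A 0 = U"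
    "\<And>n. subgroup (V n) G" "\<And>n. closedin T (V n)" "\<And>n. V (Suc n) \<subseteq> V n" "V 0 \<subseteq> U"
    "subgroup W G" "closedin T W" "\<And>n. W \<subseteq> V n" "pow_image G U p \<subseteq> W"
    "\<And>n. g n \<in> A (Suc n)" "\<And>n. g n \<notin> A n" "\<And>n. g n [^] p \<in> W"
    "\<And>n. u n \<in> V n" "\<And>n. u n \<notin> V (Suc n)"
proof -
  define P where "P s \<longleftrightarrow> (case s of (A, V) \<Rightarrow> subgroup V G \<and> openin T V \<and> V \<subseteq> U \<and>
    subgroup A G \<and> U \<subseteq> A \<and> finite (cosets G U A) \<and> pow_image G A p \<subseteq> V)" for s :: "'a set \<times> 'a set"
  define Q where "Q s s' \<longleftrightarrow> (case (s, s') of ((A, V), (A', V')) \<Rightarrow>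
    A \<subseteq> A' \<and> V' \<subseteq> V \<and> (\<exists>g. g \<in> A' - A) \<and> (\<exists>u. u \<in> V - V'))" for s s' :: "'a set \<times> 'a set"
  have Uc: "U \<subseteq> carrier G" using U subgroup.subset by blast
  have "cosets G U U \<subseteq> {U}"
    using coset_join2[OF _ U(1)] Uc by (auto simp: cosets_def)
  then have P0: "P (U, U)" using U pow_image_subset[OF U(1)] by (auto simp: P_def dest: finite_subset)
  have step: "\<exists>s'. P s' \<and> Q s s'" if Ps: "P s" for s
  proof -
    obtain A V where s: "s = (A, V)" by (cases s)
    have V: "subgroup V G" "openin T V" "V \<subseteq> U"
      and A: "subgroup A G" "U \<subseteq> A" "finite (cosets G U A)" "pow_image G A p \<subseteq> V"
      using Ps unfolding s P_def by auto
    obtain g u V' where n: "g \<in> carrier G" "g \<notin> A" "u \<in> V" "u \<notin> V'"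
      "subgroup V' G" "openin T V'" "V' \<subseteq> V"
      "subgroup (generate G {g} <#> A) G" "A \<subseteq> generate G {g} <#> A" "g \<in> generate G {g} <#> A"
      "finite (cosets G U (generate G {g} <#> A))" "pow_image G (generate G {g} <#> A) p \<subseteq> V'"
      using infinite_construction_step[OF U iU iQ V A] .
    have "P (generate G {g} <#> A, V')" unfolding P_def prod.case
      using n(5-12) subset_trans[OF n(7) V(3)] subset_trans[OF A(2) n(9)] by blast
    moreover have "Q s (generate G {g} <#> A, V')" unfolding Q_def s prod.case
      using n by blast
    ultimately show ?thesis by blast
  qed
  \<comment> \<open>The clause for \<open>n = 0\<close> fixes the initial pair, about which the
    choice principle alone promises nothing.\<close>
  have "\<exists>f. \<forall>n. (P (f n) \<and> (n = 0 \<longrightarrow> f n = (U, U))) \<and> Q (f n) (f (Suc n))"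
  proof (rule dependent_nat_choice)
    show "\<exists>x. P x \<and> (0 = (0::nat) \<longrightarrow> x = (U, U))" using P0 by blast
    show "\<exists>y. (P y \<and> (Suc n = 0 \<longrightarrow> y = (U, U))) \<and> Q x y" if "P x \<and> (n = 0 \<longrightarrow> x = (U, U))" for x n
      using step that by blast
  qed
  then obtain s where "\<forall>n::nat. (P (s n) \<and> (n = 0 \<longrightarrow> s n = (U, U))) \<and> Q (s n) (s (Suc n))" by blast
  then have s: "\<And>n. P (s n)" "\<And>n. Q (s n) (s (Suc n))" "s 0 = (U, U)" by auto
  define A V where "A n = fst (s n)" and "V n = snd (s n)" for n
  have PP: "subgroup (V n) G" "openin T (V n)" "V n \<subseteq> U"
    "subgroup (A n) G" "U \<subseteq> A n" "finite (cosets G U (A n))" "pow_image G (A n) p \<subseteq> V n" for n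
    using s(1)[of n] by (auto simp: P_def A_def V_def split: prod.splits)
  have QQ: "A n \<subseteq> A (Suc n)" "V (Suc n) \<subseteq> V n" "\<exists>g. g \<in> A (Suc n) - A n" "\<exists>u. u \<in> V n - V (Suc n)" for n
    using s(2)[of n] by (auto simp: Q_def A_def V_def split: prod.splits)
  define W where "W = (\<Inter>n. V n)"
  obtain g where g: "\<And>n. g n \<in> A (Suc n) - A n" using QQ(3) by metis
  obtain u where u: "\<And>n. u n \<in> V n - V (Suc n)" using QQ(4) by metis
  have Amono: "A m \<subseteq> A n" if "m \<le> n" for m n by (rule lift_Suc_mono_le[of A, OF QQ(1) that])
  have Vmono: "V n \<subseteq> V m" if "m \<le> n" for m n by (rule lift_Suc_antimono_le[of V, OF QQ(2) that])
  \<comment> \<open>\<open>g n\<close> belongs to every later \<open>A m\<close>, and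
    \<open>p A m \<subseteq> V m\<close>; since the \<open>V m\<close> decrease,
    \<open>p g n\<close> lies in all of them.\<close>
  have gW: "g n [^] p \<in> W" for n
    unfolding W_def
  proof
    fix m
    have "g n \<in> A (max (Suc n) m)" using g Amono[of "Suc n" "max (Suc n) m"] by auto
    then have "g n [^] p \<in> V (max (Suc n) m)" using PP(7) by (auto simp: pow_image_def)
    then show "g n [^] p \<in> V m" using Vmono[of m "max (Suc n) m"] by auto
  qed
  show thesis
  proof (rule that[of A V W g u])
    show "subgroup W G" unfolding W_def by (rule subgroups_Inter) (use PP(1) in auto)
    show cV: "closedin T (V n)" for n using openin_subgroup_closedin[OF PP(1,2)] .
    then show "closedin T W" unfolding W_def by (intro closedin_INT) auto
    show "pow_image G U p \<subseteq> W" unfolding W_def using PP(5,7) pow_image_mono by blast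
    show "A 0 = U" "V 0 \<subseteq> U" using s(3) by (auto simp: A_def V_def)
  qed (use PP QQ g u gW in \<open>auto simp: W_def\<close>)
qed

text \<open>Both auxiliary subgroups meet \<open>U\<close> exactly in the closed group
  \<open>W\<close>, so they are closed, whereas their sum meets \<open>U\<close> in the finite
  combinations of the \<open>u n\<close> modulo \<open>W\<close>. Closedness would add a limit point
  of the partial sums, and no finite combination agrees with every partial sum modulo the matching
  \<open>V n\<close>.\<close>

lemma finite_dichotomy:
  assumes sq: "strongly_topologically_quasihamiltonian G T"
    and U: "subgroup U G" "openin T U" "compactin T U"
  shows "finite (cosets G (pow_image G U p) U) \<or> finite (cosets G U {x \<in> carrier G. x [^] p \<in> U})"
proof (rule ccontr)
  assume "\<not> ?thesis"
  then have inf: "infinite (cosets G (pow_image G U p) U)" "infinite (cosets G U {x \<in> carrier G. x [^] p \<in> U})" by auto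
  show False
  proof (rule infinite_construction[OF U inf])
    fix A V :: "nat \<Rightarrow> 'a set" and W :: "'a set" and g u :: "nat \<Rightarrow> 'a"
    assume
    A: "\<And>n. subgroup (A n) G" "\<And>n. A n \<subseteq> A (Suc n)" "A 0 = U"
    and V: "\<And>n. subgroup (V n) G" "\<And>n. closedin T (V n)" "\<And>n. V (Suc n) \<subseteq> V n" "V 0 \<subseteq> U"
    and W: "subgroup W G" "closedin T W" "\<And>n. W \<subseteq> V n" "pow_image G U p \<subseteq> W"
    and g: "\<And>n. g n \<in> A (Suc n)" "\<And>n. g n \<notin> A n" "\<And>n. g n [^] p \<in> W"
    and u: "\<And>n. u n \<in> V n" "\<And>n. u n \<notin> V (Suc n)"
  have Uc: "U \<subseteq> carrier G" using U subgroup.subset by blast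
  have Amono: "A m \<subseteq> A n" if "m \<le> n" for m n by (rule lift_Suc_mono_le[of A, OF A(2) that])
  have Vmono: "V n \<subseteq> V m" if "m \<le> n" for m n by (rule lift_Suc_antimono_le[of V, OF V(3) that])
  have VU: "V n \<subseteq> U" for n using Vmono[of 0 n] V(4) by blast
  have WU: "W \<subseteq> U" using W(3) VU by blast
  have Wc: "W \<subseteq> carrier G" using WU Uc by blast
  have uU: "u n \<in> U" for n using u(1) VU by blast
  have uW: "u n [^] p \<in> W" for n using pow_imageI[OF uU] W(4) by blast
  define h where "h n = g n \<otimes> u n" for n
  have gc: "g n \<in> carrier G" for n using g(1) A(1) subgroup.mem_carrier by metis
  have uc: "u n \<in> carrier G" for n using uU Uc by blast
  have hc: "h n \<in> carrier G" for n using gc uc by (simp add: h_def)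
  have UA: "U \<subseteq> A n" for n using Amono[of 0 n] A(3) by simp
  \<comment> \<open>Adding \<open>u n \<in> U \<subseteq> A n\<close> does not change the position
    of \<open>g n\<close> in the chain \<open>A\<close>, so the \<open>h n\<close> are as
    independent as the \<open>g n\<close>.\<close>
  have h: "h n \<in> A (Suc n)" "h n \<notin> A n" "h n [^] p \<in> W" for n
  proof -
    show "h n \<in> A (Suc n)" unfolding h_def using g(1) uU UA by (intro subgroup.m_closed[OF A(1)]) auto
    show "h n \<notin> A n" unfolding h_def using subgroup_mult_right[OF A(1), of "u n" n "g n"] uU UA gc g(2) by blast
    show "h n [^] p \<in> W" unfolding h_def nat_pow_distrib[OF gc uc] using g(3) uW subgroup.m_closed[OF W(1)] by blast
  qed
  let ?g = "generate G (range g)" and ?h = "generate G (range h)" and ?u = "generate G (range u)"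
  have sg: "subgroup ?g G" and sh: "subgroup ?h G" and su: "subgroup ?u G"
    using gc hc uc by (auto intro!: generate_is_subgroup)
  have WA: "W \<subseteq> A 0" using WU A(3) by simp
  have gU: "?g \<inter> U \<subseteq> W" using generate_Int_increasing[OF prime A(1,2) W(1) WA g] A(3) by simp
  have hU: "?h \<inter> U \<subseteq> W" using generate_Int_increasing[OF prime A(1,2) W(1) WA h] A(3) by simp
  have closed: "closed_subgroup G T (B <#> W)" if B: "subgroup B G" "B \<inter> U \<subseteq> W" for B
  proof -
    have s: "subgroup (B <#> W) G" using B W by (intro mult_subgroups)
    have Bc: "B \<subseteq> carrier G" using B subgroup.subset by blast
    have "(B <#> W) \<inter> U = W"
    proof
      show "W \<subseteq> (B <#> W) \<inter> U" using subset_set_mult_right[OF B(1) Wc] WU by blast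
      show "(B <#> W) \<inter> U \<subseteq> W"
      proof
        fix x assume x: "x \<in> (B <#> W) \<inter> U"
        then obtain b w where bw: "b \<in> B" "w \<in> W" "x = b \<otimes> w" by (auto elim: set_multE)
        then have "b \<in> U" using subgroup_mult_right[OF U(1), of w b] x WU Bc by blast
        then show "x \<in> W" using bw B(2) subgroup.m_closed[OF W(1)] by blast
      qed
    qed
    then show ?thesis using closedin_subgroup_if_locally[OF s U(1,2)] W(2) s by (simp add: closed_subgroup_def)
  qed
  let ?S = "(?g <#> W) <#> (?h <#> W)"
  have cS: "closedin T ?S"
    using sq closed[OF sg gU] closed[OF sh hU] unfolding strongly_topologically_quasihamiltonian_def by blast
  have sS: "subgroup ?S G" using sg sh W by (intro mult_subgroups)
  have sgu: "subgroup (?g <#> (?u <#> W)) G" using sg su W by (intro mult_subgroups)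
  have guW: "?g \<subseteq> ?g <#> (?u <#> W)" "?u \<subseteq> ?g <#> (?u <#> W)" "W \<subseteq> ?g <#> (?u <#> W)"
  proof -
    have suW: "subgroup (?u <#> W) G" using su W by (intro mult_subgroups)
    show "?g \<subseteq> ?g <#> (?u <#> W)" using subset_set_mult_left[OF suW subgroup.subset[OF sg]] .
    show "?u \<subseteq> ?g <#> (?u <#> W)"
      using subset_set_mult_left[OF W(1) subgroup.subset[OF su]] subset_set_mult_right[OF sg subgroup.subset[OF suW]] by blast
    show "W \<subseteq> ?g <#> (?u <#> W)"
      using subset_set_mult_right[OF su Wc] subset_set_mult_right[OF sg subgroup.subset[OF suW]] by blast
  qed
  have "?h \<subseteq> ?g <#> (?u <#> W)"
  proof (rule generate_subgroup_incl[OF _ sgu])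
    have "g n \<in> ?g <#> (?u <#> W)" "u n \<in> ?g <#> (?u <#> W)" for n
      using subsetD[OF guW(1)] subsetD[OF guW(2)] generate.incl[of "g n" "range g" G] generate.incl[of "u n" "range u" G] by auto
    then show "range h \<subseteq> ?g <#> (?u <#> W)" unfolding h_def using subgroup.m_closed[OF sgu] by blast
  qed
  then have SguW: "?S \<subseteq> ?g <#> (?u <#> W)"
    using set_mult_subset[OF sgu set_mult_subset[OF sgu guW(1,3)] set_mult_subset[OF sgu _ guW(3)]] by blast
  \<comment> \<open>\<open>S\<close> is contained in the sum of the groups generated by the
    \<open>g n\<close> and the \<open>u n\<close> and of \<open>W\<close>. If such a sum lies in
    \<open>U\<close>, then so does its part from the \<open>g n\<close>, which is therefore in
    \<open>W\<close>.\<close>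
  have SU: "\<exists>a\<in>?u. \<exists>w\<in>W. x = a \<otimes> w" if x: "x \<in> ?S" "x \<in> U" for x
  proof -
    have "x \<in> ?g <#> (?u <#> W)" using SguW x(1) by (rule subsetD)
    then obtain a t where at: "a \<in> ?g" "t \<in> ?u <#> W" "x = a \<otimes> t" by (rule set_multE)
    obtain b w where "b \<in> ?u" "w \<in> W" "t = b \<otimes> w" using at(2) by (rule set_multE)
    then have abw: "a \<in> ?g" "b \<in> ?u" "w \<in> W" "x = a \<otimes> (b \<otimes> w)" using at by auto
    have c: "a \<in> carrier G" "b \<in> carrier G" "w \<in> carrier G"
      using abw subgroup.mem_carrier[OF sg] subgroup.mem_carrier[OF su] Wc by auto
    have "?u \<subseteq> U" using uU by (intro generate_subgroup_incl[OF _ U(1)]) auto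
    then have "b \<otimes> w \<in> U" using abw WU subgroup.m_closed[OF U(1)] by blast
    then have "a \<in> U" using subgroup_mult_right[OF U(1), of "b \<otimes> w" a] x abw c by blast
    then have "a \<in> W" using gU abw by blast
    then have "a \<otimes> w \<in> W" using abw subgroup.m_closed[OF W(1)] by blast
    moreover have "x = b \<otimes> (a \<otimes> w)" using abw c by (simp add: m_ac)
    ultimately show ?thesis using abw by blast
  qed
  have uS: "u n \<in> ?S" for n
  proof -
    have "u n = inv g n \<otimes> h n" using gc uc by (simp add: h_def)
    moreover have "g n \<in> ?g <#> W"
      using subsetD[OF subset_set_mult_left[OF W(1) subgroup.subset[OF sg]]] generate.incl[of "g n" "range g" G] by simp
    moreover have "h n \<in> ?h <#> W"
      using subsetD[OF subset_set_mult_left[OF W(1) subgroup.subset[OF sh]]] generate.incl[of "h n" "range h" G] by simp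
    ultimately show ?thesis
      using set_multI[OF subgroup.m_inv_closed[OF mult_subgroups[OF sg W(1)]]] by metis
  qed
  define s where "s = rec_nat \<one> (\<lambda>n x. x \<otimes> u n)"
  have s0: "s 0 = \<one>" and sSuc: "s (Suc n) = s n \<otimes> u n" for n by (auto simp: s_def)
  have sM: "s n \<in> ?S \<inter> U" for n
    by (induction n) (use sS U(1) uS uU in \<open>auto simp: s0 sSuc subgroup.one_closed subgroup.m_closed\<close>)
  have sc: "s n \<in> carrier G" for n using sM Uc by blast
  have sgen: "s n \<in> generate G (u ` {..<n})" for n
  proof (induction n)
    case 0 then show ?case by (simp add: s0 generate.one)
  next
    case (Suc n)
    have "s n \<in> generate G (u ` {..<Suc n})"
      using Suc mono_generate[of "u ` {..<n}" "u ` {..<Suc n}"] by (auto simp: lessThan_Suc)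
    then show ?case unfolding sSuc by (intro generate.eng) (auto intro: generate.incl)
  qed
  have cM: "compactin T (?S \<inter> U)"
    using compactin_closed_subset[OF U(3) closedin_Int[OF cS compactin_closedin[OF U(3)]] Int_lower2] .
  \<comment> \<open>The cosets \<open>s n + V n\<close> decrease because
    \<open>u n \<in> V n\<close>, and each contains \<open>s n\<close>. Since
    \<open>S \<inter> U\<close> is compact, they have a common point there.\<close>
  obtain z where z: "z \<in> ?S \<inter> U" "\<And>n. z \<in> (\<lambda>x. s n \<otimes> x) ` V n"
  proof (rule compact_nest[OF cM, of "\<lambda>n. (\<lambda>x. s n \<otimes> x) ` V n"])
    show "closedin T ((\<lambda>x. s n \<otimes> x) ` V n)" for n using closedin_translate[OF sc V(2)] .
    show "(\<lambda>x. s (Suc n) \<otimes> x) ` V (Suc n) \<subseteq> (\<lambda>x. s n \<otimes> x) ` V n" for n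
    proof
      fix y assume "y \<in> (\<lambda>x. s (Suc n) \<otimes> x) ` V (Suc n)"
      then obtain v where v: "v \<in> V (Suc n)" "y = s n \<otimes> u n \<otimes> v" by (auto simp: sSuc)
      then have "v \<in> carrier G" using VU Uc by blast
      then have "y = s n \<otimes> (u n \<otimes> v)" using v sc uc by (simp add: m_assoc)
      moreover have "u n \<otimes> v \<in> V n" using v V(3) u(1) subgroup.m_closed[OF V(1)] by blast
      ultimately show "y \<in> (\<lambda>x. s n \<otimes> x) ` V n" by blast
    qed
    show "(?S \<inter> U) \<inter> (\<lambda>x. s n \<otimes> x) ` V n \<noteq> {}" for n
    proof -
      have "s n = s n \<otimes> \<one>" using sc by simp
      then have "s n \<in> (\<lambda>x. s n \<otimes> x) ` V n" using subgroup.one_closed[OF V(1)] by blast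
      then show ?thesis using sM by blast
    qed
  qed blast
  obtain a w where aw: "a \<in> ?u" "w \<in> W" "z = a \<otimes> w" using SU z(1) by blast
  obtain n where n: "a \<in> generate G (u ` {..<n})" using generate_range_sequence[OF aw(1)] .
  have sgn: "subgroup (generate G (u ` {..<n})) G" using uc by (intro generate_is_subgroup) auto
  \<comment> \<open>\<open>y\<close> compares the combination \<open>a\<close> with the partial sum
    of equal length. It lies in \<open>V n\<close>, hence in \<open>W\<close>; one step further,
    \<open>z - s (Suc n) \<in> V (Suc n)\<close> then says that
    \<open>u n \<in> V (Suc n)\<close>.\<close>
  define y where "y = inv (s n) \<otimes> a"
  have ac: "a \<in> carrier G" "w \<in> carrier G" using aw Wc subgroup.mem_carrier[OF su] by auto
  have yc: "y \<in> carrier G" using ac sc by (simp add: y_def)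
  have zs: "inv (s m) \<otimes> z \<in> V m" for m
  proof -
    obtain v where v: "v \<in> V m" "z = s m \<otimes> v" using z(2)[of m] by blast
    moreover have "v \<in> carrier G" using v VU Uc by blast
    ultimately show ?thesis using sc by simp
  qed
  have "y \<otimes> w \<in> V n" using zs[of n] aw ac sc by (simp add: y_def m_assoc)
  then have "y \<in> V n" using subgroup_mult_right[OF V(1), of w n y] aw W(3) yc by blast
  moreover have "y \<in> generate G (u ` {..<n})" unfolding y_def
    using subgroup.m_closed[OF sgn subgroup.m_inv_closed[OF sgn sgen] n] .
  ultimately have "y \<in> W" using generate_Int_decreasing[of p V W u n, OF prime V(1,3) W(1,3) u uW] by blast
  then have ywW: "y \<otimes> w \<in> W" using aw subgroup.m_closed[OF W(1)] by blast
  have "inv (s (Suc n)) \<otimes> z = inv (u n) \<otimes> (y \<otimes> w)"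
    unfolding sSuc y_def aw(3) using ac sc uc by (simp add: inv_mult m_ac)
  then have "inv (u n) \<otimes> (y \<otimes> w) \<in> V (Suc n)" using zs[of "Suc n"] by simp
  then have "inv (u n) \<in> V (Suc n)"
    using subgroup_mult_right[OF V(1), of "y \<otimes> w" "Suc n" "inv (u n)"] ywW W(3) uc by blast
  then have "u n \<in> V (Suc n)" using subgroup.m_inv_closed[OF V(1)] uc by fastforce
  then show False using u(2) by blast
  qed
qed

end

section \<open>Torsion and divisible elements\<close>

context comm_group
begin

lemma subgroup_tor: "subgroup (tor G) G"
proof
  show "tor G \<subseteq> carrier G" by (auto simp: tor_def)
  show "\<one> \<in> tor G" unfolding tor_def by (auto intro: exI[of _ 1])
  fix x assume "x \<in> tor G"
  then obtain n where n: "x \<in> carrier G" "n > 0" "x [^] (n::nat) = \<one>" by (auto simp: tor_def)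
  then show "inv x \<in> tor G" unfolding tor_def by (auto simp: nat_pow_inv intro!: exI[of _ n])
  fix y assume "y \<in> tor G"
  then obtain m where m: "y \<in> carrier G" "m > 0" "y [^] (m::nat) = \<one>" by (auto simp: tor_def)
  have "(x \<otimes> y) [^] (n * m) = (x [^] n) [^] m \<otimes> (y [^] m) [^] n"
    using n(1) m(1) by (simp add: nat_pow_distrib nat_pow_pow mult.commute)
  then have "(x \<otimes> y) [^] (n * m) = \<one>" unfolding n(3) m(3) by simp
  then show "x \<otimes> y \<in> tor G" unfolding tor_def using n m by (auto intro!: exI[of _ "n * m"])
qed

end

context linear_p_group
begin

text \<open>Once the \<open>p\<close>-part of the order is removed, an element killed by a number
  prime to \<open>p\<close> remains, and it lies in the closed subgroup generated by zero.\<close>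

lemma tor_p_power:
  assumes "x \<in> tor G"
  shows "\<exists>k. x [^] (p ^ k) = \<one>"
proof -
  obtain n where n: "x \<in> carrier G" "n > 0" "x [^] (n::nat) = \<one>" using assms by (auto simp: tor_def)
  obtain m where m: "n = p ^ multiplicity p n * m" "\<not> p dvd m"
    using multiplicity_decompose'[of n p] n(2) prime by (metis not_prime_unit mult.commute neq0_conv)
  define y where "y = x [^] (p ^ multiplicity p n)"
  have yc: "y \<in> carrier G" using n by (simp add: y_def)
  have "y [^] m = \<one>" using n m(1) by (simp add: y_def nat_pow_pow)
  then have "y \<in> tgen {\<one>}" using in_tgen_coprime_power[OF yc m(2)] by simp
  also have "tgen {\<one>} \<subseteq> tgen {}"
    by (intro tgen_subset closed_subgroup_tgen) (auto simp: tgen_empty)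
  finally show ?thesis by (auto simp: tgen_empty y_def)
qed

text \<open>The \<open>p\<close>-torsion of the finitely generated group \<open>U\<close> is itself
  finitely generated and killed by \<open>p\<close>, hence finite, and a small open subgroup avoids
  its nonzero elements. A nonzero torsion element of that subgroup would have a multiple of order
  \<open>p\<close> in it.\<close>

lemma tor_trivial_open_subgroup:
  assumes U: "subgroup U G" "openin T U" "compactin T U"
    and fU: "finite (cosets G (pow_image G U p) U)"
  obtains V where "subgroup V G" "openin T V" "V \<inter> tor G = {\<one>}"
proof -
  obtain F where F: "finite F" "F \<subseteq> U" "U = tgen F"
    using tgen_if_finite_Frattini_quotient[OF U(1,3) fU] .
  have Uc: "U \<subseteq> carrier G" using U subgroup.subset by blast
  have Fc: "F \<subseteq> carrier G" using F Uc by blast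
  have one: "closed_subgroup G T {\<one>}" by (rule closed_subgroup_trivial)
  let ?S = "{x \<in> U. x [^] p \<in> {\<one>}}"
  have S: "closed_subgroup G T ?S"
    by (rule closed_subgroup_pow_preimage[OF closed_subgroup_compact[OF U(1,3)] one])
  obtain F' where F': "finite F'" "F' \<subseteq> ?S" "?S = tgen F'"
    using closed_subgroup_of_tgen[OF F(1) Fc S] F(3) by blast
  have F'c: "F' \<subseteq> carrier G" using F' Uc by blast
  have "\<And>f. f \<in> F' \<Longrightarrow> f [^] p \<in> {\<one>}" using F'(2) by blast
  from tgen_cover[OF F'(1) F'c one p_pos this]
  obtain C where C: "finite C" "tgen F' \<subseteq> C <#> {\<one>}" by metis
  have "finite (C <#> {\<one>})" using C(1) by (simp add: set_mult_def)
  then have finS: "finite (?S - {\<one>})" using C(2) F'(3) finite_subset by (metis finite_Diff)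
  have "closedin T (?S - {\<one>})"
    using finS Uc by (intro compactin_closedin compactin_finite) auto
  then have "openin T (U - (?S - {\<one>}))" using U(2) by blast
  moreover have "\<one> \<in> U - (?S - {\<one>})" using U by (auto simp: subgroup.one_closed)
  ultimately obtain V where V: "subgroup V G" "openin T V" "V \<subseteq> U - (?S - {\<one>})" using base by meson
  have "x = \<one>" if x: "x \<in> V" "x \<in> tor G" for x
  proof (rule ccontr)
    assume "x \<noteq> \<one>"
    have xc: "x \<in> carrier G" using x by (auto simp: tor_def)
    obtain k0 where "x [^] (p ^ k0) = \<one>" using tor_p_power[OF x(2)] by blast
    define k where "k = (LEAST k. x [^] (p ^ k) = \<one>)"
    have k: "x [^] (p ^ k) = \<one>" unfolding k_def using \<open>x [^] (p ^ k0) = \<one>\<close> by (rule LeastI)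
    have "k \<noteq> 0"
    proof
      assume "k = 0"
      then show False using k \<open>x \<noteq> \<one>\<close> xc by simp
    qed
    then obtain j where j: "k = Suc j" using not0_implies_Suc by blast
    then have nj: "x [^] (p ^ j) \<noteq> \<one>" using not_less_Least[of j "\<lambda>k. x [^] (p ^ k) = \<one>"] by (simp flip: k_def)
    have "x [^] (p ^ j) \<in> V" using V x subgroup_nat_pow by blast
    moreover have "(x [^] (p ^ j)) [^] p = \<one>" using k xc by (simp add: j nat_pow_pow mult.commute)
    ultimately show False using V(3) nj by blast
  qed
  then have "V \<inter> tor G = {\<one>}" using subgroup.one_closed[OF V(1)] subgroup.one_closed[OF subgroup_tor] by blast
  then show thesis using that V by blast
qed

text \<open>A trivial trace on an open subgroup isolates every torsion point, and closedness follows
  from the local criterion.\<close>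

lemma tor_discrete_closed:
  assumes U: "subgroup U G" "openin T U" "compactin T U"
    and fU: "finite (cosets G (pow_image G U p) U)"
  shows "subtopology T (tor G) = discrete_topology (tor G)" "closed_subgroup G T (tor G)"
proof -
  obtain V where V: "subgroup V G" "openin T V" "V \<inter> tor G = {\<one>}"
    using tor_trivial_open_subgroup[OF assms] .
  have tc: "tor G \<subseteq> carrier G" by (auto simp: tor_def)
  have Vc: "V \<subseteq> carrier G" using V subgroup.subset by blast
  have "openin (subtopology T (tor G)) {x}" if x: "x \<in> tor G" for x
  proof -
    have xc: "x \<in> carrier G" using x tc by blast
    have "tor G \<inter> (\<lambda>v. x \<otimes> v) ` V = {x}"
    proof
      show "{x} \<subseteq> tor G \<inter> (\<lambda>v. x \<otimes> v) ` V"
        using x xc subgroup.one_closed[OF V(1)] by (auto simp: image_iff intro!: bexI[of _ \<one>])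
      show "tor G \<inter> (\<lambda>v. x \<otimes> v) ` V \<subseteq> {x}"
      proof
        fix y assume "y \<in> tor G \<inter> (\<lambda>v. x \<otimes> v) ` V"
        then obtain v where v: "v \<in> V" "y = x \<otimes> v" "y \<in> tor G" by blast
        then have "v \<in> tor G" using subgroup_mult_left[OF subgroup_tor x, of v] Vc by blast
        then have "v = \<one>" using V(3) v(1) by blast
        then show "y \<in> {x}" using v xc by simp
      qed
    qed
    then show ?thesis using openin_subtopology_Int2[OF openin_translate[OF xc V(2)], of "tor G"] by simp
  qed
  then have "discrete_topology (tor G) = subtopology T (tor G)"
    unfolding discrete_topology_unique using tc topspace_eq by auto
  then show "subtopology T (tor G) = discrete_topology (tor G)" by simp
  have "closedin T (tor G \<inter> V)"
    using V(3) compactin_closedin[OF compactin_finite[of "{\<one>}"]] by (simp add: Int_commute)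
  then show "closed_subgroup G T (tor G)"
    using closedin_subgroup_if_locally[OF subgroup_tor V(1,2)] subgroup_tor by (simp add: closed_subgroup_def)
qed

text \<open>Without \<open>p\<close>-torsion, multiplication by \<open>p\<close> embeds the socle of
  \<open>G / U\<close> into \<open>U / pU\<close>, so the first finiteness condition implies the
  second.\<close>

lemma finite_p_rank_torsion_free:
  assumes U: "subgroup U G" "openin T U" "compactin T U"
    and fU: "finite (cosets G (pow_image G U p) U)"
    and tf: "\<And>x. x \<in> carrier G \<Longrightarrow> x [^] p = \<one> \<Longrightarrow> x = \<one>"
  shows "finite_p_rank G T"
proof (rule finite_p_rank_if_open[OF U fU])
  have Uc: "U \<subseteq> carrier G" using U subgroup.subset by blast
  show "finite (cosets G U {x \<in> carrier G. x [^] p \<in> U})"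
  proof (rule cosets_inject(1)[OF fU, where f = "\<lambda>x. x [^] p"])
    fix x y assume xy: "x \<in> {x \<in> carrier G. x [^] p \<in> U}" "y \<in> {x \<in> carrier G. x [^] p \<in> U}"
      "x [^] p \<otimes> inv (y [^] p) \<in> pow_image G U p"
    then obtain v where v: "v \<in> U" "x [^] p \<otimes> inv (y [^] p) = v [^] p" by (auto simp: pow_image_def)
    have c: "x \<in> carrier G" "y \<in> carrier G" "v \<in> carrier G" using xy v Uc by auto
    have "(x \<otimes> inv y \<otimes> inv v) [^] p = \<one>" using v(2) c by (simp add: nat_pow_distrib nat_pow_inv)
    then have "x \<otimes> inv y \<otimes> inv v = \<one>" using tf c by simp
    then have "x \<otimes> inv y = v" using c by (metis inv_closed inv_mult_cancel(1) l_one m_closed)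
    then show "x \<otimes> inv y \<in> U" using v by simp
  qed (use U Uc subgroup_pow_image in auto)
qed

section \<open>The divisible part when the socle of \<open>G / U\<close> is finite\<close>

lemma finite_cosets_power_torsion:
  assumes U: "subgroup U G" and fQ: "finite (cosets G U {x \<in> carrier G. x [^] p \<in> U})"
  shows "finite (cosets G U {x \<in> carrier G. x [^] (p ^ k) \<in> U})"
proof (induction k)
  case 0
  have "cosets G U {x \<in> carrier G. x [^] (p ^ 0) \<in> U} \<subseteq> {U}"
    using coset_join2[OF _ U] by (auto simp: cosets_def)
  then show ?case by (rule finite_subset) simp
next
  case (Suc k)
  let ?K = "\<lambda>k. {x \<in> carrier G. x [^] (p ^ k) \<in> U}"
  have K: "subgroup (?K k) G" for k using subgroup_pow_preimage[OF subgroup_self U] .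
  have "finite (cosets G (?K 1) (?K (Suc k)))"
  proof (rule cosets_inject(1)[OF Suc, where f = "\<lambda>x. x [^] p"])
    show "x [^] p \<in> ?K k" if "x \<in> ?K (Suc k)" for x using that by (simp add: nat_pow_pow)
    show "x \<otimes> inv y \<in> ?K 1" if "x \<in> ?K (Suc k)" "y \<in> ?K (Suc k)" "x [^] p \<otimes> inv (y [^] p) \<in> U" for x y
      using that by (simp add: nat_pow_distrib nat_pow_inv)
  qed (use U K[of 1] in auto)
  moreover have "finite (cosets G U (?K 1))" using fQ by simp
  moreover have "?K (Suc k) \<subseteq> carrier G" by blast
  ultimately show ?case using cosets_trans[of "?K 1" "?K (Suc k)" U] K[of 1] U by blast
qed

text \<open>The trace of \<open>p^k G\<close> on \<open>U\<close> is \<open>p^k\<close> times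
  \<open>{x. p^k x \<in> U}\<close>, and the latter is compact as a finite union of cosets of
  \<open>U\<close>.\<close>

lemma closed_subgroup_pow_image_carrier:
  assumes U: "subgroup U G" "openin T U" "compactin T U"
    and fQ: "finite (cosets G U {x \<in> carrier G. x [^] p \<in> U})"
  shows "closed_subgroup G T (pow_image G (carrier G) (p ^ k))"
proof -
  let ?K = "{x \<in> carrier G. x [^] (p ^ k) \<in> U}" and ?P = "pow_image G (carrier G) (p ^ k)"
  have Uc: "U \<subseteq> carrier G" using U subgroup.subset by blast
  have K: "subgroup ?K G" using subgroup_pow_preimage[OF subgroup_self U(1)] .
  have UK: "U \<subseteq> ?K" using Uc subgroup_nat_pow[OF U(1)] by blast
  obtain C where C: "finite C" "C \<subseteq> ?K" "?K \<subseteq> C <#> U"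
    using finite_cosets_cover[OF finite_cosets_power_torsion[OF U(1) fQ] subgroup.subset[OF K] U(1)] .
  have Cc: "C \<subseteq> carrier G" using C by blast
  have Keq: "?K = C <#> U" using C(3) set_mult_subset[OF K C(2) UK] by blast
  have "?P \<inter> U = pow_image G ?K (p ^ k)" by (auto simp: pow_image_def)
  moreover have "compactin T (pow_image G ?K (p ^ k))"
    unfolding Keq by (rule compactin_pow_image[OF compactin_set_mult[OF compactin_finite[OF C(1) Cc] U(3)]])
  ultimately have "closedin T (?P \<inter> U)" using compactin_closedin by simp
  then show ?thesis
    using closedin_subgroup_if_locally[OF subgroup_pow_image[OF subgroup_self] U(1,2)]
    by (simp add: closed_subgroup_def subgroup_pow_image subgroup_self)
qed

lemma pow_image_coprime:
  assumes D: "closed_subgroup G T D" and m: "\<not> p dvd m"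
  shows "D \<subseteq> pow_image G D m"
proof
  fix x assume x: "x \<in> D"
  then have xc: "x \<in> carrier G" using D subgroup.mem_carrier by (auto simp: closed_subgroup_def)
  then have Z: "subgroup (tgen {x}) G" "compactin T (tgen {x})" "x \<in> tgen {x}"
    by (auto intro: tgen_singleton)
  have "tgen {x [^] m} \<subseteq> pow_image G (tgen {x}) m"
    using pow_imageI[OF Z(3)] by (intro tgen_subset closed_subgroup_pow_image Z) auto
  moreover have "tgen {x} \<subseteq> D" using x D by (intro tgen_subset) auto
  ultimately show "x \<in> pow_image G D m"
    using in_tgen_coprime_power[OF xc m] pow_image_mono by blast
qed

text \<open>In a general abelian group the intersection of the \<open>p^k G\<close> need not be
  \<open>p\<close>-divisible. Here solutions of \<open>p y = x\<close> differ by
  \<open>p\<close>-torsion, which lies in a finite union of cosets of \<open>U\<close>; so solutions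
  in each single \<open>p^k G\<close> yield one in all of them by compactness. Divisibility by
  numbers prime to \<open>p\<close> holds in every closed subgroup.\<close>

lemma divisible_part_eq:
  assumes U: "subgroup U G" "openin T U" "compactin T U"
    and fQ: "finite (cosets G U {x \<in> carrier G. x [^] p \<in> U})"
  shows "divisible_part G = (\<Inter>k. pow_image G (carrier G) (p ^ k))" (is "_ = ?D")
    and "closed_subgroup G T (divisible_part G)"
proof -
  let ?P = "\<lambda>k. pow_image G (carrier G) (p ^ k)"
  have P: "closed_subgroup G T (?P k)" for k using closed_subgroup_pow_image_carrier[OF assms] .
  have Pdec: "?P (Suc k) \<subseteq> ?P k" for k by (rule pow_image_dvd[OF subgroup_self]) simp
  have sD: "subgroup ?D G" by (rule subgroups_Inter) (use P in \<open>auto simp: closed_subgroup_def\<close>)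
  have cD: "closed_subgroup G T ?D" using sD P by (auto simp: closed_subgroup_def intro!: closedin_INT)
  let ?K = "{x \<in> carrier G. x [^] p \<in> U}"
  have K: "subgroup ?K G" using subgroup_pow_preimage[OF subgroup_self U(1)] .
  obtain C where C: "finite C" "C \<subseteq> ?K" "?K \<subseteq> C <#> U"
    using finite_cosets_cover[OF fQ subgroup.subset[OF K] U(1)] .
  have Cc: "C \<subseteq> carrier G" using C by blast
  have cCU: "compactin T (C <#> U)" by (rule compactin_set_mult[OF compactin_finite[OF C(1) Cc] U(3)])
  have p_div: "?D \<subseteq> pow_image G ?D p"
  proof
    fix x assume x: "x \<in> ?D"
    have ex: "\<exists>y\<in>?P k. y [^] p = x" for k
    proof -
      have "x \<in> ?P (Suc k)" using x by blast
      then obtain z where z: "z \<in> carrier G" "x = z [^] (p ^ Suc k)" unfolding pow_image_def by blast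
      then have "x = (z [^] (p ^ k)) [^] p" by (simp add: nat_pow_pow mult.commute)
      then show ?thesis using pow_imageI[OF z(1)] by blast
    qed
    obtain y0 where y0: "y0 \<in> ?P 0" "y0 [^] p = x" using ex by blast
    have y0c: "y0 \<in> carrier G" using y0 by (auto simp: pow_image_def)
    have xc: "x \<in> carrier G" using y0 y0c by auto
    let ?Y = "\<lambda>k. ?P k \<inter> {y \<in> topspace T. y [^] p \<in> {x}}"
    have "compactin T ((\<lambda>v. y0 \<otimes> v) ` (C <#> U))"
      by (rule image_compactin[OF cCU continuous_map_translate[OF y0c]])
    then obtain y where "\<And>k. y \<in> ?Y k"
    proof (rule compact_nest[of _ ?Y])
      show "closedin T (?Y k)" for k
        using P compactin_closedin[OF compactin_finite[of "{x}"]] xc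
        by (intro closedin_Int closedin_continuous_map_preimage[OF continuous_map_pow]) (auto simp: closed_subgroup_def)
      show "?Y (Suc k) \<subseteq> ?Y k" for k using Pdec by blast
      show "(\<lambda>v. y0 \<otimes> v) ` (C <#> U) \<inter> ?Y k \<noteq> {}" for k
      proof -
        obtain y where y: "y \<in> ?P k" "y [^] p = x" using ex by blast
        then have yc: "y \<in> carrier G" by (auto simp: pow_image_def)
        have "(inv y0 \<otimes> y) [^] p = \<one>" using y y0 yc y0c xc by (simp add: nat_pow_distrib nat_pow_inv)
        then have "inv y0 \<otimes> y \<in> ?K" using yc y0c U by (simp add: subgroup.one_closed)
        then have "inv y0 \<otimes> y \<in> C <#> U" using C by blast
        moreover have "y = y0 \<otimes> (inv y0 \<otimes> y)" using yc y0c by simp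
        ultimately show ?thesis using y yc topspace_eq by blast
      qed
    qed blast
    then have "y \<in> ?D" "y [^] p = x" by auto
    then show "x \<in> pow_image G ?D p" using pow_imageI by blast
  qed
  have pk_div: "?D \<subseteq> pow_image G ?D (p ^ k)" for k
  proof (induction k)
    case 0 then show ?case using pow_image_1[OF subgroup.subset[OF sD]] by simp
  next
    case (Suc k)
    have "?D \<subseteq> pow_image G (pow_image G ?D p) (p ^ k)"
      by (rule subset_trans[OF Suc pow_image_mono[OF p_div]])
    then show ?case using subgroup.subset[OF sD] by (simp add: pow_image_pow_image)
  qed
  have "divisible_subgroup G ?D"
    unfolding divisible_subgroup_def
  proof (intro conjI ballI allI impI sD)
    fix x and n :: nat assume x: "x \<in> ?D" and n: "n > 0"
    obtain m where m: "n = p ^ multiplicity p n * m" "\<not> p dvd m"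
      using multiplicity_decompose'[of n p] n prime by (metis not_prime_unit mult.commute neq0_conv)
    have "?D \<subseteq> pow_image G (pow_image G ?D (p ^ multiplicity p n)) m"
      by (rule subset_trans[OF pow_image_coprime[OF cD m(2)] pow_image_mono[OF pk_div]])
    then have "?D \<subseteq> pow_image G ?D n"
      unfolding pow_image_pow_image[OF subgroup.subset[OF sD]] m(1)[symmetric] .
    then have "x \<in> pow_image G ?D n" using x by blast
    then show "\<exists>y\<in>?D. y [^] n = x" by (auto simp: pow_image_def)
  qed
  then have "?D \<subseteq> divisible_part G" by (rule divisible_part_greatest(2))
  moreover have "divisible_part G \<subseteq> ?D"
  proof (intro subsetI INT_I)
    fix x k assume "x \<in> divisible_part G"
    then obtain y where "y \<in> divisible_part G" "y [^] (p ^ k) = x"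
      using divisible_part_greatest(1) p_pos unfolding divisible_subgroup_def by (metis zero_less_power)
    moreover from this have "y \<in> carrier G"
      using divisible_part_greatest(1) subgroup.mem_carrier unfolding divisible_subgroup_def by metis
    ultimately show "x \<in> ?P k" using pow_imageI by blast
  qed
  ultimately show *: "divisible_part G = ?D" by blast
  show "closed_subgroup G T (divisible_part G)" unfolding * by (rule cD)
qed

text \<open>For every \<open>j\<close>, \<open>G\<close> is the sum of \<open>p^j G\<close> and a
  subgroup \<open>B\<close> that is bounded modulo \<open>U\<close>. Multiplying by a bound
  \<open>p^k\<close> gives \<open>p^k G \<subseteq> U + p^j G\<close> for all \<open>j\<close>,
  hence \<open>p^k G \<subseteq> U + div(G)\<close> by compactness, while \<open>B\<close> is finite
  modulo \<open>U\<close>.\<close>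

lemma compact_cover_divisible_part:
  assumes U: "subgroup U G" "openin T U" "compactin T U"
    and fQ: "finite (cosets G U {x \<in> carrier G. x [^] p \<in> U})"
  obtains Q where "compactin T Q" "carrier G = Q <#> divisible_part G"
proof -
  let ?P = "\<lambda>k. pow_image G (carrier G) (p ^ k)" and ?D = "divisible_part G"
  have P: "closed_subgroup G T (?P k)" for k using closed_subgroup_pow_image_carrier[OF assms] .
  have Pc: "?P k \<subseteq> carrier G" for k using pow_image_subset[OF subgroup_self] .
  have Pdec: "?P (Suc k) \<subseteq> ?P k" for k by (rule pow_image_dvd[OF subgroup_self]) simp
  have D: "?D = (\<Inter>k. ?P k)" "closed_subgroup G T ?D" using divisible_part_eq[OF assms] by auto
  have Uc: "U \<subseteq> carrier G" using subgroup.subset[OF U(1)] .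
  have Dc: "?D \<subseteq> carrier G" using closedin_carrier D(2) by (simp add: closed_subgroup_def)
  have tors: "\<exists>k. x [^] (p ^ k) \<in> U" if "x \<in> carrier G" for x using eventually_in[OF U(1,2) that] .
  have sPU: "subgroup (pow_image G (carrier G) p <#> U) G"
    using mult_subgroups[OF subgroup_pow_image[OF subgroup_self] U(1)] .
  have pc: "pow_image G (carrier G) p \<subseteq> carrier G" using pow_image_subset[OF subgroup_self] .
  obtain C where C: "finite C" "C \<subseteq> carrier G" "carrier G \<subseteq> C <#> (pow_image G (carrier G) p <#> U)"
    using finite_cosets_cover[OF card_cosets_quotient_le(1)[OF subgroup_self U(1) Uc p_pos tors fQ] order_refl sPU] .
  obtain k where k: "\<And>c. c \<in> C \<Longrightarrow> c [^] (p ^ k) \<in> U"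
    using uniform_p_power[OF C(1) U(1) C(2) tors] C(2) by blast
  let ?B = "generate G C <#> U"
  have sC: "subgroup (generate G C) G" using generate_is_subgroup[OF C(2)] .
  have sB: "subgroup ?B G" using mult_subgroups[OF sC U(1)] .
  have "C <#> (pow_image G (carrier G) p <#> U) = (C <#> U) <#> pow_image G (carrier G) p"
    using set_mult_comm[OF pc Uc] set_mult_assoc[OF C(2) Uc pc] by simp
  also have "\<dots> \<subseteq> ?B <#> pow_image G (carrier G) p"
    by (intro mono_set_mult order_refl) (auto intro: generate.incl)
  finally have "carrier G \<subseteq> ?B <#> pow_image G (carrier G) p" using C(3) by (rule subset_trans[rotated])
  from subset_set_mult_pow_image_iterate[OF sB subgroup_self this]
  have GB: "carrier G \<subseteq> ?B <#> ?P j" for j .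
  have BU: "pow_image G ?B (p ^ k) \<subseteq> U" using pow_image_generate_set_mult[OF C(2) U(1) k] .
  have PU: "?P k \<subseteq> U <#> ?P j" for j
  proof -
    have "?P k \<subseteq> pow_image G (?B <#> ?P j) (p ^ k)" using pow_image_mono[OF GB] .
    also have "\<dots> = pow_image G ?B (p ^ k) <#> pow_image G (?P j) (p ^ k)"
      by (rule pow_image_set_mult[OF subgroup.subset[OF sB] Pc])
    also have "\<dots> \<subseteq> U <#> ?P j"
      by (intro mono_set_mult BU pow_image_subset subgroup_pow_image subgroup_self)
    finally show ?thesis .
  qed
  \<comment> \<open>The sets \<open>(e + U) \<inter> p^j G\<close> are nonempty, closed and
    decreasing in \<open>j\<close>; a common point lies in the divisible part and differs from
    \<open>e\<close> by an element of \<open>U\<close>.\<close>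
  have "?P k \<subseteq> U <#> ?D"
  proof
    fix e assume e: "e \<in> ?P k"
    then have ec: "e \<in> carrier G" using Pc by blast
    have "compactin T ((\<lambda>u. e \<otimes> u) ` U)"
      by (rule image_compactin[OF U(3) continuous_map_translate[OF ec]])
    then obtain d where d: "d \<in> (\<lambda>u. e \<otimes> u) ` U" "\<And>j. d \<in> ?P j"
    proof (rule compact_nest[of _ ?P])
      show "closedin T (?P j)" for j using P by (simp add: closed_subgroup_def)
      show "?P (Suc j) \<subseteq> ?P j" for j by (rule Pdec)
      show "(\<lambda>u. e \<otimes> u) ` U \<inter> ?P j \<noteq> {}" for j
      proof -
        obtain u a where ua: "u \<in> U" "a \<in> ?P j" "e = u \<otimes> a" using subsetD[OF PU e] by (rule set_multE)
        have c: "u \<in> carrier G" "a \<in> carrier G" using ua Uc Pc by auto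
        then have "e = a \<otimes> u" using ua(3) by (simp add: m_comm)
        then have "a = e \<otimes> inv u" using c by simp
        then show ?thesis using ua subgroup.m_inv_closed[OF U(1)] by blast
      qed
    qed blast
    then obtain u where u: "u \<in> U" "d = e \<otimes> u" by blast
    have uc: "u \<in> carrier G" using u Uc by blast
    have "d = u \<otimes> e" using u(2) uc ec by (simp add: m_comm)
    then have "e = inv u \<otimes> d" using uc ec by simp
    moreover have "d \<in> ?D" unfolding D(1) using d(2) by blast
    ultimately show "e \<in> U <#> ?D" using u(1) subgroup.m_inv_closed[OF U(1)] set_multI by metis
  qed
  then have "carrier G \<subseteq> ?B <#> (U <#> ?D)" using subset_trans[OF GB mono_set_mult[OF order_refl]] by blast
  have "p ^ k > 0" using p_pos by simp
  then obtain D' where D': "finite D'" "D' \<subseteq> generate G C" "?B \<subseteq> D' <#> U"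
    using finite_generate_set_mult[OF C(1,2) U(1) _ k] by blast
  have D'c: "D' \<subseteq> carrier G" using D' generate_incl[OF C(2)] by blast
  have UDc: "U <#> ?D \<subseteq> carrier G" using set_mult_subset[OF subgroup_self Uc Dc] .
  have "?B <#> (U <#> ?D) \<subseteq> (D' <#> U) <#> (U <#> ?D)" by (rule mono_set_mult[OF D'(3) order_refl])
  also have "\<dots> = (D' <#> (U <#> U)) <#> ?D"
    using set_mult_assoc D'c Uc Dc UDc set_mult_closed by (simp add: set_mult_assoc)
  also have "\<dots> \<subseteq> (D' <#> U) <#> ?D"
    by (intro mono_set_mult order_refl set_mult_subset[OF U(1)])
  finally have "carrier G \<subseteq> (D' <#> U) <#> ?D" using \<open>carrier G \<subseteq> ?B <#> (U <#> ?D)\<close> by (rule subset_trans[rotated])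
  moreover have "(D' <#> U) <#> ?D \<subseteq> carrier G"
    by (rule set_mult_subset[OF subgroup_self set_mult_subset[OF subgroup_self D'c Uc] Dc])
  ultimately show thesis
    using that[of "D' <#> U"] compactin_set_mult[OF compactin_finite[OF D'(1) D'c] U(3)] by blast
qed

end

section \<open>Subgroups, quotients and van Dantzig's theorem\<close>

context linear_p_group
begin

text \<open>Compact open subgroups of \<open>G\<close> are cut with \<open>D\<close>; closedness of
  \<open>D\<close> keeps the traces compact.\<close>

lemma linear_p_group_subgroup_of:
  assumes D: "closed_subgroup G T D"
  shows "linear_p_group (subgroup_of G D) (subtopology T D) p"
proof -
  have sD: "subgroup D G" and cD: "closedin T D" using D by (auto simp: closed_subgroup_def)
  have Dc: "D \<subseteq> carrier G" using sD by (rule subgroup.subset)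
  interpret S: comm_group "subgroup_of G D" by (rule comm_group_subgroup_of[OF sD])
  have top: "topspace (subtopology T D) = D" using Dc topspace_eq by auto
  show ?thesis
  proof
    show "topspace (subtopology T D) = carrier (subgroup_of G D)" using top by simp
    have "continuous_map (subtopology (prod_topology T T) (D \<times> D)) (subtopology T D) (\<lambda>(x, y). x \<otimes> y)"
      using continuous_map_from_subtopology[OF continuous_mult] subgroup.m_closed[OF sD]
      by (intro continuous_map_into_subtopology) auto
    then show "continuous_map (prod_topology (subtopology T D) (subtopology T D)) (subtopology T D)
        (\<lambda>(x, y). x \<otimes>\<^bsub>subgroup_of G D\<^esub> y)"
      by (simp add: subtopology_Times)
    have "continuous_map (subtopology T D) (subtopology T D) (\<lambda>x. inv x)"
      using continuous_map_from_subtopology[OF continuous_inv] subgroup.m_inv_closed[OF sD]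
      by (intro continuous_map_into_subtopology) auto
    then show "continuous_map (subtopology T D) (subtopology T D) (\<lambda>x. inv\<^bsub>subgroup_of G D\<^esub> x)"
      by (rule continuous_map_eq) (use sD top in simp)
    show "Hausdorff_space (subtopology T D)" using Hausdorff by (rule Hausdorff_space_subtopology)
    show "prime p" by (rule prime)
    have nbhd: "\<exists>V. subgroup V G \<and> openin T V \<and> compactin T V \<and> V \<inter> D \<subseteq> N"
      if N: "openin (subtopology T D) N" "\<one> \<in> N" for N
    proof -
      obtain N' where N': "openin T N'" "N = N' \<inter> D" using N(1) by (auto simp: openin_subtopology)
      then obtain V where "subgroup V G" "openin T V" "compactin T V" "V \<subseteq> N'" using base[of N'] N(2) by auto
      then show ?thesis using N' by blast
    qed
    fix V
    show "\<exists>V'. subgroup V' (subgroup_of G D) \<and> openin (subtopology T D) V' \<and> compactin (subtopology T D) V' \<and> V' \<subseteq> V"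
      if V: "openin (subtopology T D) V" "\<one>\<^bsub>subgroup_of G D\<^esub> \<in> V"
    proof -
      obtain W where W: "subgroup W G" "openin T W" "compactin T W" "W \<inter> D \<subseteq> V" using nbhd[OF V(1)] V(2) by auto
      have "subgroup (W \<inter> D) (subgroup_of G D)"
        using subgroup_incl[OF subgroup_Int[OF W(1) sD] sD] by simp
      moreover have "openin (subtopology T D) (W \<inter> D)" using W(2) by (rule openin_subtopology_Int)
      moreover have "compactin (subtopology T D) (W \<inter> D)"
        using compactin_closed_subset[OF W(3) closedin_Int[OF compactin_closedin[OF W(3)] cD]]
        by (simp add: compactin_subtopology)
      ultimately show ?thesis using W(4) by blast
    qed
    fix x
    show "\<exists>k. x [^]\<^bsub>subgroup_of G D\<^esub> (p ^ k) \<in> V"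
      if V: "subgroup V (subgroup_of G D)" "openin (subtopology T D) V" and x: "x \<in> carrier (subgroup_of G D)"
    proof -
      have "\<one> \<in> V" using subgroup.one_closed[OF V(1)] by simp
      then obtain W where W: "subgroup W G" "openin T W" "W \<inter> D \<subseteq> V" using nbhd[OF V(2)] by blast
      obtain k where "x [^] (p ^ k) \<in> W" using eventually_in[OF W(1,2), of x] x Dc by auto
      moreover have "x [^] (p ^ k) \<in> D" using subgroup_nat_pow[OF sD] x by simp
      ultimately show ?thesis using W(3) by auto
    qed
  qed
qed

lemma linear_p_group_Mod:
  assumes N: "closed_subgroup G T N"
  shows "linear_p_group (G Mod N) (quotient_topology G T N) p"
proof -
  let ?Q = "G Mod N" and ?T = "quotient_topology G T N" and ?q = "\<lambda>x. N #> x"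
  have sN: "subgroup N G" and cN: "closedin T N" using N by (auto simp: closed_subgroup_def)
  have nN: "N \<lhd> G" using sN normal_iff_subgroup by blast
  have Nc: "N \<subseteq> carrier G" using sN by (rule subgroup.subset)
  interpret Q: comm_group ?Q by (rule abelian_FactGroup[OF sN])
  interpret q: group_hom G ?Q ?q
    by unfold_locales (rule normal.r_coset_hom_Mod[OF nN])
  have qm: "quotient_map T ?T ?q" by (rule quotient_map_quotient_topology)
  have carr: "carrier ?Q = ?q ` carrier G" by (rule carrier_FactGroup)
  have top: "topspace ?T = carrier ?Q"
    using quotient_imp_surjective_map[OF qm] topspace_eq carr by simp
  have op: "openin ?T (?q ` U)" if "openin T U" for U
    by (rule openin_rcos_image[OF sN that])
  have pre: "openin T {x \<in> carrier G. ?q x \<in> W}" if "openin ?T W" for W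
    using that topspace_eq unfolding openin_quotient_topology by simp
  have nbhd: "\<exists>V. subgroup V G \<and> openin T V \<and> compactin T V \<and> ?q ` V \<subseteq> W"
    if W: "openin ?T W" "N \<in> W" for W
  proof -
    have "\<one> \<in> {x \<in> carrier G. ?q x \<in> W}" using W(2) Nc by simp
    then obtain V where "subgroup V G" "openin T V" "compactin T V" "V \<subseteq> {x \<in> carrier G. ?q x \<in> W}"
      using base[OF pre[OF W(1)]] by blast
    then show ?thesis by blast
  qed
  show ?thesis
  proof
    show "topspace ?T = carrier ?Q" by (rule top)
    \<comment> \<open>A product of quotient maps need not be a quotient map, so continuity is
      checked on basic open sets, using that the projection is open.\<close>
    show "continuous_map (prod_topology ?T ?T) ?T (\<lambda>(x, y). x \<otimes>\<^bsub>?Q\<^esub> y)"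
      unfolding continuous_map_def
    proof (intro conjI allI impI)
      show "(\<lambda>(x, y). x \<otimes>\<^bsub>?Q\<^esub> y) \<in> topspace (prod_topology ?T ?T) \<rightarrow> topspace ?T"
        using Q.m_closed top by auto
      fix W assume W: "openin ?T W"
      show "openin (prod_topology ?T ?T) {z \<in> topspace (prod_topology ?T ?T). (\<lambda>(x, y). x \<otimes>\<^bsub>?Q\<^esub> y) z \<in> W}"
        unfolding openin_prod_topology_alt
      proof (intro allI impI)
        fix a b assume "(a, b) \<in> {z \<in> topspace (prod_topology ?T ?T). (\<lambda>(x, y). x \<otimes>\<^bsub>?Q\<^esub> y) z \<in> W}"
        then have ab: "a \<in> carrier ?Q" "b \<in> carrier ?Q" "a \<otimes>\<^bsub>?Q\<^esub> b \<in> W" using top by auto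
        then obtain x y where xy: "x \<in> carrier G" "y \<in> carrier G" "a = ?q x" "b = ?q y" unfolding carr by auto
        have "?q (x \<otimes> y) \<in> W" using ab(3) xy q.hom_mult by simp
        then have "(x, y) \<in> {z \<in> topspace (prod_topology T T). (\<lambda>(x, y). x \<otimes> y) z \<in> {x \<in> carrier G. ?q x \<in> W}}"
          using xy topspace_eq by simp
        moreover have "openin (prod_topology T T) {z \<in> topspace (prod_topology T T). (\<lambda>(x, y). x \<otimes> y) z \<in> {x \<in> carrier G. ?q x \<in> W}}"
          using openin_continuous_map_preimage[OF continuous_mult pre[OF W]] .
        ultimately obtain A B where AB: "openin T A" "openin T B" "x \<in> A" "y \<in> B"
          "A \<times> B \<subseteq> {z \<in> topspace (prod_topology T T). (\<lambda>(x, y). x \<otimes> y) z \<in> {x \<in> carrier G. ?q x \<in> W}}"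
          unfolding openin_prod_topology_alt by meson
        have "?q ` A \<times> ?q ` B \<subseteq> {z \<in> topspace (prod_topology ?T ?T). (\<lambda>(x, y). x \<otimes>\<^bsub>?Q\<^esub> y) z \<in> W}"
        proof
          fix z assume "z \<in> ?q ` A \<times> ?q ` B"
          then obtain x' y' where z: "x' \<in> A" "y' \<in> B" "z = (?q x', ?q y')" by auto
          then have "x' \<in> carrier G" "y' \<in> carrier G" "?q (x' \<otimes> y') \<in> W" using AB topspace_eq by auto
          then show "z \<in> {z \<in> topspace (prod_topology ?T ?T). (\<lambda>(x, y). x \<otimes>\<^bsub>?Q\<^esub> y) z \<in> W}"
            using z top q.hom_mult q.hom_closed by simp
        qed
        then show "\<exists>U V. openin ?T U \<and> openin ?T V \<and> a \<in> U \<and> b \<in> V \<and>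
            U \<times> V \<subseteq> {z \<in> topspace (prod_topology ?T ?T). (\<lambda>(x, y). x \<otimes>\<^bsub>?Q\<^esub> y) z \<in> W}"
          using op[OF AB(1)] op[OF AB(2)] AB(3,4) xy by blast
      qed
    qed
    have "continuous_map T ?T (?q \<circ> (\<lambda>x. inv x))"
      by (rule continuous_map_compose[OF continuous_inv quotient_imp_continuous_map[OF qm]])
    then have "continuous_map T ?T ((\<lambda>x. inv\<^bsub>?Q\<^esub> x) \<circ> ?q)"
      by (rule continuous_map_eq) (simp add: topspace_eq q.hom_inv)
    then show "continuous_map ?T ?T (\<lambda>x. inv\<^bsub>?Q\<^esub> x)"
      using continuous_compose_quotient_map_eq[OF qm] by blast
    show "Hausdorff_space ?T"
      unfolding Hausdorff_space_def
    proof (intro allI impI)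
      fix a b assume "a \<in> topspace ?T \<and> b \<in> topspace ?T \<and> a \<noteq> b"
      then obtain x y where xy: "x \<in> carrier G" "y \<in> carrier G" "a = ?q x" "b = ?q y" "?q x \<noteq> ?q y"
        unfolding top carr by auto
      \<comment> \<open>Since \<open>N\<close> is closed, some open subgroup \<open>V\<close> keeps
        \<open>x - y\<close> out of \<open>N + V\<close>; the cosets \<open>x + V\<close> and
        \<open>y + V\<close> then have disjoint images.\<close>
      then have nin: "x \<otimes> inv y \<notin> N" using rcos_eq_iff[OF sN] by blast
      obtain V where V: "subgroup V G" "openin T V" "x \<otimes> inv y \<notin> N <#> V"
        using closed_separation[OF cN _ nin] xy by auto
      have Vc: "V \<subseteq> carrier G" using V(1) by (rule subgroup.subset)
      let ?A = "?q ` (\<lambda>v. x \<otimes> v) ` V" and ?B = "?q ` (\<lambda>v. y \<otimes> v) ` V"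
      have "openin ?T ?A" "openin ?T ?B" using op openin_translate V xy by auto
      moreover have "a \<in> ?A" "b \<in> ?B"
      proof -
        have "x = x \<otimes> \<one>" "y = y \<otimes> \<one>" "\<one> \<in> V" using xy subgroup.one_closed[OF V(1)] by auto
        then show "a \<in> ?A" "b \<in> ?B" unfolding xy(3,4) by blast+
      qed
      moreover have "disjnt ?A ?B"
      proof (rule ccontr)
        assume "\<not> disjnt ?A ?B"
        then obtain v w where vw: "v \<in> V" "w \<in> V" "?q (x \<otimes> v) = ?q (y \<otimes> w)" unfolding disjnt_def by auto
        have c: "v \<in> carrier G" "w \<in> carrier G" using vw Vc by auto
        have "(x \<otimes> v) \<otimes> inv (y \<otimes> w) \<in> N" using vw(3) rcos_eq_iff[OF sN, of "x \<otimes> v" "y \<otimes> w"] c xy by simp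
        moreover have "x \<otimes> inv y = ((x \<otimes> v) \<otimes> inv (y \<otimes> w)) \<otimes> (w \<otimes> inv v)"
          using c xy by (simp add: inv_mult m_assoc m_lcomm[of "inv v"] m_comm[of "inv y"] m_lcomm[of v])
        moreover have "w \<otimes> inv v \<in> V" using vw V(1) by (intro subgroup_diff)
        ultimately show False using V(3) set_multI by metis
      qed
      ultimately show "\<exists>U V. openin ?T U \<and> openin ?T V \<and> a \<in> U \<and> b \<in> V \<and> disjnt U V" by blast
    qed
    show "prime p" by (rule prime)
    fix V
    show "\<exists>V'. subgroup V' ?Q \<and> openin ?T V' \<and> compactin ?T V' \<and> V' \<subseteq> V"
      if V: "openin ?T V" "\<one>\<^bsub>?Q\<^esub> \<in> V"
    proof -
      obtain W where W: "subgroup W G" "openin T W" "compactin T W" "?q ` W \<subseteq> V" using nbhd[OF V(1)] V(2) by auto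
      have "subgroup (?q ` W) ?Q" using W(1) by (rule q.subgroup_img_is_subgroup)
      moreover have "compactin ?T (?q ` W)" using image_compactin[OF W(3) quotient_imp_continuous_map[OF qm]] .
      ultimately show ?thesis using op[OF W(2)] W(4) by blast
    qed
    fix a
    show "\<exists>k. a [^]\<^bsub>?Q\<^esub> (p ^ k) \<in> V" if V: "subgroup V ?Q" "openin ?T V" and a: "a \<in> carrier ?Q"
    proof -
      obtain x where x: "x \<in> carrier G" "a = ?q x" using a unfolding carr by auto
      have "N \<in> V" using subgroup.one_closed[OF V(1)] by simp
      then obtain W where W: "subgroup W G" "openin T W" "?q ` W \<subseteq> V" using nbhd[OF V(2)] by blast
      obtain k where "x [^] (p ^ k) \<in> W" using eventually_in[OF W(1,2) x(1)] by blast
      then have "?q (x [^] (p ^ k)) \<in> V" using W(3) by blast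
      then show ?thesis using FactGroup_rcos[OF sN x(1)] x(2) by metis
    qed
  qed
qed

end

text \<open>Van Dantzig's theorem: total disconnectedness and local compactness give a compact open
  set \<open>C\<close> with \<open>\<one> \<in> C \<subseteq> N\<close>, and the translations that
  map \<open>C\<close> into itself, together with their inverses, form an open subgroup inside
  \<open>C\<close>. The condition on powers is the convergence of \<open>p^k x\<close> to
  zero.\<close>

lemma (in lca_p_group) linear_p_group: "linear_p_group G T p"
proof
  show "prime p" by (rule prime)
next
  fix V x assume V: "subgroup V G" "openin T V" and x: "x \<in> carrier G"
  have "limitin T (\<lambda>k. x [^] (p ^ k)) \<one> sequentially"
    using all_p_elements[OF x] by (simp add: p_element_def)
  then have "\<forall>\<^sub>F k in sequentially. x [^] (p ^ k) \<in> V"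
    using V subgroup.one_closed[OF V(1)] by (simp add: limitin_def)
  then show "\<exists>k. x [^] (p ^ k) \<in> V" using eventually_happens'[OF sequentially_bot] by blast
next
  fix N assume N: "openin T N" "\<one> \<in> N"
  obtain O' K where OK: "openin T O'" "compactin T K" "\<one> \<in> O'" "O' \<subseteq> K"
    using locally_compact one_closed unfolding locally_compact_space_def topspace_eq by meson
  have "connected_component_of_set T \<one> = {\<one>}"
    using totally_disconnected one_closed unfolding totally_disconnected_def topspace_eq by blast
  then have comp: "{\<one>} \<in> connected_components_of T"
    unfolding connected_components_of_def topspace_eq using one_closed by (metis imageI)
  \<comment> \<open>Cutting with \<open>O'\<close> keeps \<open>C\<close> inside the compact
    neighbourhood \<open>K\<close>, so that \<open>C\<close> is compact.\<close>
  let ?R = "topspace T - (N \<inter> O')"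
  have "separated_between T {\<one>} ?R"
  proof (rule separated_between_compact_connected_component[OF locally_compact Hausdorff comp])
    show "compactin T {\<one>}" by (rule compactin_finite) auto
    show "closedin T ?R" using N OK by blast
    show "disjnt {\<one>} ?R" using N OK by auto
  qed
  then obtain C E where CE: "openin T C" "openin T E" "C \<union> E = topspace T" "disjnt C E" "\<one> \<in> C" "?R \<subseteq> E"
    unfolding separated_between_def by auto
  have C: "closedin T C"
  proof -
    have "C = topspace T - E" using CE(3,4) openin_subset[OF CE(1)] unfolding disjnt_def by blast
    then show ?thesis using CE(2) by blast
  qed
  have CN: "C \<subseteq> N \<inter> O'" using CE(4,6) openin_subset[OF CE(1)] unfolding disjnt_def by blast
  then have cC: "compactin T C" using compactin_closed_subset[OF OK(2) C] OK(4) by blast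
  have Cc: "C \<subseteq> carrier G" using cC by (rule compactin_carrier)
  \<comment> \<open>\<open>A\<close> is open because its complement is the sum of the closed set
    \<open>topspace T - C\<close> and the compact set of inverses of \<open>C\<close>.\<close>
  define A where "A = {x \<in> carrier G. \<forall>c\<in>C. x \<otimes> c \<in> C}"
  have "openin T A"
  proof -
    let ?S = "(topspace T - C) <#> (\<lambda>x. inv x) ` C"
    have "closedin T ?S"
      using CE(1) by (intro closedin_set_mult_compactin image_compactin[OF cC continuous_inv]) blast
    moreover have "A = topspace T - ?S"
    proof (intro subset_antisym subsetI)
      fix x assume x: "x \<in> A"
      have "x \<notin> ?S"
      proof
        assume "x \<in> ?S"
        then obtain d c where dc: "d \<in> topspace T - C" "c \<in> C" "x = d \<otimes> inv c" by (auto elim!: set_multE)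
        then have "x \<otimes> c = d" using Cc topspace_eq by auto
        then show False using x dc by (auto simp: A_def)
      qed
      then show "x \<in> topspace T - ?S" using x by (simp add: A_def topspace_eq)
    next
      fix x assume x: "x \<in> topspace T - ?S"
      have "x \<otimes> c \<in> C" if c: "c \<in> C" for c
      proof (rule ccontr)
        have cc: "x \<in> carrier G" "c \<in> carrier G" using x c Cc topspace_eq by auto
        assume "x \<otimes> c \<notin> C"
        then have "(x \<otimes> c) \<otimes> inv c \<in> ?S" using c cc topspace_eq by (intro set_multI) auto
        then show False using x cc by simp
      qed
      then show "x \<in> A" using x by (simp add: A_def topspace_eq)
    qed
    ultimately show ?thesis by blast
  qed
  define V where "V = A \<inter> {x \<in> topspace T. inv x \<in> A}"
  have oV: "openin T V" unfolding V_def
    using \<open>openin T A\<close> openin_continuous_map_preimage[OF continuous_inv \<open>openin T A\<close>] by blast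
  have VA: "x \<in> V \<longleftrightarrow> x \<in> carrier G \<and> (\<forall>c\<in>C. x \<otimes> c \<in> C \<and> inv x \<otimes> c \<in> C)" for x
    unfolding V_def A_def topspace_eq by auto
  have sV: "subgroup V G"
  proof
    show "V \<subseteq> carrier G" using VA by blast
    show "\<one> \<in> V" using VA Cc by auto
    show "inv x \<in> V" if "x \<in> V" for x using that VA by simp
    show "x \<otimes> y \<in> V" if "x \<in> V" "y \<in> V" for x y
    proof -
      have c: "x \<in> carrier G" "y \<in> carrier G" using that VA by auto
      have "x \<otimes> y \<otimes> c \<in> C \<and> inv (x \<otimes> y) \<otimes> c \<in> C" if cC: "c \<in> C" for c
      proof -
        have "c \<in> carrier G" using cC Cc by blast
        then have "x \<otimes> y \<otimes> c = x \<otimes> (y \<otimes> c)" "inv (x \<otimes> y) \<otimes> c = inv x \<otimes> (inv y \<otimes> c)"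
          using c by (simp_all add: m_assoc inv_mult)
        then show ?thesis using \<open>x \<in> V\<close> \<open>y \<in> V\<close> VA cC by simp
      qed
      then show ?thesis using VA c by simp
    qed
  qed
  have VC: "V \<subseteq> C"
  proof
    fix x assume "x \<in> V"
    then have "x \<otimes> \<one> \<in> C" "x \<in> carrier G" using VA CE(5) by auto
    then show "x \<in> C" by simp
  qed
  have "compactin T V" using compactin_closed_subset[OF cC openin_subgroup_closedin[OF sV oV] VC] .
  then show "\<exists>V. subgroup V G \<and> openin T V \<and> compactin T V \<and> V \<subseteq> N"
    using sV oV VC CN by blast
qed

section \<open>Translation of the rank and compactness conditions\<close>

context linear_p_group
begin

text \<open>Inside the compact group \<open>U\<close> the open subgroup may be \<open>U\<close>
  itself. The socle of \<open>U / U\<close> is trivial, so only the condition on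
  \<open>U / pU\<close> is left.\<close>

lemma finite_p_rank_subgroup_iff:
  assumes U: "subgroup U G" "compactin T U"
  shows "finite_p_rank (subgroup_of G U) (subtopology T U) \<longleftrightarrow> finite (cosets G (pow_image G U p) U)"
proof -
  interpret S: linear_p_group "subgroup_of G U" "subtopology T U" p
    using linear_p_group_subgroup_of[OF closed_subgroup_compact[OF U]] .
  have Uc: "U \<subseteq> carrier G" using subgroup.subset[OF U(1)] .
  show ?thesis
  proof
    assume "finite_p_rank (subgroup_of G U) (subtopology T U)"
    then obtain n where "p_rank_le (subgroup_of G U) (subtopology T U) n" unfolding finite_p_rank_iff by blast
    from S.finite_Frattini_quotient_if_p_rank_le[OF this] show "finite (cosets G (pow_image G U p) U)" by simp
  next
    assume f: "finite (cosets G (pow_image G U p) U)"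
    show "finite_p_rank (subgroup_of G U) (subtopology T U)"
    proof (rule S.finite_p_rank_if_open[of U])
      show "subgroup U (subgroup_of G U)" using S.subgroup_self by simp
      show "openin (subtopology T U) U" using Uc topspace_eq by (metis openin_topspace topspace_subtopology_subset)
      show "compactin (subtopology T U) U" using U by (simp add: compactin_subtopology)
      have "cosets G U {x \<in> U. x [^] p \<in> U} \<subseteq> {U}" using coset_join2[OF _ U(1)] Uc by (auto simp: cosets_def)
      then show "finite (cosets (subgroup_of G U) U {x \<in> carrier (subgroup_of G U). x [^]\<^bsub>subgroup_of G U\<^esub> p \<in> U})"
        by (simp add: finite_subset)
    qed (use f in simp)
  qed
qed

lemma FactGroup_socle:
  assumes U: "subgroup U G"
  shows "{a \<in> carrier (G Mod U). a [^]\<^bsub>G Mod U\<^esub> p = \<one>\<^bsub>G Mod U\<^esub>} = cosets G U {x \<in> carrier G. x [^] p \<in> U}"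
proof -
  have "(U #> x) [^]\<^bsub>G Mod U\<^esub> p = \<one>\<^bsub>G Mod U\<^esub> \<longleftrightarrow> x [^] p \<in> U" if x: "x \<in> carrier G" for x
    unfolding FactGroup_rcos[OF U x] one_FactGroup by (rule rcos_eq_self_iff[OF U nat_pow_closed[OF x]])
  then show ?thesis unfolding carrier_FactGroup cosets_def by blast
qed

text \<open>The dual case: \<open>G / U\<close> is discrete, so its trivial subgroup is compact and
  open, and only the condition on the socle is left.\<close>

lemma finite_p_rank_Mod_open_iff:
  assumes U: "subgroup U G" "openin T U"
  shows "finite_p_rank (G Mod U) (quotient_topology G T U) \<longleftrightarrow> finite (cosets G U {x \<in> carrier G. x [^] p \<in> U})"
proof -
  have "closed_subgroup G T U" using U openin_subgroup_closedin by (simp add: closed_subgroup_def)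
  then interpret Q: linear_p_group "G Mod U" "quotient_topology G T U" p by (rule linear_p_group_Mod)
  have oneQ: "\<one>\<^bsub>G Mod U\<^esub> = U" by simp
  show ?thesis
  proof
    assume "finite_p_rank (G Mod U) (quotient_topology G T U)"
    then obtain n where "p_rank_le (G Mod U) (quotient_topology G T U) n" unfolding finite_p_rank_iff by blast
    from Q.finite_socle_if_p_rank_le[OF this] show "finite (cosets G U {x \<in> carrier G. x [^] p \<in> U})"
      unfolding FactGroup_socle[OF U(1)] .
  next
    assume f: "finite (cosets G U {x \<in> carrier G. x [^] p \<in> U})"
    show "finite_p_rank (G Mod U) (quotient_topology G T U)"
    proof (rule Q.finite_p_rank_if_open[of "{\<one>\<^bsub>G Mod U\<^esub>}"])
      show "subgroup {\<one>\<^bsub>G Mod U\<^esub>} (G Mod U)" by (rule Q.triv_subgroup)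
      have "{x \<in> topspace T. U #> x \<in> {U}} = U"
        using rcos_eq_self_iff[OF U(1)] topspace_eq subgroup.subset[OF U(1)] by auto
      then have "openin T {x \<in> topspace T. U #> x \<in> {U}}" using U(2) by (rule ssubst)
      moreover have "U \<in> carrier (G Mod U)"
        unfolding carrier_FactGroup using subgroup.subset[OF U(1)] by (intro image_eqI[of _ _ \<one>]) auto
      then have "{U} \<subseteq> carrier (G Mod U)" by blast
      ultimately show "openin (quotient_topology G T U) {\<one>\<^bsub>G Mod U\<^esub>}"
        unfolding openin_quotient_topology oneQ by (intro conjI)
      show "compactin (quotient_topology G T U) {\<one>\<^bsub>G Mod U\<^esub>}"
        by (rule Q.compactin_finite) (use Q.one_closed in auto)
      show "finite (cosets (G Mod U) (pow_image (G Mod U) {\<one>\<^bsub>G Mod U\<^esub>} p) {\<one>\<^bsub>G Mod U\<^esub>})"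
        by (simp add: cosets_def)
      have "finite {a \<in> carrier (G Mod U). a [^]\<^bsub>G Mod U\<^esub> p \<in> {\<one>\<^bsub>G Mod U\<^esub>}}"
        using f FactGroup_socle[OF U(1)] by simp
      then show "finite (cosets (G Mod U) {\<one>\<^bsub>G Mod U\<^esub>} {a \<in> carrier (G Mod U). a [^]\<^bsub>G Mod U\<^esub> p \<in> {\<one>\<^bsub>G Mod U\<^esub>}})"
        unfolding cosets_def by (rule finite_imageI)
    qed
  qed
qed

text \<open>\<open>G / tor(G)\<close> has no \<open>p\<close>-torsion, so
  \<open>finite_p_rank_torsion_free\<close> applies: the image of \<open>U\<close> is compact and
  open, and representatives of \<open>U / pU\<close> still represent its classes modulo
  \<open>p\<close>.\<close>

lemma finite_p_rank_Mod_tor: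
  assumes U: "subgroup U G" "openin T U" "compactin T U"
    and fU: "finite (cosets G (pow_image G U p) U)"
  shows "finite_p_rank (G Mod tor G) (quotient_topology G T (tor G))"
proof -
  let ?N = "tor G" and ?q = "\<lambda>x. tor G #> x"
  have N: "closed_subgroup G T ?N" using tor_discrete_closed(2)[OF assms] .
  have sN: "subgroup ?N G" by (rule subgroup_tor)
  have nN: "?N \<lhd> G" using sN normal_iff_subgroup by blast
  interpret Q: linear_p_group "G Mod ?N" "quotient_topology G T ?N" p using N by (rule linear_p_group_Mod)
  interpret q: group_hom G "G Mod ?N" ?q
    by unfold_locales (rule normal.r_coset_hom_Mod[OF nN])
  have Uc: "U \<subseteq> carrier G" using subgroup.subset[OF U(1)] .
  have qm: "quotient_map T (quotient_topology G T ?N) ?q" by (rule quotient_map_quotient_topology)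
  show ?thesis
  proof (rule Q.finite_p_rank_torsion_free[of "?q ` U"])
    show sqU: "subgroup (?q ` U) (G Mod ?N)" using U(1) by (rule q.subgroup_img_is_subgroup)
    show "compactin (quotient_topology G T ?N) (?q ` U)"
      using image_compactin[OF U(3) quotient_imp_continuous_map[OF qm]] .
    show "openin (quotient_topology G T ?N) (?q ` U)" by (rule openin_rcos_image[OF sN U(2)])
    have sP: "subgroup (pow_image G U p) G" using U(1) by (rule subgroup_pow_image)
    obtain C where C: "finite C" "C \<subseteq> U" "U \<subseteq> C <#> pow_image G U p"
      using finite_cosets_cover[OF fU Uc sP] .
    have qpow: "?q x [^]\<^bsub>G Mod ?N\<^esub> n = ?q (x [^] n)" if "x \<in> carrier G" for x and n :: nat
      using FactGroup_rcos[OF sN that] .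
    have "?q ` U \<subseteq> (?q ` C) <#>\<^bsub>G Mod ?N\<^esub> pow_image (G Mod ?N) (?q ` U) p"
    proof
      fix a assume "a \<in> ?q ` U"
      then obtain x where x: "x \<in> U" "a = ?q x" by blast
      then obtain c z where cz: "c \<in> C" "z \<in> pow_image G U p" "x = c \<otimes> z" using C(3) by (meson set_multE subsetD)
      then obtain u where u: "u \<in> U" "z = u [^] p" by (auto simp: pow_image_def)
      have cc: "c \<in> carrier G" "u \<in> carrier G" using cz u C Uc by auto
      have "a = ?q c \<otimes>\<^bsub>G Mod ?N\<^esub> (?q u [^]\<^bsub>G Mod ?N\<^esub> p)"
        unfolding x(2) cz(3) u(2) qpow[OF cc(2)] by (rule q.hom_mult) (use cc in auto)
      then show "a \<in> (?q ` C) <#>\<^bsub>G Mod ?N\<^esub> pow_image (G Mod ?N) (?q ` U) p"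
        using cz(1) u(1) set_multI[of "?q c" "?q ` C"] Q.pow_imageI[of "?q u" "?q ` U" p] by blast
    qed
    moreover have "finite (?q ` C)" using C(1) by (rule finite_imageI)
    moreover have "?q ` C \<subseteq> carrier (G Mod ?N)"
      by (rule subset_trans[OF image_mono[OF C(2)] subgroup.subset[OF sqU]])
    ultimately show "finite (cosets (G Mod ?N) (pow_image (G Mod ?N) (?q ` U) p) (?q ` U))"
      using Q.cosets_finite_card(1)[OF _ _ Q.subgroup_pow_image[OF sqU]] by metis
    fix a assume a: "a \<in> carrier (G Mod ?N)" "a [^]\<^bsub>G Mod ?N\<^esub> p = \<one>\<^bsub>G Mod ?N\<^esub>"
    then obtain x where x: "x \<in> carrier G" "a = ?q x" unfolding carrier_FactGroup by blast
    then have "?q (x [^] p) = ?N" using a(2) qpow by simp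
    then have "x [^] p \<in> ?N" using rcos_eq_self_iff[OF sN] x(1) by simp
    then obtain n where "n > 0" "(x [^] p) [^] (n::nat) = \<one>" by (auto simp: tor_def)
    then have "x \<in> ?N" using x(1) p_pos by (auto simp: tor_def nat_pow_pow intro!: exI[of _ "p * n"])
    then show "a = \<one>\<^bsub>G Mod ?N\<^esub>" using rcos_eq_self_iff[OF sN x(1)] x(2) by simp
  qed
qed

text \<open>Divisibility turns the socle condition into the condition modulo \<open>p\<close>. With
  \<open>V = D \<inter> U\<close> and \<open>K = {x \<in> D. p x \<in> V}\<close>, every element of
  \<open>V\<close> is \<open>p\<close> times one of \<open>K\<close>, and \<open>K\<close> is a
  finite set plus \<open>V\<close>; hence \<open>V\<close> is covered by a finite set plus
  \<open>pV\<close>.\<close>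

lemma finite_p_rank_divisible_part:
  assumes U: "subgroup U G" "openin T U" "compactin T U"
    and fQ: "finite (cosets G U {x \<in> carrier G. x [^] p \<in> U})"
  shows "finite_p_rank (subgroup_of G (divisible_part G)) (subtopology T (divisible_part G))"
proof -
  let ?D = "divisible_part G"
  have D: "closed_subgroup G T ?D" using divisible_part_eq(2)[OF assms] .
  have sD: "subgroup ?D G" using D by (simp add: closed_subgroup_def)
  have Dc: "?D \<subseteq> carrier G" using subgroup.subset[OF sD] .
  interpret S: linear_p_group "subgroup_of G ?D" "subtopology T ?D" p by (rule linear_p_group_subgroup_of[OF D])
  let ?V = "?D \<inter> U" and ?K = "{x \<in> ?D. x [^] p \<in> ?D \<inter> U}"
  have sV: "subgroup ?V G" by (rule subgroup_Int[OF sD U(1)])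
  have Vc: "?V \<subseteq> carrier G" using Dc by blast
  have Kc: "?K \<subseteq> carrier G" using Dc by blast
  have fK: "finite (cosets G ?V ?K)"
  proof (rule cosets_inject(1)[OF fQ, where f = "\<lambda>x. x"])
    show "x \<otimes> inv y \<in> ?V" if "x \<in> ?K" "y \<in> ?K" "x \<otimes> inv y \<in> U" for x y
      using that subgroup_diff[OF sD] by auto
  qed (use U sV Dc in auto)
  obtain C where C: "finite C" "C \<subseteq> ?K" "?K \<subseteq> C <#> ?V" using finite_cosets_cover[OF fK Kc sV] .
  have Cc: "C \<subseteq> carrier G" using C Kc by blast
  have sP: "subgroup (pow_image G ?V p) G" using sV by (rule subgroup_pow_image)
  have "?V \<subseteq> pow_image G ?K p"
  proof
    fix x assume x: "x \<in> ?V"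
    then obtain y where "y \<in> ?D" "y [^] p = x"
      using divisible_part_greatest(1) p_pos unfolding divisible_subgroup_def by blast
    then show "x \<in> pow_image G ?K p" using x unfolding pow_image_def by blast
  qed
  also have "\<dots> \<subseteq> pow_image G C p <#> pow_image G ?V p"
    unfolding pow_image_set_mult[OF Cc Vc, symmetric] by (rule pow_image_mono[OF C(3)])
  finally have cover: "?V \<subseteq> pow_image G C p <#> pow_image G ?V p" .
  have "finite (pow_image G C p)" "pow_image G C p \<subseteq> carrier G"
    using C(1) Cc by (auto simp: pow_image_def)
  from cosets_finite_card(1)[OF this sP cover]
  have fV: "finite (cosets G (pow_image G ?V p) ?V)" .
  show ?thesis
  proof (rule S.finite_p_rank_if_open[of ?V])
    show "subgroup ?V (subgroup_of G ?D)" using subgroup_incl[OF sV sD] by simp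
    show "openin (subtopology T ?D) ?V" using openin_subtopology_Int2[OF U(2)] .
    show "compactin (subtopology T ?D) ?V"
      using compactin_closed_subset[OF U(3) closedin_Int[OF _ compactin_closedin[OF U(3)]]] D
      by (simp add: compactin_subtopology closed_subgroup_def)
  qed (use fV fK in simp_all)
qed

text \<open>The compact set of \<open>compact_cover_divisible_part\<close> maps onto the whole
  quotient.\<close>

lemma compact_space_Mod_divisible_part:
  assumes U: "subgroup U G" "openin T U" "compactin T U"
    and fQ: "finite (cosets G U {x \<in> carrier G. x [^] p \<in> U})"
  shows "compact_space (quotient_topology G T (divisible_part G))"
proof -
  let ?D = "divisible_part G" and ?q = "\<lambda>x. divisible_part G #> x"
  have sD: "subgroup ?D G" using divisible_part_eq(2)[OF assms] by (simp add: closed_subgroup_def)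
  obtain Q where Q: "compactin T Q" "carrier G = Q <#> ?D" using compact_cover_divisible_part[OF assms] .
  have qm: "quotient_map T (quotient_topology G T ?D) ?q" by (rule quotient_map_quotient_topology)
  have "?q ` carrier G \<subseteq> ?q ` Q"
  proof (rule image_subsetI)
    fix x assume "x \<in> carrier G"
    then obtain a d where ad: "a \<in> Q" "d \<in> ?D" "x = a \<otimes> d" unfolding Q(2) by (rule set_multE)
    have c: "a \<in> carrier G" "d \<in> carrier G" using ad compactin_carrier[OF Q(1)] subgroup.mem_carrier[OF sD] by auto
    then have "x \<otimes> inv a = d" using ad(3) by (simp add: m_comm)
    then have "?q x = ?q a" using rcos_eq_iff[OF sD, of x a] c ad by simp
    then show "?q x \<in> ?q ` Q" using ad(1) by blast
  qed
  then have "?q ` carrier G = ?q ` Q"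
    using image_mono[OF compactin_carrier[OF Q(1)], of ?q] by (rule subset_antisym)
  then have "topspace (quotient_topology G T ?D) = ?q ` Q"
    using quotient_imp_surjective_map[OF qm] by (simp add: topspace_eq)
  then show ?thesis
    using image_compactin[OF Q(1) quotient_imp_continuous_map[OF qm]] by (simp add: compact_space_def)
qed

end

theorem theorem1p1:
  fixes G :: "('a, 'm) monoid_scheme" and T :: "'a topology" and p :: nat
  assumes "lca_p_group G T p"
  shows "(topologically_modular G T \<longleftrightarrow>
      (\<forall>U. subgroup U G \<and> openin T U \<and> compactin T U \<longrightarrow>
        (let
           b1 =
             (finite_p_rank (subgroup_of G U) (subtopology T U) \<and>
              subtopology T (tor G) = discrete_topology (tor G) \<and>
              finite_p_rank (G Mod tor G) (quotient_topology G T (tor G)));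
           b2 =
             (infinite_p_rank (subgroup_of G U) (subtopology T U) \<and>
              closedin T (divisible_part G) \<and>
              finite_p_rank (G Mod U) (quotient_topology G T U) \<and>
              finite_p_rank (subgroup_of G (divisible_part G)) (subtopology T (divisible_part G)) \<and>
              compact_space (quotient_topology G T (divisible_part G)))
         in (b1 \<or> b2) \<and> \<not> (b1 \<and> b2)))) \<and>
    (topologically_modular G T \<longleftrightarrow> strongly_topologically_quasihamiltonian G T)"
proof -
  interpret linear_p_group G T p using assms by (rule lca_p_group.linear_p_group)
  let ?fU = "\<lambda>U. finite (cosets G (pow_image G U p) U)"
    and ?fQ = "\<lambda>U. finite (cosets G U {x \<in> carrier G. x [^]\<^bsub>G\<^esub> p \<in> U})"
  have ac: "topologically_modular G T \<longleftrightarrow> strongly_topologically_quasihamiltonian G T"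
    using topologically_modular_if_quasihamiltonian quasihamiltonian_if_topologically_modular by blast
  \<comment> \<open>For closed sums the alternative at one compact open subgroup suffices, whereas
    closed sums give it at every \<open>U\<close>; a single \<open>U0\<close> therefore closes the
    circle.\<close>
  obtain U0 where U0: "subgroup U0 G" "openin T U0" "compactin T U0" by (rule compact_open_subgroup)
  have suff: "strongly_topologically_quasihamiltonian G T" if "?fU U0 \<or> ?fQ U0"
    unfolding strongly_topologically_quasihamiltonian_def
    using that closedin_set_mult_if_noetherian[OF U0] closedin_set_mult_if_artinian[OF U0] by blast
  have b: "subtopology T (tor G) = discrete_topology (tor G)" "finite_p_rank (G Mod tor G) (quotient_topology G T (tor G))"
    if "subgroup U G" "openin T U" "compactin T U" "?fU U" for U
    using tor_discrete_closed(1)[OF that] finite_p_rank_Mod_tor[OF that] by blast+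
  have b': "closedin T (divisible_part G)"
    "finite_p_rank (subgroup_of G (divisible_part G)) (subtopology T (divisible_part G))"
    "compact_space (quotient_topology G T (divisible_part G))"
    if "subgroup U G" "openin T U" "compactin T U" "?fQ U" for U
    using divisible_part_eq(2)[OF that] finite_p_rank_divisible_part[OF that] compact_space_Mod_divisible_part[OF that]
    by (auto simp: closed_subgroup_def)
  define b1 where "b1 U \<longleftrightarrow> finite_p_rank (subgroup_of G U) (subtopology T U) \<and>
    subtopology T (tor G) = discrete_topology (tor G) \<and>
    finite_p_rank (G Mod tor G) (quotient_topology G T (tor G))" for U
  define b2 where "b2 U \<longleftrightarrow> infinite_p_rank (subgroup_of G U) (subtopology T U) \<and>
    closedin T (divisible_part G) \<and>
    finite_p_rank (G Mod U) (quotient_topology G T U) \<and>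
    finite_p_rank (subgroup_of G (divisible_part G)) (subtopology T (divisible_part G)) \<and>
    compact_space (quotient_topology G T (divisible_part G))" for U
  \<comment> \<open>The clauses on \<open>tor G\<close> and \<open>divisible_part G\<close> are
    consequences of the two finiteness conditions, so both alternatives reduce to these, and
    \<open>\<not> ?fU U\<close> in the second makes them exclusive.\<close>
  have "b1 U \<longleftrightarrow> ?fU U" "b2 U \<longleftrightarrow> \<not> ?fU U \<and> ?fQ U"
    if U: "subgroup U G" "openin T U" "compactin T U" for U
    unfolding b1_def b2_def finite_p_rank_subgroup_iff[OF U(1,3)] finite_p_rank_Mod_open_iff[OF U(1,2)]
    using b[OF U] b'[OF U] by blast+
  then show ?thesis
    unfolding ac Let_def b1_def[symmetric] b2_def[symmetric]
    using finite_dichotomy suff U0 by blast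
qed

end
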